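(* Let $K$ be a field, $E$ an elliptic curve over $K$ given by a Weierstrass equation, and $m\geq 2$ an integer coprime to $\mathrm{char}(K)$ when $\mathrm{char}(K)>0$. Let $P_1=(x_1,y_1)$, $P_2=(x_2,y_2)$ be a $\mathbb{Z}/m\mathbb{Z}$-basis of $E[m]$ and $\zeta_m:=e_m(P_1,P_2)$. Then $K(x_1,x_2,\zeta_m)=K(x_1,x_2,y_1y_2)$.
   Context: $E[m]$ is the $m$-torsion subgroup of $E(\overline{K})$; $e_m$ is the Weil pairing on $E[m]$, so $\zeta_m$ is a primitive $m$-th root of unity.
   Formalization: The Weierstrass equation is taken in the form y² = x³+a2x²+a4x+a6 (no xy or y term, hence char(K) ≠ 2); for general Weierstrass equations the claim fails, e.g. y²+2y = x³+1 over Q with m = 3. *)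

theory Defs
  imports "HOL-Algebra.Algebraic_Closure_Type" "HOL-Algebra.Generated_Fields"
begin

section \<open>Weierstrass curves and their group law\<close>

text \<open>\<open>Weierstrass a\<^sub>1 a\<^sub>2 a\<^sub>3 a\<^sub>4 a\<^sub>6\<close> stands for
  \<open>y\<^sup>2 + a\<^sub>1 x y + a\<^sub>3 y = x\<^sup>3 + a\<^sub>2 x\<^sup>2 + a\<^sub>4 x + a\<^sub>6\<close>; the generated map function is base change of
  the coefficients.\<close>

datatype 'a weierstrass = Weierstrass (wa1: 'a) (wa2: 'a) (wa3: 'a) (wa4: 'a) (wa6: 'a)

definition discriminant :: "'a::field weierstrass \<Rightarrow> 'a" where
  "discriminant E =
    (let b2 = wa1 E ^ 2 + 4 * wa2 E;
         b4 = 2 * wa4 E + wa1 E * wa3 E;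
         b6 = wa3 E ^ 2 + 4 * wa6 E;
         b8 = wa1 E ^ 2 * wa6 E + 4 * wa2 E * wa6 E - wa1 E * wa3 E * wa4 E
              + wa2 E * wa3 E ^ 2 - wa4 E ^ 2
     in - (b2 ^ 2) * b8 - 8 * b4 ^ 3 - 27 * b6 ^ 2 + 9 * b2 * b4 * b6)"

definition elliptic_curve :: "'a::field weierstrass \<Rightarrow> bool" where
  "elliptic_curve E \<longleftrightarrow> discriminant E \<noteq> 0"

datatype 'a point = Infinity | Affine 'a 'a

definition on_curve :: "'a::field weierstrass \<Rightarrow> 'a \<Rightarrow> 'a \<Rightarrow> bool" where
  "on_curve E x y \<longleftrightarrow>
    y ^ 2 + wa1 E * x * y + wa3 E * y = x ^ 3 + wa2 E * x ^ 2 + wa4 E * x + wa6 E"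

definition points :: "'a::field weierstrass \<Rightarrow> 'a point set" where
  "points E = insert Infinity {Affine x y | x y. on_curve E x y}"

fun add_pt :: "'a::field weierstrass \<Rightarrow> 'a point \<Rightarrow> 'a point \<Rightarrow> 'a point" where
  "add_pt E Infinity Q = Q"
| "add_pt E P Infinity = P"
| "add_pt E (Affine x1 y1) (Affine x2 y2) =
    (if x1 = x2 \<and> y1 + y2 + wa1 E * x2 + wa3 E = 0 then Infinity
     else
       let l = (if x1 = x2
                then (3 * x1 ^ 2 + 2 * wa2 E * x1 + wa4 E - wa1 E * y1) / (2 * y1 + wa1 E * x1 + wa3 E)
                else (y2 - y1) / (x2 - x1));
           x3 = l ^ 2 + wa1 E * l - wa2 E - x1 - x2
       in Affine x3 (- (l + wa1 E) * x3 - (y1 - l * x1) - wa3 E))"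

definition mult_pt :: "'a::field weierstrass \<Rightarrow> nat \<Rightarrow> 'a point \<Rightarrow> 'a point" where
  "mult_pt E n P = (add_pt E P ^^ n) Infinity"

text \<open>All torsion points over the base field at hand; it is the full group \<open>E[m]\<close> only when that
  field is algebraically closed.\<close>

definition torsion :: "'a::field weierstrass \<Rightarrow> nat \<Rightarrow> 'a point set" where
  "torsion E m = {P \<in> points E. mult_pt E m P = Infinity}"

text \<open>Natural numbers represent the residue classes of \<open>\<int>/m\<int>\<close>: \<open>P, Q\<close> generate \<open>E[m]\<close> and are
  linearly independent over \<open>\<int>/m\<int>\<close>.\<close>

definition torsion_basis :: "'a::field weierstrass \<Rightarrow> nat \<Rightarrow> 'a point \<Rightarrow> 'a point \<Rightarrow> bool" where
  "torsion_basis E m P Q \<longleftrightarrow>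
    P \<in> torsion E m \<and> Q \<in> torsion E m \<and>
    (\<forall>R\<in>torsion E m. \<exists>a b. R = add_pt E (mult_pt E a P) (mult_pt E b Q)) \<and>
    (\<forall>a b. add_pt E (mult_pt E a P) (mult_pt E b Q) = Infinity \<longrightarrow> m dvd a \<and> m dvd b)"


section \<open>Rational functions and their orders of vanishing\<close>

text \<open>An element of \<open>'a poly poly\<close> is a polynomial in \<open>y\<close> with coefficients in \<open>F[x]\<close>. A nonzero
  rational function on the curve is a quotient \<open>u/v\<close> of two such polynomials, neither of which is
  divisible by the Weierstrass polynomial.\<close>

definition eval2 :: "'a::field poly poly \<Rightarrow> 'a \<Rightarrow> 'a \<Rightarrow> 'a" where
  "eval2 u x y = poly (poly u [:y:]) x"

definition weierstrass_poly :: "'a::field weierstrass \<Rightarrow> 'a poly poly" where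
  "weierstrass_poly E = [:- [:wa6 E, wa4 E, wa2 E, 1:], [:wa3 E, wa1 E:], 1:]"

definition nonzero_on :: "'a::field weierstrass \<Rightarrow> 'a poly poly \<Rightarrow> bool" where
  "nonzero_on E u \<longleftrightarrow> \<not> weierstrass_poly E dvd u"

text \<open>The class of \<open>u\<close> lies in the \<open>n\<close>-th power of the maximal ideal of the local ring of the curve
  at \<open>(x\<^sub>0, y\<^sub>0)\<close>; the factor \<open>s\<close> is the denominator coming from the localization.\<close>

definition in_max_ideal_power ::
    "'a::field weierstrass \<Rightarrow> 'a \<Rightarrow> 'a \<Rightarrow> nat \<Rightarrow> 'a poly poly \<Rightarrow> bool" where
  "in_max_ideal_power E x0 y0 n u \<longleftrightarrow>
    (\<exists>s h c. eval2 s x0 y0 \<noteq> 0 \<and>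
      s * u = h * weierstrass_poly E + (\<Sum>i\<le>n. c i * [:[:- x0, 1:]:] ^ i * [:[:- y0:], 1:] ^ (n - i)))"

text \<open>At infinity, \<open>u\<close> is first reduced to \<open>A(x) + B(x) y\<close> modulo the Weierstrass polynomial, which
  is monic in \<open>y\<close>. As \<open>x\<close> and \<open>y\<close> have poles of order \<open>2\<close> and \<open>3\<close>, the pole orders of
  \<open>A(x)\<close> and \<open>B(x) y\<close> have different parity and the larger one is that of the sum.\<close>

fun ord_at :: "'a::field weierstrass \<Rightarrow> 'a point \<Rightarrow> 'a poly poly \<Rightarrow> int" where
  "ord_at E (Affine x y) u = int (GREATEST n. in_max_ideal_power E x y n u)"
| "ord_at E Infinity u =
    (let r = pseudo_mod u (weierstrass_poly E);
         A = Polynomial.coeff r 0;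
         B = Polynomial.coeff r 1
     in - int (max (2 * Polynomial.degree A) (if B = 0 then 0 else 2 * Polynomial.degree B + 3)))"

text \<open>The divisor of \<open>u/v\<close> is \<open>D\<close>, given by its multiplicities.\<close>

definition has_divisor ::
    "'a::field weierstrass \<Rightarrow> 'a poly poly \<Rightarrow> 'a poly poly \<Rightarrow> ('a point \<Rightarrow> int) \<Rightarrow> bool" where
  "has_divisor E u v D \<longleftrightarrow>
    nonzero_on E u \<and> nonzero_on E v \<and> (\<forall>P\<in>points E. ord_at E P u - ord_at E P v = D P)"


section \<open>The Weil pairing\<close>

text \<open>The definition of Silverman (The Arithmetic of Elliptic Curves, III.8), over an algebraically
  closed field: choose \<open>T'\<close> with \<open>m T' = T\<close> and \<open>g = u/v\<close> with
  \<open>div g = [m]\<^sup>*(T) - [m]\<^sup>*(O) = \<Sum>R\<in>E[m]. (T' + R) - (R)\<close>; then \<open>e\<^sub>m(S, T) = g(X + S) / g(X)\<close> for any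
  point \<open>X\<close> such that both values are defined and nonzero.\<close>

definition weil_divisor ::
    "'a::field weierstrass \<Rightarrow> nat \<Rightarrow> 'a point \<Rightarrow> 'a point \<Rightarrow> int" where
  "weil_divisor E m T' P =
    (\<Sum>R\<in>torsion E m. of_bool (P = add_pt E T' R) - of_bool (P = R))"

definition weil_pairing ::
    "'a::field weierstrass \<Rightarrow> nat \<Rightarrow> 'a point \<Rightarrow> 'a point \<Rightarrow> 'a" where
  "weil_pairing E m S T =
    (THE c. \<exists>T' u v x y x' y'.
      T' \<in> points E \<and> mult_pt E m T' = T \<and>
      has_divisor E u v (weil_divisor E m T') \<and>
      on_curve E x y \<and> add_pt E (Affine x y) S = Affine x' y' \<and>
      eval2 u x y \<noteq> 0 \<and> eval2 v x y \<noteq> 0 \<and> eval2 u x' y' \<noteq> 0 \<and> eval2 v x' y' \<noteq> 0 \<and>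
      c = (eval2 u x' y' / eval2 v x' y') / (eval2 u x y / eval2 v x y))"


section \<open>Adjoining elements inside the algebraic closure\<close>

definition adjoin :: "'k::field alg_closure set \<Rightarrow> 'k alg_closure set" where
  "adjoin S = generate_field ring_of_type_algebra (range to_ac \<union> S)"

end

theory Submission
  imports Defs
begin

text \<open>Over the algebraically closed field, functions on the curve \<open>y\<^sup>2 = f(x)\<close> are handled through their
  orders of vanishing. The norm \<open>A\<^sup>2 - f B\<^sup>2\<close> of \<open>A + B y\<close> never has degree one, so a point is determined by
  the class of its divisor; with the divisors of lines this yields the group law, and translations preserve
  orders because a valuation of the function field is a multiple of the order at the point it is centred at.
  Hence the function \<open>g\<close> in the definition of the Weil pairing exists and \<open>g(X + S)/g(X)\<close> is a constant,
  multiplicative in \<open>S\<close>, inverted by \<open>T \<mapsto> -T\<close>, and compatible with field automorphisms.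

  For \<open>m \<ge> 3\<close> the value \<open>\<zeta> = e\<^sub>m(P\<^sub>1, P\<^sub>2)\<close> satisfies \<open>\<zeta>\<^sup>2 \<noteq> 1\<close>. An automorphism over \<open>K(x\<^sub>1, x\<^sub>2)\<close> maps
  \<open>P\<^sub>i\<close> to \<open>\<plusminus>P\<^sub>i\<close>; it fixes \<open>y\<^sub>1 y\<^sub>2\<close> if and only if the two signs agree, if and only if it fixes \<open>\<zeta>\<close>.
  As \<open>\<zeta>\<close> and \<open>y\<^sub>1 y\<^sub>2\<close> are separable over \<open>K(x\<^sub>1, x\<^sub>2)\<close>, they generate the same field. For \<open>m = 2\<close> one has
  \<open>y\<^sub>1 = y\<^sub>2 = 0\<close> and \<open>\<zeta> = \<plusminus>1\<close>.\<close>

text \<open>The costliest fact is \<open>wp P1 P2 ^ 2 \<noteq> 1\<close>. If the square were 1, a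
  product of two translates of g would be invariant under E[m], with simple zeros on one coset and
  simple poles on another. Such a G separates the cosets of E[m], so G(-p) is an affine function of
  G(p). Evaluating at points p for which m p equals, or differs from, its negative contradicts
  characteristic different from 2. A second obstacle is a point T' with m T' = T. A nonconstant
  rational function takes almost every value, so the multiples m p form a subgroup with finite
  complement, and such a subgroup is everything. Functions agreeing off a finite set are identified,
  because translation by S is then literally composition with p \<mapsto> p + S. The price is that a
  value at a point has to be recovered from orders: it is the c for which h - c has positive order
  there. The step from automorphisms to fields is the following: an element that is a simple root of
  a polynomial over F and is fixed by all automorphisms over F lies in F. Such automorphisms are
  produced by extending graphs of partial embeddings with Zorn's lemma.\<close>

section \<open>Preliminaries on polynomials over algebraically closed fields\<close>

text \<open>As in Euclid's argument on primes: over a finite field the product of all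
  \<open>[:-a, 1:]\<close>, plus 1, would be nonconstant and take the value 1 everywhere.\<close>

lemma infinite_UNIV_alg_closed: "infinite (UNIV :: 'a::alg_closed_field set)"
proof
  assume fin: "finite (UNIV :: 'a set)"
  define p :: "'a poly" where "p = (\<Prod>a\<in>UNIV. [:-a, 1:])"
  have deg: "degree p = card (UNIV :: 'a set)"
    unfolding p_def by (subst degree_prod_eq_sum_degree) auto
  have "card (UNIV :: 'a set) > 0"
    using fin by (simp add: card_gt_0_iff)
  then have "degree (p + 1) > 0"
    using deg by (simp add: degree_add_eq_left)
  then obtain x where "poly (p + 1) x = 0"
    using alg_closed_imp_poly_has_root by blast
  moreover have "poly p x = 0"
    unfolding p_def by (auto simp: poly_prod fin intro!: prod_zero)
  ultimately show False by simp
qed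

text \<open>Dividing by the smaller of the two orders at \<open>a\<close> makes one cofactor nonzero
  there. This reduces A + B y to the case in which A and B do not both vanish at the abscissa of a
  point.\<close>

lemma common_linear_factor:
  fixes A B :: "'a::field poly"
  assumes "A \<noteq> 0 \<or> B \<noteq> 0"
  obtains k A' B' where "A = [:-a, 1:] ^ k * A'" "B = [:-a, 1:] ^ k * B'"
    "poly A' a \<noteq> 0 \<or> poly B' a \<noteq> 0"
proof -
  have *: "\<exists>k P' Q'. P = [:-a, 1:] ^ k * P' \<and> Q = [:-a, 1:] ^ k * Q' \<and> poly P' a \<noteq> 0"
    if "P \<noteq> 0" "Q = 0 \<or> order a P \<le> order a Q" for P Q :: "'a poly"
  proof -
    obtain P' where P': "P = [:-a, 1:] ^ order a P * P'" "\<not> [:-a, 1:] dvd P'"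
      using order_decomp[of P a] \<open>P \<noteq> 0\<close> by blast
    have "[:-a, 1:] ^ order a P dvd Q"
      using \<open>Q = 0 \<or> order a P \<le> order a Q\<close> by (metis dvd_0_right order_divides)
    then obtain Q' where "Q = [:-a, 1:] ^ order a P * Q'"
      by (elim dvdE)
    moreover have "poly P' a \<noteq> 0"
      using P'(2) by (simp add: poly_eq_0_iff_dvd)
    ultimately show ?thesis using P'(1) by blast
  qed
  show ?thesis
  proof (cases "A \<noteq> 0 \<and> (B = 0 \<or> order a A \<le> order a B)")
    case True
    with *[of A B] that show ?thesis by blast
  next
    case False
    then have "B \<noteq> 0" "A = 0 \<or> order a B \<le> order a A"
      using assms by auto
    with *[of B A] that show ?thesis by blast
  qed
qed

section \<open>The curve y^2 = f(x) and its points\<close>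

locale weierstrass_curve =
  fixes E :: "'a::alg_closed_field weierstrass"
  assumes a1: "wa1 E = 0" and a3: "wa3 E = 0" and disc: "discriminant E \<noteq> 0"
begin

definition f :: "'a poly" where
  "f = [:wa6 E, wa4 E, wa2 E, 1:]"

lemma poly_f: "poly f x = x ^ 3 + wa2 E * x ^ 2 + wa4 E * x + wa6 E"
  by (simp add: f_def algebra_simps power2_eq_square power3_eq_cube)

lemma degree_f: "degree f = 3"
  by (simp add: f_def)

lemma f_neq_0 [simp]: "f \<noteq> 0"
  by (simp add: f_def)

lemma on_curve_iff: "on_curve E x y \<longleftrightarrow> y ^ 2 = poly f x"
  by (simp add: on_curve_def a1 a3 poly_f)

text \<open>The second factor is the discriminant of the cubic \<open>f\<close>. The factor 16
  excludes characteristic 2, the other one excludes double roots.\<close>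

lemma discriminant_eq:
  "discriminant E = 16 * (18 * wa2 E * wa4 E * wa6 E + wa2 E ^ 2 * wa4 E ^ 2
     - 4 * wa2 E ^ 3 * wa6 E - 4 * wa4 E ^ 3 - 27 * wa6 E ^ 2)"
  unfolding discriminant_def Let_def a1 a3 by (simp, Groebner_Basis.algebra)

lemma two_neq_0: "(2::'a) \<noteq> 0"
proof
  assume "(2::'a) = 0"
  moreover have "(16::'a) = 2 * 8" by simp
  ultimately have "(16::'a) = 0" by (metis mult_zero_left)
  then show False using disc discriminant_eq by simp
qed

lemma double_eq_0_iff: "(x::'a) + x = 0 \<longleftrightarrow> x = 0"
  using two_neq_0 by (metis mult_2 mult_eq_0_iff)

lemma eq_minus_self_iff: "(x::'a) = - x \<longleftrightarrow> x = 0"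
  using double_eq_0_iff by (metis add_eq_0_iff2 neg_equal_0_iff_equal)

text \<open>The equations f(x) = 0 and f'(x) = 0 express \<open>wa6 E\<close> and
  \<open>wa4 E\<close> through x and \<open>wa2 E\<close>; after this substitution the discriminant
  vanishes identically.\<close>

lemma pderiv_f_neq_0:
  assumes "poly f x = 0"
  shows "3 * x ^ 2 + 2 * wa2 E * x + wa4 E \<noteq> 0"
proof
  assume d: "3 * x ^ 2 + 2 * wa2 E * x + wa4 E = 0"
  have a4: "wa4 E = - (3 * x ^ 2 + 2 * wa2 E * x)"
    using d by Groebner_Basis.algebra
  have a6: "wa6 E = - (x ^ 3 + wa2 E * x ^ 2 + wa4 E * x)"
    using assms unfolding poly_f by Groebner_Basis.algebra
  have "discriminant E = 0"
    unfolding discriminant_eq a6 a4 by Groebner_Basis.algebra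
  then show False using disc by simp
qed

text \<open>Smoothness at the points of order two: as the root is simple, y and not x - a is the
  local parameter there.\<close>

lemma f_root_decomp:
  assumes "poly f a = 0"
  obtains q where "f = [:-a, 1:] * q" "poly q a \<noteq> 0"
proof -
  obtain q where q: "f = [:-a, 1:] * q"
    using assms by (auto simp: poly_eq_0_iff_dvd elim: dvdE)
  have "poly (pderiv f) a = 3 * a ^ 2 + 2 * wa2 E * a + wa4 E"
    by (simp add: f_def pderiv_pCons algebra_simps power2_eq_square)
  then have "poly (pderiv f) a \<noteq> 0"
    using pderiv_f_neq_0[OF assms] by simp
  moreover have "poly (pderiv f) a = poly q a"
    unfolding q by (subst pderiv_mult) (simp add: pderiv_pCons)
  ultimately show ?thesis using that q by metis
qed

lemma sqrt_f_exists: "\<exists>y. on_curve E x y"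
  using nth_root_exists[of 2 "poly f x"] by (auto simp: on_curve_iff)

lemma points_cases:
  assumes "P \<in> points E"
  obtains "P = Infinity" | x y where "P = Affine x y" "on_curve E x y"
  using assms by (auto simp: points_def)

lemma Affine_in_points [simp]: "Affine x y \<in> points E \<longleftrightarrow> on_curve E x y"
  by (auto simp: points_def)

lemma Infinity_in_points [simp]: "Infinity \<in> points E"
  by (auto simp: points_def)

lemma infinite_points: "infinite (points E)"
proof
  assume fin: "finite (points E)"
  obtain s where s: "\<And>x. on_curve E x (s x)"
    using sqrt_f_exists by metis
  have "range (\<lambda>x. Affine x (s x)) \<subseteq> points E"
    using s by auto
  then have "finite (range (\<lambda>x. Affine x (s x)))"
    using fin finite_subset by blast
  moreover have "inj (\<lambda>x. Affine x (s x))"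
    by (auto simp: inj_def)
  ultimately show False
    using finite_imageD infinite_UNIV_alg_closed by blast
qed

lemma finite_points_over:
  assumes "finite S"
  shows "finite {Affine x y | x y. on_curve E x y \<and> x \<in> S}"
proof -
  have "finite (\<Union>x\<in>S. Affine x ` {y. poly [:- poly f x, 0, 1:] y = 0})"
    using assms by (intro finite_UN_I finite_imageI poly_roots_finite) auto
  moreover have "{Affine x y | x y. on_curve E x y \<and> x \<in> S} \<subseteq>
      (\<Union>x\<in>S. Affine x ` {y. poly [:- poly f x, 0, 1:] y = 0})"
    by (auto simp: on_curve_iff power2_eq_square)
  ultimately show ?thesis by (rule rev_finite_subset)
qed

subsection \<open>Functions up to finitely many points\<close>

text \<open>A rational function is represented by any function on points that agrees with a quotient of
  polynomials at all but finitely many points of the curve; this makes translation a literal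
  composition.\<close>

definition gen :: "'a point filter" where
  "gen = inf cofinite (principal (points E))"

abbreviation ev :: "('a point \<Rightarrow> bool) \<Rightarrow> bool" where
  "ev Q \<equiv> eventually Q gen"

lemma ev_iff: "ev Q \<longleftrightarrow> finite {p \<in> points E. \<not> Q p}"
  unfolding gen_def eventually_inf_principal eventually_cofinite
  by (rule arg_cong[where f = finite]) auto

lemma gen_neq_bot: "gen \<noteq> bot"
  using infinite_points by (simp add: trivial_limit_def ev_iff)

lemma ev_const [simp]: "ev (\<lambda>p. c) \<longleftrightarrow> c"
  using gen_neq_bot by (auto simp: eventually_const_iff)

lemma ev_points: "ev (\<lambda>p. p \<in> points E)"
  by (simp add: ev_iff)

lemma ev_neq: "ev (\<lambda>p. p \<noteq> q)"
  unfolding ev_iff by (rule finite_subset[of _ "{q}"]) auto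

lemma ev_notin_finite: "finite S \<Longrightarrow> ev (\<lambda>p. p \<notin> S)"
  unfolding ev_iff by (rule finite_subset[of _ S]) auto

lemma ev_affine: "ev (\<lambda>p. \<exists>x y. p = Affine x y \<and> on_curve E x y)"
  using eventually_conj[OF ev_points ev_neq[of Infinity]]
  by eventually_elim (auto elim!: points_cases)

lemma ev_affineI:
  assumes "\<And>x y. on_curve E x y \<Longrightarrow> Q (Affine x y)"
  shows "ev Q"
  using ev_affine by eventually_elim (use assms in auto)

lemma ev_ex: "ev Q \<Longrightarrow> \<exists>x y. on_curve E x y \<and> Q (Affine x y)"
  using eventually_happens'[OF gen_neq_bot eventually_conj[OF ev_affine]] by blast

text \<open>The element A + B y of the coordinate ring. The value at \<open>Infinity\<close> is a
  default, which \<open>ev\<close> ignores like any finite set of points.\<close>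

fun reg :: "'a poly \<Rightarrow> 'a poly \<Rightarrow> 'a point \<Rightarrow> 'a" where
  "reg A B Infinity = 0"
| "reg A B (Affine x y) = poly A x + poly B x * y"

text \<open>Agreement is required at every affine point, so that a regular function can be evaluated
  at a prescribed one; only its value at \<open>Infinity\<close> is arbitrary.\<close>

definition isreg :: "('a point \<Rightarrow> 'a) \<Rightarrow> bool" where
  "isreg h \<longleftrightarrow> (\<exists>A B. \<forall>x y. on_curve E x y \<longrightarrow> h (Affine x y) = reg A B (Affine x y))"

fun xc :: "'a point \<Rightarrow> 'a" where "xc Infinity = 0" | "xc (Affine x y) = x"
fun yc :: "'a point \<Rightarrow> 'a" where "yc Infinity = 0" | "yc (Affine x y) = y"

text \<open>The norm from the function field down to F(x), the product of A + B y with its conjugate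
  A - B y.\<close>

definition nrm :: "'a poly \<Rightarrow> 'a poly \<Rightarrow> 'a poly" where
  "nrm A B = A ^ 2 - f * B ^ 2"

lemma reg_mult:
  assumes "on_curve E x y"
  shows "reg A B (Affine x y) * reg C D (Affine x y) =
    reg (A * C + f * B * D) (A * D + B * C) (Affine x y)"
proof -
  have "y * y = poly f x" using assms by (simp add: on_curve_iff power2_eq_square)
  then show ?thesis by (simp add: algebra_simps flip: \<open>y * y = poly f x\<close>)
qed

lemma nrm_mult: "nrm (A * C + f * B * D) (A * D + B * C) = nrm A B * nrm C D"
  unfolding nrm_def by Groebner_Basis.algebra

lemma reg_conj:
  assumes "on_curve E x y"
  shows "reg A B (Affine x y) * reg A (- B) (Affine x y) = poly (nrm A B) x"
proof -
  have "y * y = poly f x" using assms by (simp add: on_curve_iff power2_eq_square)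
  then show ?thesis by (simp add: nrm_def algebra_simps power2_eq_square flip: \<open>y * y = poly f x\<close>)
qed

text \<open>The degrees 2 deg A and 2 deg B + 3 differ in parity, so the leading terms of A^2 and f
  B^2 cannot cancel.\<close>

lemma degree_nrm:
  assumes "A \<noteq> 0 \<or> B \<noteq> 0"
  shows "nrm A B \<noteq> 0"
    "degree (nrm A B) = max (2 * degree A) (if B = 0 then 0 else 2 * degree B + 3)"
proof -
  have *: "nrm A B \<noteq> 0 \<and> degree (nrm A B) = max (2 * degree A) (if B = 0 then 0 else 2 * degree B + 3)"
  proof (cases "B = 0")
    case True
    with assms show ?thesis by (simp add: nrm_def degree_power_eq)
  next
    case False
    then have d: "degree (f * B ^ 2) = 2 * degree B + 3"
      by (simp add: degree_mult_eq degree_power_eq degree_f)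
    have dA: "degree (A ^ 2) = 2 * degree A"
      by (cases "A = 0") (simp_all add: degree_power_eq)
    have "degree (A ^ 2) \<noteq> degree (f * B ^ 2)"
      unfolding d dA by presburger
    then have dn: "degree (nrm A B) = max (degree (A ^ 2)) (degree (f * B ^ 2))"
      unfolding nrm_def diff_conv_add_uminus
      using degree_add_eq_left[of "- (f * B ^ 2)" "A ^ 2"] degree_add_eq_right[of "A ^ 2" "- (f * B ^ 2)"]
      by (auto simp: neq_iff max_def)
    then have "degree (nrm A B) > 0" using d by linarith
    then have "nrm A B \<noteq> 0" by (metis degree_0 less_nat_zero_code)
    with dn d dA False show ?thesis by simp
  qed
  then show "nrm A B \<noteq> 0"
    "degree (nrm A B) = max (2 * degree A) (if B = 0 then 0 else 2 * degree B + 3)" by blast+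
qed

text \<open>The ultrametric inequality at infinity, once the degree of the norm is read as a pole
  order.\<close>

lemma degree_nrm_add_le:
  assumes "A + C \<noteq> 0 \<or> B + D \<noteq> 0"
  shows "degree (nrm (A + C) (B + D)) \<le> max (degree (nrm A B)) (degree (nrm C D))"
proof -
  have *: "2 * degree A \<le> degree (nrm A B)" "B \<noteq> 0 \<Longrightarrow> 2 * degree B + 3 \<le> degree (nrm A B)" for A B
    using degree_nrm(2)[of A B] by (cases "A \<noteq> 0 \<or> B \<noteq> 0"; simp)+
  have a: "2 * degree (A + C) \<le> max (degree (nrm A B)) (degree (nrm C D))"
    using degree_add_le_max[of A C] *(1)[of A B] *(1)[of C D] by linarith
  have b: "2 * degree (B + D) + 3 \<le> max (degree (nrm A B)) (degree (nrm C D))" if "B + D \<noteq> 0"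
  proof (cases "B = 0 \<or> D = 0")
    case True
    then show ?thesis using that *(2)[of B A] *(2)[of D C] by (auto simp: le_max_iff_disj)
  next
    case False
    then show ?thesis
      using degree_add_le_max[of B D] *(2)[of B A] *(2)[of D C] by linarith
  qed
  show ?thesis
    using a b degree_nrm(2)[OF assms] by auto
qed

text \<open>Zeros of A + B y lie above the roots of its norm, a nonzero polynomial in x.\<close>

lemma ev_reg_neq_0:
  assumes "A \<noteq> 0 \<or> B \<noteq> 0"
  shows "ev (\<lambda>p. reg A B p \<noteq> 0)"
proof -
  have "finite {x. poly (nrm A B) x = 0}"
    using degree_nrm(1)[OF assms] by (rule poly_roots_finite)
  from finite_points_over[OF this]
  have "ev (\<lambda>p. p \<notin> {Affine x y | x y. on_curve E x y \<and> x \<in> {x. poly (nrm A B) x = 0}})"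
    by (rule ev_notin_finite)
  with ev_affine show ?thesis
  proof eventually_elim
    case (elim p)
    then obtain x y where p: "p = Affine x y" "on_curve E x y" "poly (nrm A B) x \<noteq> 0" by auto
    with reg_conj[OF p(2), of A B] show ?case by auto
  qed
qed

lemma isregI: "(\<And>x y. on_curve E x y \<Longrightarrow> h (Affine x y) = reg A B (Affine x y)) \<Longrightarrow> isreg h"
  unfolding isreg_def by blast

lemma isreg_obtain:
  assumes "isreg h"
  obtains A B where "\<And>x y. on_curve E x y \<Longrightarrow> h (Affine x y) = reg A B (Affine x y)"
    "ev (\<lambda>p. h p = reg A B p)"
proof -
  from assms obtain A B where *: "\<And>x y. on_curve E x y \<Longrightarrow> h (Affine x y) = reg A B (Affine x y)"
    unfolding isreg_def by blast
  moreover have "ev (\<lambda>p. h p = reg A B p)"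
    by (rule ev_affineI) (use * in auto)
  ultimately show ?thesis using that by blast
qed

named_theorems isreg_intros

lemma isreg_reg [isreg_intros]: "isreg (reg A B)"
  by (rule isregI) simp

lemma isreg_poly [isreg_intros]: "isreg (\<lambda>p. poly A (xc p))"
  by (rule isregI[of _ A 0]) simp

lemma isreg_const [isreg_intros]: "isreg (\<lambda>p. c)"
  by (rule isregI[of _ "[:c:]" 0]) simp

lemma isreg_xc [isreg_intros]: "isreg xc"
  by (rule isregI[of _ "[:0, 1:]" 0]) simp

lemma isreg_yc [isreg_intros]: "isreg yc"
  by (rule isregI[of _ 0 1]) simp

lemma isreg_add [isreg_intros]: "isreg h \<Longrightarrow> isreg k \<Longrightarrow> isreg (\<lambda>p. h p + k p)"
proof (elim isreg_obtain)
  fix A B C D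
  assume *: "\<And>x y. on_curve E x y \<Longrightarrow> h (Affine x y) = reg A B (Affine x y)"
    "\<And>x y. on_curve E x y \<Longrightarrow> k (Affine x y) = reg C D (Affine x y)"
  show "isreg (\<lambda>p. h p + k p)"
    by (rule isregI[of _ "A + C" "B + D"]) (simp add: * algebra_simps)
qed

lemma isreg_mult [isreg_intros]: "isreg h \<Longrightarrow> isreg k \<Longrightarrow> isreg (\<lambda>p. h p * k p)"
proof (elim isreg_obtain)
  fix A B C D
  assume *: "\<And>x y. on_curve E x y \<Longrightarrow> h (Affine x y) = reg A B (Affine x y)"
    "\<And>x y. on_curve E x y \<Longrightarrow> k (Affine x y) = reg C D (Affine x y)"
  show "isreg (\<lambda>p. h p * k p)"
    by (rule isregI) (subst *, assumption, subst *, assumption, rule reg_mult)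
qed

lemma isreg_uminus [isreg_intros]: "isreg h \<Longrightarrow> isreg (\<lambda>p. - h p)"
  using isreg_mult[OF isreg_const[of "-1"], of h] by simp

lemma isreg_diff [isreg_intros]: "isreg h \<Longrightarrow> isreg k \<Longrightarrow> isreg (\<lambda>p. h p - k p)"
  using isreg_add[OF _ isreg_uminus, of h k] by simp

lemma isreg_power [isreg_intros]: "isreg h \<Longrightarrow> isreg (\<lambda>p. h p ^ n)"
  by (induction n) (auto intro: isreg_intros)

text \<open>Irreducibility of the curve: a regular function that is nonzero somewhere has a nonzero
  coefficient, hence finitely many zeros.\<close>

lemma isreg_ev_neq_0:
  assumes "isreg h" "on_curve E x y" "h (Affine x y) \<noteq> 0"
  shows "ev (\<lambda>p. h p \<noteq> 0)"
proof -
  from assms(1) obtain A B where *: "\<And>x y. on_curve E x y \<Longrightarrow> h (Affine x y) = reg A B (Affine x y)"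
    "ev (\<lambda>p. h p = reg A B p)" using isreg_obtain by blast
  with assms have "A \<noteq> 0 \<or> B \<noteq> 0" by auto
  from ev_reg_neq_0[OF this] *(2) show ?thesis by eventually_elim simp
qed

lemma isreg_cases:
  assumes "isreg h"
  shows "(\<forall>x y. on_curve E x y \<longrightarrow> h (Affine x y) = 0) \<or> ev (\<lambda>p. h p \<noteq> 0)"
  using isreg_ev_neq_0[OF assms] by blast

text \<open>Turns an identity off finitely many points into one at a prescribed affine point;
  generic identities are evaluated in this way.\<close>

lemma isreg_ev_eqD:
  assumes "isreg h" "isreg k" "ev (\<lambda>p. h p = k p)" "on_curve E x y"
  shows "h (Affine x y) = k (Affine x y)"
proof (rule ccontr)
  assume "h (Affine x y) \<noteq> k (Affine x y)"
  then have "ev (\<lambda>p. h p - k p \<noteq> 0)"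
    by (intro isreg_ev_neq_0[OF _ assms(4)] isreg_intros assms) simp
  with assms(3) have "ev (\<lambda>p. False)" by eventually_elim simp
  then show False by simp
qed

section \<open>Rational functions as quotients of regular ones\<close>

text \<open>\<open>rat\<close> is the function field, zero included, and \<open>rfun\<close> its
  multiplicative group, both up to agreement off a finite set.\<close>

definition rat :: "('a point \<Rightarrow> 'a) \<Rightarrow> bool" where
  "rat h \<longleftrightarrow> (\<exists>u v. isreg u \<and> isreg v \<and> ev (\<lambda>p. v p \<noteq> 0) \<and> ev (\<lambda>p. h p = u p / v p))"

definition rfun :: "('a point \<Rightarrow> 'a) \<Rightarrow> bool" where
  "rfun h \<longleftrightarrow> rat h \<and> ev (\<lambda>p. h p \<noteq> 0)"

lemma ratI: "isreg u \<Longrightarrow> isreg v \<Longrightarrow> ev (\<lambda>p. v p \<noteq> 0) \<Longrightarrow> ev (\<lambda>p. h p = u p / v p) \<Longrightarrow> rat h"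
  unfolding rat_def by blast

lemma rat_cong: "rat h \<Longrightarrow> ev (\<lambda>p. h p = k p) \<Longrightarrow> rat k"
proof -
  assume "rat h" and hk: "ev (\<lambda>p. h p = k p)"
  then obtain u v where "isreg u" "isreg v" "ev (\<lambda>p. v p \<noteq> 0)" and eq: "ev (\<lambda>p. h p = u p / v p)"
    unfolding rat_def by blast
  moreover from hk eq have "ev (\<lambda>p. k p = u p / v p)" by eventually_elim simp
  ultimately show "rat k" by (blast intro: ratI)
qed

lemma rfun_cong: "rfun h \<Longrightarrow> ev (\<lambda>p. h p = k p) \<Longrightarrow> rfun k"
  unfolding rfun_def by (auto intro: rat_cong elim: eventually_elim2)

lemma isreg_rat: "isreg h \<Longrightarrow> rat h"
  by (rule ratI[of h "\<lambda>p. 1"]) (auto intro: isreg_intros)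

named_theorems rat_intros
lemmas [rat_intros] = isreg_poly[THEN isreg_rat] isreg_const[THEN isreg_rat]
  isreg_xc[THEN isreg_rat] isreg_yc[THEN isreg_rat]

lemma rat_add [rat_intros]: assumes "rat h" "rat k" shows "rat (\<lambda>p. h p + k p)"
proof -
  from assms obtain u v u' v' where *: "isreg u" "isreg v" "isreg u'" "isreg v'"
    and nz: "ev (\<lambda>p. v p \<noteq> 0)" "ev (\<lambda>p. v' p \<noteq> 0)"
    and eq: "ev (\<lambda>p. h p = u p / v p)" "ev (\<lambda>p. k p = u' p / v' p)" unfolding rat_def by blast
  show ?thesis
  proof (rule ratI)
    show "isreg (\<lambda>p. u p * v' p + u' p * v p)" "isreg (\<lambda>p. v p * v' p)"
      by (intro isreg_intros *)+
    show "ev (\<lambda>p. v p * v' p \<noteq> 0)" using nz by eventually_elim simp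
    show "ev (\<lambda>p. h p + k p = (u p * v' p + u' p * v p) / (v p * v' p))"
      using nz eq by eventually_elim (simp add: field_simps)
  qed
qed

lemma rat_mult [rat_intros]: assumes "rat h" "rat k" shows "rat (\<lambda>p. h p * k p)"
proof -
  from assms obtain u v u' v' where *: "isreg u" "isreg v" "isreg u'" "isreg v'"
    and nz: "ev (\<lambda>p. v p \<noteq> 0)" "ev (\<lambda>p. v' p \<noteq> 0)"
    and eq: "ev (\<lambda>p. h p = u p / v p)" "ev (\<lambda>p. k p = u' p / v' p)" unfolding rat_def by blast
  show ?thesis
  proof (rule ratI)
    show "isreg (\<lambda>p. u p * u' p)" "isreg (\<lambda>p. v p * v' p)"
      by (intro isreg_intros *)+
    show "ev (\<lambda>p. v p * v' p \<noteq> 0)" using nz by eventually_elim simp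
    show "ev (\<lambda>p. h p * k p = (u p * u' p) / (v p * v' p))"
      using nz eq by eventually_elim simp
  qed
qed

lemma rat_uminus [rat_intros]: "rat h \<Longrightarrow> rat (\<lambda>p. - h p)"
  using rat_mult[OF isreg_rat[OF isreg_const[of "-1"]], of h] by simp

lemma rat_diff [rat_intros]: "rat h \<Longrightarrow> rat k \<Longrightarrow> rat (\<lambda>p. h p - k p)"
  using rat_add[OF _ rat_uminus, of h k] by simp

lemma rat_cases: assumes "rat h" shows "ev (\<lambda>p. h p = 0) \<or> rfun h"
proof -
  from assms obtain u v where *: "isreg u" "isreg v"
    and nz: "ev (\<lambda>p. v p \<noteq> 0)"
    and eq: "ev (\<lambda>p. h p = u p / v p)" unfolding rat_def by blast
  show ?thesis using isreg_cases[OF *(1)]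
  proof
    assume "\<forall>x y. on_curve E x y \<longrightarrow> u (Affine x y) = 0"
    then have "ev (\<lambda>p. u p = 0)" by (intro ev_affineI) auto
    with eq have "ev (\<lambda>p. h p = 0)" by eventually_elim simp
    then show ?thesis ..
  next
    assume "ev (\<lambda>p. u p \<noteq> 0)"
    with eq nz have "ev (\<lambda>p. h p \<noteq> 0)" by eventually_elim simp
    then show ?thesis using assms by (simp add: rfun_def)
  qed
qed

text \<open>For the zero function the convention \<open>inverse 0 = 0\<close> keeps the inverse
  rational.\<close>

lemma rat_inverse [rat_intros]: assumes "rat h" shows "rat (\<lambda>p. inverse (h p))"
  using rat_cases[OF assms]
proof
  assume "ev (\<lambda>p. h p = 0)"
  then have "ev (\<lambda>p. 0 = inverse (h p))" by eventually_elim simp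
  then show ?thesis by (rule rat_cong[OF isreg_rat[OF isreg_const[of 0]]])
next
  assume nzh: "rfun h"
  from assms obtain u v where *: "isreg u" "isreg v"
    and nz: "ev (\<lambda>p. v p \<noteq> 0)"
    and eq: "ev (\<lambda>p. h p = u p / v p)" unfolding rat_def by blast
  from nzh have "ev (\<lambda>p. h p \<noteq> 0)" by (simp add: rfun_def)
  with eq nz have "ev (\<lambda>p. u p \<noteq> 0)" by eventually_elim auto
  moreover from eq have "ev (\<lambda>p. inverse (h p) = v p / u p)" by eventually_elim simp
  ultimately show ?thesis using * by (auto intro: ratI)
qed

lemma rat_divide [rat_intros]: "rat h \<Longrightarrow> rat k \<Longrightarrow> rat (\<lambda>p. h p / k p)"
  using rat_mult[OF _ rat_inverse, of h k] by (simp add: field_class.field_divide_inverse)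

lemma rat_power [rat_intros]: "rat h \<Longrightarrow> rat (\<lambda>p. h p ^ n)"
  by (induction n) (auto intro: rat_intros)

lemma rfun_mult: "rfun h \<Longrightarrow> rfun k \<Longrightarrow> rfun (\<lambda>p. h p * k p)"
  unfolding rfun_def by (auto intro: rat_intros elim: eventually_elim2)

lemma rfun_inverse: "rfun h \<Longrightarrow> rfun (\<lambda>p. inverse (h p))"
  unfolding rfun_def by (auto intro: rat_intros elim: eventually_elim2)

lemma rfun_divide: "rfun h \<Longrightarrow> rfun k \<Longrightarrow> rfun (\<lambda>p. h p / k p)"
  unfolding rfun_def by (auto intro: rat_intros elim: eventually_elim2)

lemma rfun_const: "c \<noteq> 0 \<Longrightarrow> rfun (\<lambda>p. c)"
  unfolding rfun_def by (auto intro: rat_intros)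

lemma rfun_prod: "finite I \<Longrightarrow> (\<And>i. i \<in> I \<Longrightarrow> rfun (h i)) \<Longrightarrow> rfun (\<lambda>p. \<Prod>i\<in>I. h i p)"
  by (induction I rule: finite_induct) (auto intro: rfun_const rfun_mult)

lemma rfun_isreg: "isreg h \<Longrightarrow> ev (\<lambda>p. h p \<noteq> 0) \<Longrightarrow> rfun h"
  by (simp add: rfun_def isreg_rat)

lemma rfun_reg: "A \<noteq> 0 \<or> B \<noteq> 0 \<Longrightarrow> rfun (reg A B)"
  by (intro rfun_isreg isreg_intros ev_reg_neq_0)

lemma rfun_obtain:
  assumes "rfun h"
  obtains A B C D where "A \<noteq> 0 \<or> B \<noteq> 0" "C \<noteq> 0 \<or> D \<noteq> 0" "ev (\<lambda>p. h p = reg A B p / reg C D p)"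
proof -
  from assms have "rat h" and nzh: "ev (\<lambda>p. h p \<noteq> 0)" by (auto simp: rfun_def)
  then obtain u v where uv: "isreg u" "isreg v"
    and eq: "ev (\<lambda>p. h p = u p / v p)" unfolding rat_def by blast
  obtain A B where A: "ev (\<lambda>p. u p = reg A B p)" using uv(1) by (rule isreg_obtain)
  obtain C D where C: "ev (\<lambda>p. v p = reg C D p)" using uv(2) by (rule isreg_obtain)
  from eq A C have e: "ev (\<lambda>p. h p = reg A B p / reg C D p)" by eventually_elim simp
  have nz: "ev (\<lambda>p. reg A B p \<noteq> 0 \<and> reg C D p \<noteq> 0)"
    using nzh e by eventually_elim auto
  have reg0: "reg 0 0 p = 0" for p by (cases p) auto
  have "A \<noteq> 0 \<or> B \<noteq> 0" "C \<noteq> 0 \<or> D \<noteq> 0"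
    using nz reg0 by (auto intro!: ccontr[of "_ \<or> _"])
  with e show ?thesis using that by blast
qed


subsection \<open>Orders of vanishing\<close>

text \<open>Local parameters. Where b = 0, f has a simple root, so x - a has a double zero and y
  takes its place. At infinity x/y works because x and y have poles of order 2 and 3.\<close>

fun unif :: "'a point \<Rightarrow> 'a point \<Rightarrow> 'a" where
  "unif Infinity p = xc p / yc p"
| "unif (Affine a b) p = (if b = 0 then yc p else xc p - a)"

text \<open>The pole order of \<open>A + B y\<close> at infinity is the degree of its norm.\<close>

fun has_ord :: "'a point \<Rightarrow> ('a point \<Rightarrow> 'a) \<Rightarrow> int \<Rightarrow> bool" where
  "has_ord Infinity h n \<longleftrightarrow>
    (\<exists>A B C D. (A \<noteq> 0 \<or> B \<noteq> 0) \<and> (C \<noteq> 0 \<or> D \<noteq> 0) \<and> ev (\<lambda>p. reg C D p * h p = reg A B p) \<and>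
      n = int (degree (nrm C D)) - int (degree (nrm A B)))"
| "has_ord (Affine a b) h n \<longleftrightarrow>
    (\<exists>s t. isreg s \<and> isreg t \<and> s (Affine a b) \<noteq> 0 \<and> t (Affine a b) \<noteq> 0 \<and>
      ev (\<lambda>p. s p * h p = t p * unif (Affine a b) p powi n))"

declare has_ord.simps [simp del]

definition ord :: "'a point \<Rightarrow> ('a point \<Rightarrow> 'a) \<Rightarrow> int" where
  "ord P h = (THE n. has_ord P h n)"

lemma has_ord_InfinityI:
  assumes "A \<noteq> 0 \<or> B \<noteq> 0" "C \<noteq> 0 \<or> D \<noteq> 0" "ev (\<lambda>p. reg C D p * h p = reg A B p)"
    "n = int (degree (nrm C D)) - int (degree (nrm A B))"
  shows "has_ord Infinity h n"
  unfolding has_ord.simps using assms by blast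

lemma has_ord_AffineI:
  assumes "isreg s" "isreg t" "s (Affine a b) \<noteq> 0" "t (Affine a b) \<noteq> 0"
    "ev (\<lambda>p. s p * h p = t p * unif (Affine a b) p powi n)"
  shows "has_ord (Affine a b) h n"
  unfolding has_ord.simps using assms by blast

lemma isreg_unif [isreg_intros]: "isreg (\<lambda>p. unif (Affine a b) p)"
  by (cases "b = 0") (auto intro: isreg_intros)

lemma ev_unif_neq_0: "ev (\<lambda>p. unif (Affine a b) p \<noteq> 0)"
proof -
  have "ev (\<lambda>p. reg 0 1 p \<noteq> 0)" "ev (\<lambda>p. reg [:-a, 1:] 0 p \<noteq> 0)"
    by (intro ev_reg_neq_0; simp)+
  with ev_affine show ?thesis
    by eventually_elim auto
qed

lemma unif_self [simp]: "unif (Affine a b) (Affine a b) = 0"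
  by simp

lemma has_ord_cong: "has_ord P h n \<Longrightarrow> ev (\<lambda>p. h p = k p) \<Longrightarrow> has_ord P k n"
proof (cases P)
  case Infinity
  assume "has_ord P h n" and e: "ev (\<lambda>p. h p = k p)"
  then obtain A B C D where *: "A \<noteq> 0 \<or> B \<noteq> 0" "C \<noteq> 0 \<or> D \<noteq> 0" "ev (\<lambda>p. reg C D p * h p = reg A B p)"
      "n = int (degree (nrm C D)) - int (degree (nrm A B))" 
    unfolding Infinity has_ord.simps by blast
  from *(3) e have "ev (\<lambda>p. reg C D p * k p = reg A B p)" by eventually_elim simp
  with * show ?thesis unfolding Infinity has_ord.simps by blast
next
  case (Affine a b)
  assume "has_ord P h n" and e: "ev (\<lambda>p. h p = k p)"
  then obtain s t where *: "isreg s" "isreg t" "s P \<noteq> 0" "t P \<noteq> 0"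
      "ev (\<lambda>p. s p * h p = t p * unif P p powi n)"
    unfolding Affine has_ord.simps by blast
  from *(5) e have "ev (\<lambda>p. s p * k p = t p * unif P p powi n)" by eventually_elim simp
  with * show ?thesis unfolding Affine has_ord.simps by blast
qed

lemma ev_reg_mult:
  "ev (\<lambda>p. reg A B p * reg C D p = reg (A * C + f * B * D) (A * D + B * C) p)"
  by (rule ev_affineI) (rule reg_mult)

lemma reg_mult_nonzero:
  assumes "A \<noteq> 0 \<or> B \<noteq> 0" "C \<noteq> 0 \<or> D \<noteq> 0"
  shows "A * C + f * B * D \<noteq> 0 \<or> A * D + B * C \<noteq> 0"
    "degree (nrm (A * C + f * B * D) (A * D + B * C)) = degree (nrm A B) + degree (nrm C D)"
proof -
  have "nrm (A * C + f * B * D) (A * D + B * C) \<noteq> 0"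
    unfolding nrm_mult using degree_nrm(1) assms by simp
  then show "A * C + f * B * D \<noteq> 0 \<or> A * D + B * C \<noteq> 0"
    by (auto simp: nrm_def)
  show "degree (nrm (A * C + f * B * D) (A * D + B * C)) = degree (nrm A B) + degree (nrm C D)"
    unfolding nrm_mult using degree_nrm(1) assms by (simp add: degree_mult_eq)
qed

lemma has_ord_mult:
  assumes "has_ord P h n" "has_ord P k m"
  shows "has_ord P (\<lambda>p. h p * k p) (n + m)"
proof (cases P)
  case Infinity
  obtain A B C D where 1: "A \<noteq> 0 \<or> B \<noteq> 0" "C \<noteq> 0 \<or> D \<noteq> 0" and 2: "ev (\<lambda>p. reg C D p * h p = reg A B p)"
      and 3: "n = int (degree (nrm C D)) - int (degree (nrm A B))"
    using assms(1) unfolding Infinity has_ord.simps by blast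
  obtain A' B' C' D' where 4: "A' \<noteq> 0 \<or> B' \<noteq> 0" "C' \<noteq> 0 \<or> D' \<noteq> 0"
      and 5: "ev (\<lambda>p. reg C' D' p * k p = reg A' B' p)"
      and 6: "m = int (degree (nrm C' D')) - int (degree (nrm A' B'))"
    using assms(2) unfolding Infinity has_ord.simps by blast
  have "ev (\<lambda>p. reg (C * C' + f * D * D') (C * D' + D * C') p * (h p * k p) =
      reg (A * A' + f * B * B') (A * B' + B * A') p)"
    using 2 5 ev_reg_mult[of A B A' B'] ev_reg_mult[of C D C' D']
  proof eventually_elim
    case (elim p)
    show ?case unfolding elim(3)[symmetric] elim(4)[symmetric] elim(1)[symmetric] elim(2)[symmetric]
      by (simp add: mult_ac)
  qed
  then show ?thesis
    unfolding Infinity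
    using reg_mult_nonzero[OF 1(1) 4(1)] reg_mult_nonzero[OF 1(2) 4(2)] 3 6
    by (intro has_ord_InfinityI) auto
next
  case (Affine a b)
  obtain s t where 1: "isreg s" "isreg t" "s P \<noteq> 0" "t P \<noteq> 0"
      and 2: "ev (\<lambda>p. s p * h p = t p * unif P p powi n)"
    using assms(1) unfolding Affine has_ord.simps by blast
  obtain s' t' where 3: "isreg s'" "isreg t'" "s' P \<noteq> 0" "t' P \<noteq> 0"
      and 4: "ev (\<lambda>p. s' p * k p = t' p * unif P p powi m)"
    using assms(2) unfolding Affine has_ord.simps by blast
  have "ev (\<lambda>p. (s p * s' p) * (h p * k p) = (t p * t' p) * unif P p powi (n + m))"
    using 2 4 ev_unif_neq_0[of a b, folded Affine]
  proof eventually_elim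
    case (elim p)
    have "(s p * s' p) * (h p * k p) = (s p * h p) * (s' p * k p)" by (simp add: mult_ac)
    also have "\<dots> = (t p * t' p) * unif P p powi (n + m)"
      unfolding elim(1) elim(2) using elim(3) by (simp add: power_int_add mult_ac)
    finally show ?case .
  qed
  moreover have "isreg (\<lambda>p. s p * s' p)" "isreg (\<lambda>p. t p * t' p)"
    by (intro isreg_intros 1 3)+
  ultimately show ?thesis
    using 1 3 unfolding Affine has_ord.simps by (intro exI conjI; (assumption | simp))
qed

lemma has_ord_inverse:
  assumes "has_ord P h n" "P \<in> points E"
  shows "has_ord P (\<lambda>p. inverse (h p)) (- n)"
proof (cases P)
  case Infinity
  obtain A B C D where 1: "A \<noteq> 0 \<or> B \<noteq> 0" "C \<noteq> 0 \<or> D \<noteq> 0" and 2: "ev (\<lambda>p. reg C D p * h p = reg A B p)"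
      and 3: "n = int (degree (nrm C D)) - int (degree (nrm A B))"
    using assms(1) unfolding Infinity has_ord.simps by blast
  have "ev (\<lambda>p. reg A B p * inverse (h p) = reg C D p)"
    using 2 ev_reg_neq_0[OF 1(1)] ev_reg_neq_0[OF 1(2)]
  proof eventually_elim
    case (elim p)
    then have "h p \<noteq> 0" by auto
    then show ?case by (simp add: field_simps flip: elim(1))
  qed
  then show ?thesis
    unfolding Infinity has_ord.simps using 1 3 by (intro exI conjI; (assumption | simp))
next
  case (Affine a b)
  obtain s t where 1: "isreg s" "isreg t" "s P \<noteq> 0" "t P \<noteq> 0"
      and 2: "ev (\<lambda>p. s p * h p = t p * unif P p powi n)"
    using assms(1) unfolding Affine has_ord.simps by blast
  have t: "ev (\<lambda>p. t p \<noteq> 0)"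
    using assms(2) 1(2,4) isreg_ev_neq_0 unfolding Affine Affine_in_points by blast
  have "ev (\<lambda>p. t p * inverse (h p) = s p * unif P p powi (- n))"
    using 2 t ev_unif_neq_0[of a b, folded Affine]
  proof eventually_elim
    case (elim p)
    then have "h p \<noteq> 0" by auto
    then show ?case using elim by (simp add: field_simps power_int_minus)
  qed
  then show ?thesis
    using 1 unfolding Affine has_ord.simps by (intro exI conjI; (assumption | simp))
qed

text \<open>For a positive order n the identity s = t \<pi>^n, with \<pi> the local parameter, could
  be evaluated at the point, where the right side vanishes and s does not. At infinity, two
  representations of one function have equal coefficients and hence equal norms.\<close>

lemma has_ord_unique_aux:
  assumes "has_ord P (\<lambda>p. 1) n" "P \<in> points E" "n \<ge> 0"
  shows "n = 0"
proof (cases P)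
  case Infinity
  obtain A B C D where 1: "A \<noteq> 0 \<or> B \<noteq> 0" "C \<noteq> 0 \<or> D \<noteq> 0" and 2: "ev (\<lambda>p. reg C D p * 1 = reg A B p)"
      and 3: "n = int (degree (nrm C D)) - int (degree (nrm A B))"
    using assms(1) unfolding Infinity has_ord.simps by blast
  have "C - A = 0 \<and> D - B = 0"
  proof (rule ccontr)
    assume "\<not> ?thesis"
    then have "ev (\<lambda>p. reg (C - A) (D - B) p \<noteq> 0)" by (intro ev_reg_neq_0) auto
    with 2 ev_affine have "ev (\<lambda>p. False)"
      by eventually_elim (auto simp: algebra_simps)
    then show False by simp
  qed
  then show ?thesis using 3 by simp
next
  case (Affine a b)
  obtain s t where 1: "isreg s" "isreg t" "s P \<noteq> 0" "t P \<noteq> 0"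
      and 2: "ev (\<lambda>p. s p * 1 = t p * unif P p powi n)"
    using assms(1) unfolding Affine has_ord.simps by blast
  have oc: "on_curve E a b" using assms(2) Affine by simp
  show ?thesis
  proof (rule ccontr)
    assume "n \<noteq> 0"
    then obtain k where k: "n = int (Suc k)"
      using assms(3) by (metis nonneg_int_cases not0_implies_Suc of_nat_0)
    from 2 have "ev (\<lambda>p. s p = t p * unif P p ^ Suc k)"
      unfolding k power_int_of_nat by simp
    moreover have "isreg (\<lambda>p. t p * unif P p ^ Suc k)"
      unfolding Affine by (intro isreg_intros 1)
    ultimately have "s P = t P * unif P P ^ Suc k"
      using isreg_ev_eqD[OF 1(1) _ _ oc] Affine by blast
    then show False using 1(3) unfolding Affine unif_self by simp
  qed
qed

lemma has_ord_unique:
  assumes "has_ord P h n" "has_ord P h m" "P \<in> points E" "ev (\<lambda>p. h p \<noteq> 0)"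
  shows "n = m"
proof -
  have *: "has_ord P (\<lambda>p. 1) (i - j)" if "has_ord P h i" "has_ord P h j" for i j
  proof -
    have "has_ord P (\<lambda>p. h p * inverse (h p)) (i + - j)"
      by (intro has_ord_mult has_ord_inverse that assms)
    moreover have "ev (\<lambda>p. h p * inverse (h p) = 1)"
      using assms(4) by eventually_elim simp
    ultimately show ?thesis using has_ord_cong[of P "\<lambda>p. h p * inverse (h p)" "i + - j" "\<lambda>p. 1"] by simp
  qed
  show ?thesis
  proof (cases "n \<ge> m")
    case True
    then show ?thesis using has_ord_unique_aux[OF *[OF assms(1,2)] assms(3)] by simp
  next
    case False
    then show ?thesis using has_ord_unique_aux[OF *[OF assms(2,1)] assms(3)] by simp
  qed
qed

lemma has_ord_one: 
  assumes "P \<in> points E" shows "has_ord P (\<lambda>p. 1) 0"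
proof (cases P)
  case Infinity
  show ?thesis unfolding Infinity
    by (rule has_ord_InfinityI[of 1 0 1 0]) (auto intro: ev_affineI)
next
  case (Affine a b)
  show ?thesis unfolding Affine
    by (rule has_ord_AffineI[of "\<lambda>p. 1" "\<lambda>p. 1"]) (auto intro: isreg_intros)
qed

lemma has_ord_power:
  assumes "P \<in> points E" "has_ord P h n"
  shows "has_ord P (\<lambda>p. h p ^ k) (int k * n)"
proof (induction k)
  case 0
  then show ?case using has_ord_one[OF assms(1)] by simp
next
  case (Suc k)
  then show ?case using has_ord_mult[OF assms(2) Suc] by (simp add: algebra_simps)
qed

text \<open>When q(a) is nonzero, this exhibits x - a near (a, 0) as y^2 divided by a unit.\<close>

lemma ev_f_factor:
  assumes "f = [:-a, 1:] * q"
  shows "ev (\<lambda>p. poly q (xc p) * (xc p - a) = yc p ^ 2)"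
proof (rule ev_affineI)
  fix x y assume "on_curve E x y"
  then have "y ^ 2 = poly f x" by (simp add: on_curve_iff)
  also have "\<dots> = poly q x * (x - a)" unfolding assms by (simp add: algebra_simps)
  finally show "poly q (xc (Affine x y)) * (xc (Affine x y) - a) = yc (Affine x y) ^ 2" by simp
qed

lemma has_ord_xc_diff:
  assumes "on_curve E a b"
  shows "has_ord (Affine a b) (\<lambda>p. xc p - a) (if b = 0 then 2 else 1)"
proof (cases "b = 0")
  case True
  then have "poly f a = 0" using assms by (simp add: on_curve_iff)
  then obtain q where q: "f = [:-a, 1:] * q" "poly q a \<noteq> 0" by (rule f_root_decomp)
  have "has_ord (Affine a b) (\<lambda>p. xc p - a) 2"
  proof (rule has_ord_AffineI)
    show "isreg (\<lambda>p. poly q (xc p))" "isreg (\<lambda>p. 1)" by (intro isreg_intros)+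
    show "ev (\<lambda>p. poly q (xc p) * (xc p - a) = 1 * unif (Affine a b) p powi 2)"
      using ev_f_factor[OF q(1)] by eventually_elim (simp add: True)
  qed (use q(2) in auto)
  then show ?thesis using True by simp
next
  case False
  have "has_ord (Affine a b) (\<lambda>p. xc p - a) 1"
    by (rule has_ord_AffineI[of "\<lambda>p. 1" "\<lambda>p. 1"]) (auto intro: isreg_intros simp: False)
  then show ?thesis using False by simp
qed

text \<open>Suppose the value is zero. If b is nonzero, multiplying by the conjugate, a unit at the
  point, gives the norm, whose order in x - a is known. If b = 0, x - a is traded for y^2 and
  exactly one factor y splits off.\<close>

lemma has_ord_reg_primitive:
  assumes oc: "on_curve E a b" and "poly A a \<noteq> 0 \<or> poly B a \<noteq> 0"
  shows "\<exists>n\<ge>0. has_ord (Affine a b) (reg A B) n"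
proof (cases "reg A B (Affine a b) = 0")
  case False
  have "has_ord (Affine a b) (reg A B) 0"
    by (rule has_ord_AffineI[of "\<lambda>p. 1" "reg A B"]) (use False in \<open>auto intro: isreg_intros simp del: reg.simps\<close>)
  then show ?thesis by blast
next
  case True
  then have z: "poly A a + poly B a * b = 0" by simp
  show ?thesis
  proof (cases "b = 0")
    case False
    have "A \<noteq> 0 \<or> B \<noteq> 0" using assms(2) by auto
    then have "nrm A B \<noteq> 0" by (rule degree_nrm)
    then obtain M where M: "nrm A B = [:-a, 1:] ^ order a (nrm A B) * M" "\<not> [:-a, 1:] dvd M"
      using order_decomp by blast
    define j where "j = order a (nrm A B)"
    have Ma: "poly M a \<noteq> 0" using M(2) by (simp add: poly_eq_0_iff_dvd)
    have "poly A a - poly B a * b \<noteq> 0"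
    proof
      assume "poly A a - poly B a * b = 0"
      with z have "poly A a + poly A a = 0" by Groebner_Basis.algebra
      then have "poly A a = 0" using double_eq_0_iff by blast
      then show False using z False assms(2) by simp
    qed
    moreover have "ev (\<lambda>p. reg A (- B) p * reg A B p = poly M (xc p) * unif (Affine a b) p powi (int j))"
    proof (rule ev_affineI)
      fix x y assume "on_curve E x y"
      then have "reg A (- B) (Affine x y) * reg A B (Affine x y) = poly (nrm A B) x"
        using reg_conj by (simp add: mult.commute)
      also have "\<dots> = poly M x * (x - a) ^ j"
        by (subst M(1)) (simp add: j_def)
      finally show "reg A (- B) (Affine x y) * reg A B (Affine x y) =
          poly M (xc (Affine x y)) * unif (Affine a b) (Affine x y) powi (int j)"
        using False by (simp del: reg.simps)
    qed
    ultimately have "has_ord (Affine a b) (reg A B) (int j)"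
      using Ma by (intro has_ord_AffineI[of "reg A (- B)" "\<lambda>p. poly M (xc p)"] isreg_intros) auto
    then show ?thesis by (intro exI[of _ "int j"]) auto
  next
    case True
    then have "poly f a = 0" using oc by (simp add: on_curve_iff)
    then obtain q where q: "f = [:-a, 1:] * q" "poly q a \<noteq> 0" by (rule f_root_decomp)
    have "poly A a = 0" using z True by simp
    then obtain A2 where A2: "A = [:-a, 1:] * A2" by (auto simp: poly_eq_0_iff_dvd elim: dvdE)
    have Ba: "poly B a \<noteq> 0" using assms(2) \<open>poly A a = 0\<close> by simp
    have "has_ord (Affine a b) (reg A B) 1"
    \<comment> \<open>From A = (x - a) A2 and q (x - a) = y^2 one gets q (A + B y) = (y A2 + q B) y.
      At (a, 0) the first factor is q(a) B(a), which is nonzero.\<close>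
    proof (rule has_ord_AffineI[of "\<lambda>p. poly q (xc p)" "\<lambda>p. yc p * poly A2 (xc p) + poly (q * B) (xc p)"])
      show "ev (\<lambda>p. poly q (xc p) * reg A B p =
          (yc p * poly A2 (xc p) + poly (q * B) (xc p)) * unif (Affine a b) p powi 1)"
        using ev_f_factor[OF q(1)] ev_affine
      proof eventually_elim
        case (elim p)
        then obtain x y where p: "p = Affine x y" by blast
        have e: "poly q x * (x - a) = y * y" using elim(1) p by (simp add: power2_eq_square)
        have "poly q x * ((x - a) * poly A2 x + poly B x * y) =
            (poly q x * (x - a)) * poly A2 x + poly q x * poly B x * y" by (simp add: algebra_simps)
        also have "\<dots> = (y * poly A2 x + poly q x * poly B x) * y" unfolding e by (simp add: algebra_simps)
        finally show ?case using p True by (simp add: A2 mult.commute left_diff_distrib)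
      qed
    qed (use q(2) Ba True in \<open>auto intro!: isreg_intros\<close>)
    then show ?thesis by (intro exI[of _ 1]) auto
  qed
qed

text \<open>The common power of x - a is pulled out; it contributes k, or 2k at a point of order
  two, and leaves a primitive pair.\<close>

lemma has_ord_reg_exists:
  assumes oc: "on_curve E a b" and "A \<noteq> 0 \<or> B \<noteq> 0"
  shows "\<exists>n\<ge>0. has_ord (Affine a b) (reg A B) n"
proof -
  obtain k A' B' where k: "A = [:-a, 1:] ^ k * A'" "B = [:-a, 1:] ^ k * B'"
    "poly A' a \<noteq> 0 \<or> poly B' a \<noteq> 0"
    using common_linear_factor[OF assms(2)] by blast
  obtain n where n: "n \<ge> 0" "has_ord (Affine a b) (reg A' B') n"
    using has_ord_reg_primitive[OF oc k(3)] by blast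
  have P: "Affine a b \<in> points E" using oc by simp
  define e :: int where "e = (if b = 0 then 2 else 1)"
  have "has_ord (Affine a b) (\<lambda>p. (xc p - a) ^ k * reg A' B' p) (int k * e + n)"
    unfolding e_def by (intro has_ord_mult has_ord_power P has_ord_xc_diff oc n)
  moreover have "ev (\<lambda>p. (xc p - a) ^ k * reg A' B' p = reg A B p)"
    by (rule ev_affineI) (simp add: k algebra_simps)
  ultimately have "has_ord (Affine a b) (reg A B) (int k * e + n)" using has_ord_cong by blast
  moreover have "int k * e + n \<ge> 0" using n by (simp add: e_def)
  ultimately show ?thesis by blast
qed

lemma has_ord_isreg_exists:
  assumes "on_curve E a b" "isreg h" "ev (\<lambda>p. h p \<noteq> 0)"
  shows "\<exists>n\<ge>0. has_ord (Affine a b) h n"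
proof -
  obtain A B where *: "ev (\<lambda>p. h p = reg A B p)" using assms(2) by (rule isreg_obtain)
  have "A \<noteq> 0 \<or> B \<noteq> 0"
  proof (rule ccontr)
    assume "\<not> ?thesis"
    then have "A = 0" "B = 0" by auto
    from * assms(3) ev_affine have "ev (\<lambda>p. False)"
      by eventually_elim (auto simp: \<open>A = 0\<close> \<open>B = 0\<close>)
    then show False by simp
  qed
  then obtain n where n: "n \<ge> 0" "has_ord (Affine a b) (reg A B) n"
    using has_ord_reg_exists[OF assms(1)] by blast
  from * have "ev (\<lambda>p. reg A B p = h p)" by eventually_elim simp
  with n show ?thesis using has_ord_cong by blast
qed

lemma has_ord_exists:
  assumes "P \<in> points E" "rfun h"
  shows "\<exists>n. has_ord P h n"
proof -
  obtain A B C D where 1: "A \<noteq> 0 \<or> B \<noteq> 0" "C \<noteq> 0 \<or> D \<noteq> 0" "ev (\<lambda>p. h p = reg A B p / reg C D p)"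
    using assms(2) by (rule rfun_obtain)
  have *: "\<exists>n. has_ord P (reg F G) n" if "F \<noteq> 0 \<or> G \<noteq> 0" for F G
  proof (cases P)
    case Infinity
    have "has_ord P (reg F G) (0 - int (degree (nrm F G)))"
      unfolding Infinity by (rule has_ord_InfinityI[of F G 1 0]) (use that in \<open>auto intro: ev_affineI simp: nrm_def\<close>)
    then show ?thesis by blast
  next
    case (Affine a b)
    then show ?thesis using has_ord_reg_exists[OF _ that] assms(1) by auto
  qed
  obtain n where "has_ord P (reg A B) n" using *[OF 1(1)] by blast
  moreover obtain m where "has_ord P (reg C D) m" using *[OF 1(2)] by blast
  ultimately have "has_ord P (\<lambda>p. reg A B p * inverse (reg C D p)) (n + - m)"
    by (intro has_ord_mult has_ord_inverse assms)
  moreover have "ev (\<lambda>p. reg A B p * inverse (reg C D p) = h p)"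
    using 1(3) by eventually_elim (simp add: field_class.field_divide_inverse)
  ultimately show ?thesis using has_ord_cong by blast
qed

lemma ord_eqI: "P \<in> points E \<Longrightarrow> rfun h \<Longrightarrow> has_ord P h n \<Longrightarrow> ord P h = n"
  unfolding ord_def rfun_def by (rule the_equality) (auto intro: has_ord_unique)

lemma has_ord_ord: "P \<in> points E \<Longrightarrow> rfun h \<Longrightarrow> has_ord P h (ord P h)"
  using has_ord_exists[of P h] ord_eqI[of P h] by auto

lemma ord_cong: "P \<in> points E \<Longrightarrow> rfun h \<Longrightarrow> ev (\<lambda>p. h p = k p) \<Longrightarrow> ord P k = ord P h"
  by (rule ord_eqI, assumption, erule rfun_cong, assumption, rule has_ord_cong[OF has_ord_ord])

lemma ord_mult: "P \<in> points E \<Longrightarrow> rfun h \<Longrightarrow> rfun k \<Longrightarrow> ord P (\<lambda>p. h p * k p) = ord P h + ord P k"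
  by (rule ord_eqI) (auto intro: has_ord_mult has_ord_ord rfun_mult)

lemma ord_inverse: "P \<in> points E \<Longrightarrow> rfun h \<Longrightarrow> ord P (\<lambda>p. inverse (h p)) = - ord P h"
  by (rule ord_eqI) (auto intro: has_ord_inverse has_ord_ord rfun_inverse)

lemma ord_divide: "P \<in> points E \<Longrightarrow> rfun h \<Longrightarrow> rfun k \<Longrightarrow> ord P (\<lambda>p. h p / k p) = ord P h - ord P k"
  using ord_mult[of P h "\<lambda>p. inverse (k p)"]
  by (simp add: field_class.field_divide_inverse rfun_inverse ord_inverse)

lemma ord_one: "P \<in> points E \<Longrightarrow> ord P (\<lambda>p. 1) = 0"
  by (rule ord_eqI) (auto intro: has_ord_one rfun_const)

lemma ord_prod: "finite I \<Longrightarrow> P \<in> points E \<Longrightarrow> (\<And>i. i \<in> I \<Longrightarrow> rfun (h i)) \<Longrightarrow>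
    ord P (\<lambda>p. \<Prod>i\<in>I. h i p) = (\<Sum>i\<in>I. ord P (h i))"
  by (induction I rule: finite_induct) (simp_all add: ord_one ord_mult rfun_prod)

lemma ord_isreg_nonneg:
  assumes "on_curve E a b" "isreg h" "ev (\<lambda>p. h p \<noteq> 0)"
  shows "ord (Affine a b) h \<ge> 0"
proof -
  obtain n where n: "n \<ge> 0" "has_ord (Affine a b) h n"
    using has_ord_isreg_exists[OF assms] by blast
  have "ord (Affine a b) h = n"
    by (rule ord_eqI[OF _ rfun_isreg n(2)]) (use assms in simp_all)
  then show ?thesis using n by simp
qed

text \<open>Evaluating s h = t \<pi>^n at the point, where s and t are nonzero, shows that h
  vanishes there exactly if n > 0.\<close>

lemma ord_isreg_pos_iff:
  assumes oc: "on_curve E a b" and h: "isreg h" "ev (\<lambda>p. h p \<noteq> 0)"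
  shows "ord (Affine a b) h > 0 \<longleftrightarrow> h (Affine a b) = 0"
proof -
  obtain n where n: "ord (Affine a b) h = int n"
    using ord_isreg_nonneg[OF assms] by (metis nonneg_int_cases)
  have "has_ord (Affine a b) h (int n)"
    using has_ord_ord[of "Affine a b" h] n oc rfun_isreg[OF h] by simp
  then obtain s t where *: "isreg s" "isreg t" "s (Affine a b) \<noteq> 0" "t (Affine a b) \<noteq> 0"
      "ev (\<lambda>p. s p * h p = t p * unif (Affine a b) p ^ n)"
    unfolding has_ord.simps power_int_of_nat by blast
  have "s (Affine a b) * h (Affine a b) = t (Affine a b) * unif (Affine a b) (Affine a b) ^ n"
    by (rule isreg_ev_eqD[OF _ _ *(5) oc]) (intro isreg_intros * h)+
  then show ?thesis using * n unfolding unif_self by (cases n) auto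
qed

lemma ord_isreg_eq_0:
  assumes "on_curve E a b" "isreg h" "h (Affine a b) \<noteq> 0"
  shows "ord (Affine a b) h = 0"
proof -
  have "ev (\<lambda>p. h p \<noteq> 0)" using assms by (intro isreg_ev_neq_0)
  then show ?thesis
    using ord_isreg_pos_iff[OF assms(1,2)] ord_isreg_nonneg[OF assms(1,2)] assms(3) by simp
qed

lemma ord_const: 
  assumes "P \<in> points E" "c \<noteq> 0" shows "ord P (\<lambda>p. c) = 0"
proof (cases P)
  case Infinity
  have "has_ord P (\<lambda>p. c) 0" unfolding Infinity
    by (rule has_ord_InfinityI[of "[:c:]" 0 1 0]) (use assms in \<open>auto intro: ev_affineI simp: nrm_def power2_eq_square\<close>)
  then show ?thesis by (rule ord_eqI[OF assms(1) rfun_const[OF assms(2)]])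
next
  case (Affine a b)
  then show ?thesis using assms by (auto intro: ord_isreg_eq_0 isreg_intros)
qed

lemma ord_Infinity_reg:
  assumes "A \<noteq> 0 \<or> B \<noteq> 0" shows "ord Infinity (reg A B) = - int (degree (nrm A B))"
proof -
  have "has_ord Infinity (reg A B) (0 - int (degree (nrm A B)))"
    by (rule has_ord_InfinityI[of A B 1 0]) (use assms in \<open>auto intro: ev_affineI simp: nrm_def\<close>)
  then show ?thesis using ord_eqI[OF Infinity_in_points rfun_reg[OF assms]] by simp
qed

text \<open>At infinity both functions are put over a common denominator and norm degrees are
  compared. At an affine point the lower power of the local parameter is factored out; the cofactor
  is regular, so its order is nonnegative.\<close>

lemma ord_add_ge_aux:
  assumes "P \<in> points E" "rfun h" "rfun k" "ev (\<lambda>p. h p + k p \<noteq> 0)" "ord P h \<le> ord P k"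
  shows "ord P h \<le> ord P (\<lambda>p. h p + k p)"
proof -
  have hk: "rfun (\<lambda>p. h p + k p)"
    using assms unfolding rfun_def by (auto intro: rat_intros)
  show ?thesis
  proof (cases P)
    case Infinity
    obtain A B C D where 1: "A \<noteq> 0 \<or> B \<noteq> 0" "C \<noteq> 0 \<or> D \<noteq> 0" "ev (\<lambda>p. h p = reg A B p / reg C D p)"
      using assms(2) by (rule rfun_obtain)
    obtain A' B' C' D' where 2: "A' \<noteq> 0 \<or> B' \<noteq> 0" "C' \<noteq> 0 \<or> D' \<noteq> 0" "ev (\<lambda>p. k p = reg A' B' p / reg C' D' p)"
      using assms(3) by (rule rfun_obtain)
    define F G where "F = C * C' + f * D * D'" and "G = C * D' + D * C'"
    define A1 B1 where "A1 = A * C' + f * B * D'" and "B1 = A * D' + B * C'"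
    define A2 B2 where "A2 = A' * C + f * B' * D" and "B2 = A' * D + B' * C"
    have FG: "F \<noteq> 0 \<or> G \<noteq> 0" and A1: "A1 \<noteq> 0 \<or> B1 \<noteq> 0" and A2: "A2 \<noteq> 0 \<or> B2 \<noteq> 0"
      unfolding F_def G_def A1_def B1_def A2_def B2_def
      by (intro reg_mult_nonzero(1) 1 2)+
    have h: "ev (\<lambda>p. h p = reg A1 B1 p / reg F G p)" 
      using 1(3) ev_reg_mult[of A B C' D'] ev_reg_mult[of C D C' D'] ev_reg_neq_0[OF 2(2)]
    proof eventually_elim
      case (elim p)
      show ?case unfolding A1_def B1_def F_def G_def elim(1) elim(2)[symmetric] elim(3)[symmetric]
        using elim(4) by simp
    qed
    have k: "ev (\<lambda>p. k p = reg A2 B2 p / reg F G p)" 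
      using 2(3) ev_reg_mult[of A' B' C D] ev_reg_mult[of C D C' D'] ev_reg_neq_0[OF 1(2)]
    proof eventually_elim
      case (elim p)
      show ?case unfolding A2_def B2_def F_def G_def elim(1) elim(2)[symmetric] elim(3)[symmetric]
        using elim(4) by (simp add: field_simps)
    qed
    have hk': "ev (\<lambda>p. h p + k p = reg (A1 + A2) (B1 + B2) p / reg F G p)"
      using h k ev_affine by eventually_elim (auto simp: add_divide_distrib algebra_simps)
    have nz: "A1 + A2 \<noteq> 0 \<or> B1 + B2 \<noteq> 0"
    proof (rule ccontr)
      assume "\<not> ?thesis"
      then have z: "A1 + A2 = 0" "B1 + B2 = 0" by auto
      from hk' assms(4) ev_affine have "ev (\<lambda>p. False)" by eventually_elim (auto simp: z)
      then show False by simp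
    qed
    have o: "ord Infinity g = int (degree (nrm F G)) - int (degree (nrm U V))"
      if "U \<noteq> 0 \<or> V \<noteq> 0" "rfun g" "ev (\<lambda>p. g p = reg U V p / reg F G p)" for U V g
    proof -
      have "ord Infinity g = ord Infinity (\<lambda>p. reg U V p / reg F G p)"
        using ord_cong[OF Infinity_in_points that(2,3)] by simp
      also have "\<dots> = int (degree (nrm F G)) - int (degree (nrm U V))"
        using ord_divide[OF Infinity_in_points rfun_reg[OF that(1)] rfun_reg[OF FG]]
          ord_Infinity_reg[OF that(1)] ord_Infinity_reg[OF FG] by simp
      finally show ?thesis .
    qed
    show ?thesis
      using degree_nrm_add_le[OF nz] o[OF A1 assms(2) h] o[OF A2 assms(3) k] o[OF nz hk hk'] assms(5)
      unfolding Infinity by linarith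
  next
    case (Affine a b)
    have oc: "on_curve E a b" using assms(1) Affine by simp
    obtain s t where 1: "isreg s" "isreg t" "s P \<noteq> 0" "t P \<noteq> 0"
      and 2: "ev (\<lambda>p. s p * h p = t p * unif P p powi ord P h)"
      using has_ord_ord[OF assms(1,2)] unfolding Affine has_ord.simps by blast
    obtain s' t' where 3: "isreg s'" "isreg t'" "s' P \<noteq> 0" "t' P \<noteq> 0"
      and 4: "ev (\<lambda>p. s' p * k p = t' p * unif P p powi ord P k)"
      using has_ord_ord[OF assms(1,3)] unfolding Affine has_ord.simps by blast
    obtain d where d: "ord P k = ord P h + int d"
      using assms(5) by (metis zle_iff_zadd)
    \<comment> \<open>The cofactor: s s' times the sum equals \<open>r\<close> times the lower power
      of the parameter.\<close>
    define r where "r = (\<lambda>p. t p * s' p + t' p * s p * unif P p ^ d)"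
    have r: "isreg r" unfolding r_def Affine by (intro isreg_intros 1 3)
    have s: "ev (\<lambda>p. s p \<noteq> 0)" "ev (\<lambda>p. s' p \<noteq> 0)"
      using isreg_ev_neq_0[OF _ oc] 1 3 Affine by auto
    have eq: "ev (\<lambda>p. s p * s' p * (h p + k p) = r p * unif P p powi ord P h)"
      using 2 4 ev_unif_neq_0[of a b, folded Affine]
    proof eventually_elim
      case (elim p)
      have "s p * s' p * (h p + k p) = s' p * (s p * h p) + s p * (s' p * k p)"
        by (simp add: algebra_simps)
      also have "\<dots> = r p * unif P p powi ord P h"
        unfolding elim(1,2) d r_def using elim(3) by (simp add: power_int_add algebra_simps)
      finally show ?case .
    qed
    have nz: "ev (\<lambda>p. r p \<noteq> 0)"
      using eq s assms(4) by eventually_elim auto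
    obtain j where j: "j \<ge> 0" "has_ord P r j"
      using has_ord_isreg_exists[OF oc r nz] Affine by blast
    obtain s'' t'' where 5: "isreg s''" "isreg t''" "s'' P \<noteq> 0" "t'' P \<noteq> 0"
      and 6: "ev (\<lambda>p. s'' p * r p = t'' p * unif P p powi j)"
      using j(2) unfolding Affine has_ord.simps by blast
    have "has_ord (Affine a b) (\<lambda>p. h p + k p) (j + ord P h)"
    proof (rule has_ord_AffineI)
      show "isreg (\<lambda>p. s'' p * (s p * s' p))" by (intro isreg_intros 1 3 5)
      show "isreg t''" by fact
      show "ev (\<lambda>p. s'' p * (s p * s' p) * (h p + k p) = t'' p * unif (Affine a b) p powi (j + ord P h))"
        using eq 6 ev_unif_neq_0[of a b, folded Affine]
      proof eventually_elim
        case (elim p)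
        have "s'' p * (s p * s' p) * (h p + k p) = (s'' p * r p) * unif P p powi ord P h"
          using elim(1) by (simp add: mult_ac)
        also have "\<dots> = t'' p * unif P p powi (j + ord P h)"
          unfolding elim(2) using elim(3) by (simp add: power_int_add mult_ac)
        finally show ?case unfolding Affine .
      qed
    qed (use 1 3 5 Affine in auto)
    then have "ord P (\<lambda>p. h p + k p) = j + ord P h"
      using ord_eqI[OF assms(1) hk] Affine by blast
    then show ?thesis using j by simp
  qed
qed

lemma ord_add_ge:
  assumes "P \<in> points E" "rfun h" "rfun k" "ev (\<lambda>p. h p + k p \<noteq> 0)"
  shows "min (ord P h) (ord P k) \<le> ord P (\<lambda>p. h p + k p)"
proof (cases "ord P h \<le> ord P k")
  case True
  then show ?thesis using ord_add_ge_aux[OF assms] by simp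
next
  case False
  have "ev (\<lambda>p. k p + h p \<noteq> 0)" using assms(4) by (simp add: add.commute)
  then show ?thesis using ord_add_ge_aux[OF assms(1,3,2)] False by (simp add: add.commute)
qed

section \<open>Orders of the coordinate functions\<close>

lemma ev_xc_neq: "ev (\<lambda>p. xc p - a \<noteq> 0)"
proof -
  have "ev (\<lambda>p. reg [:-a, 1:] 0 p \<noteq> 0)" by (intro ev_reg_neq_0) simp
  with ev_affine show ?thesis by eventually_elim auto
qed

lemma ev_yc_neq: "ev (\<lambda>p. yc p \<noteq> 0)"
proof -
  have "ev (\<lambda>p. reg 0 1 p \<noteq> 0)" by (intro ev_reg_neq_0) simp
  with ev_affine show ?thesis by eventually_elim auto
qed

lemma rfun_xc_diff: "rfun (\<lambda>p. xc p - a)"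
  by (intro rfun_isreg isreg_intros ev_xc_neq)

lemma rfun_yc: "rfun yc"
  by (intro rfun_isreg isreg_intros ev_yc_neq)

lemma ord_xc_diff_Affine:
  assumes "on_curve E x y"
  shows "ord (Affine x y) (\<lambda>p. xc p - a) = (if x = a then if y = 0 then 2 else 1 else 0)"
proof (cases "x = a")
  case True
  then show ?thesis
    using ord_eqI[OF _ rfun_xc_diff has_ord_xc_diff[OF assms]] assms by auto
next
  case False
  then have "ord (Affine x y) (\<lambda>p. xc p - a) = 0"
    by (intro ord_isreg_eq_0 isreg_intros assms) simp
  then show ?thesis using False by simp
qed

lemma ord_xc_diff_Infinity: "ord Infinity (\<lambda>p. xc p - a) = -2"
proof -
  have "ord Infinity (reg [:-a, 1:] 0) = - 2"
    by (subst ord_Infinity_reg) (simp_all add: degree_nrm)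
  moreover have "ev (\<lambda>p. reg [:-a, 1:] 0 p = xc p - a)"
    by (rule ev_affineI) simp
  ultimately show ?thesis using ord_cong[OF Infinity_in_points rfun_reg[of "[:-a, 1:]" 0], of "\<lambda>p. xc p - a"] by simp
qed

lemma ord_yc_Infinity: "ord Infinity yc = -3"
proof -
  have "ord Infinity (reg 0 1) = - 3"
    by (subst ord_Infinity_reg) (simp_all add: degree_nrm)
  moreover have "ev (\<lambda>p. reg 0 1 p = yc p)"
    by (rule ev_affineI) simp
  ultimately show ?thesis using ord_cong[OF Infinity_in_points rfun_reg[of 0 1], of yc] by simp
qed

lemma ord_unif:
  assumes "on_curve E a b" shows "ord (Affine a b) (unif (Affine a b)) = 1"
proof (rule ord_eqI)
  show "has_ord (Affine a b) (unif (Affine a b)) 1"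
    by (rule has_ord_AffineI[of "\<lambda>p. 1" "\<lambda>p. 1"]) (auto intro: isreg_intros)
  show "rfun (unif (Affine a b))"
    by (intro rfun_isreg ev_unif_neq_0 isreg_unif)
qed (use assms in simp)


subsection \<open>Functions with prescribed behaviour at all points\<close>

lemma poly_xc_rfun: "D \<noteq> 0 \<Longrightarrow> rfun (\<lambda>p. poly D (xc p))"
  by (rule rfun_cong[OF rfun_reg[of D 0]]) (auto intro: ev_affineI)

text \<open>Integral closedness of F[x] + F[x] y. A root a of the denominator D can be cancelled
  because nonnegative orders force both A and B to vanish at a; the induction runs on deg D.\<close>

lemma regular_if_ord_nonneg_aux:
  assumes "rfun h" "\<And>x y. on_curve E x y \<Longrightarrow> ord (Affine x y) h \<ge> 0"
  assumes "D \<noteq> 0" "A \<noteq> 0 \<or> B \<noteq> 0" "ev (\<lambda>p. h p * poly D (xc p) = reg A B p)"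
  shows "\<exists>A B. (A \<noteq> 0 \<or> B \<noteq> 0) \<and> ev (\<lambda>p. h p = reg A B p)"
  using assms(3-)
proof (induction "degree D" arbitrary: D A B)
  case 0
  then obtain c where D: "D = [:c:]" "c \<noteq> 0"
    by (metis degree_eq_zeroE pCons_0_0)
  have "ev (\<lambda>p. h p = reg (smult (1 / c) A) (smult (1 / c) B) p)"
    using 0(4) ev_affine by eventually_elim (use D in \<open>auto simp: field_simps\<close>)
  moreover have "smult (1 / c) A \<noteq> 0 \<or> smult (1 / c) B \<noteq> 0" using 0 D by auto
  ultimately show ?case by blast
next
  case (Suc n)
  obtain a where "poly D a = 0"
    using alg_closed_imp_poly_has_root[of D] Suc(2) by auto
  then obtain D' where D': "D = [:-a, 1:] * D'" by (auto simp: poly_eq_0_iff_dvd elim: dvdE)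
  then have D'0: "D' \<noteq> 0" using Suc by auto
  have ord: "ord (Affine x y) (reg A B) \<ge> ord (Affine x y) (\<lambda>p. xc p - a)" if "on_curve E x y" for x y
  proof -
    have P: "Affine x y \<in> points E" using that by simp
    have "ev (\<lambda>p. h p * ((xc p - a) * poly D' (xc p)) = reg A B p)"
      using Suc(5) by eventually_elim (simp add: D' algebra_simps)
    from ord_cong[OF P _ this]
    have "ord (Affine x y) (reg A B) = ord (Affine x y) (\<lambda>p. h p * ((xc p - a) * poly D' (xc p)))"
      by (simp add: rfun_mult assms(1) rfun_xc_diff poly_xc_rfun[OF D'0])
    also have "\<dots> = ord (Affine x y) h + (ord (Affine x y) (\<lambda>p. xc p - a) + ord (Affine x y) (\<lambda>p. poly D' (xc p)))"
      by (simp add: ord_mult[OF P] rfun_mult assms(1) rfun_xc_diff poly_xc_rfun[OF D'0])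
    moreover have "ord (Affine x y) (\<lambda>p. poly D' (xc p)) \<ge> 0"
      using poly_xc_rfun[OF D'0] by (intro ord_isreg_nonneg isreg_intros that) (simp add: rfun_def)
    ultimately show ?thesis using assms(2)[OF that] by simp
  qed
  have zero: "reg A B (Affine x y) = 0" if "on_curve E x y" "x = a" for x y
    using ord[OF that(1)] ord_xc_diff_Affine[OF that(1), of a] that(2)
      ord_isreg_pos_iff[OF that(1) isreg_reg ev_reg_neq_0[OF Suc(4)]] by (auto split: if_splits)
  obtain b where b: "on_curve E a b" using sqrt_f_exists by blast
  have b': "on_curve E a (-b)" using b by (simp add: on_curve_iff)
  \<comment> \<open>Two distinct points above a give two linear equations for A(a) and B(a),
    independent since 2b is nonzero. If b = 0 the points merge, and the double zero of x - a
    replaces the second equation: A is zero or of order at least 2 there, whereas B y has order 1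
    unless B(a) = 0.\<close>
  have "poly A a = 0 \<and> poly B a = 0"
  proof (cases "b = 0")
    case False
    have "poly A a + poly B a * b = 0" "poly A a - poly B a * b = 0"
      using zero[OF b] zero[OF b'] by auto
    then have "poly A a + poly A a = 0" "poly B a * b = - poly A a" by Groebner_Basis.algebra+
    then show ?thesis using double_eq_0_iff False by simp
  next
    case True
    have P: "Affine a b \<in> points E" using b by simp
    have Aa: "poly A a = 0" using zero[OF b] True by simp
    then obtain A' where A': "A = [:-a, 1:] * A'" by (auto simp: poly_eq_0_iff_dvd elim: dvdE)
    have o2: "ord (Affine a b) (reg A B) \<ge> 2"
      using ord[OF b] ord_xc_diff_Affine[OF b, of a] True by simp
    have "poly B a = 0"
    proof (rule ccontr)
      assume Ba: "poly B a \<noteq> 0"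
      then have B0: "B \<noteq> 0" by auto
      have By: "rfun (\<lambda>p. poly B (xc p) * yc p)" by (intro rfun_mult poly_xc_rfun B0 rfun_yc)
      have "ord (Affine a b) (\<lambda>p. poly B (xc p)) = 0"
        by (intro ord_isreg_eq_0 isreg_intros b) (use Ba in simp)
      moreover have "unif (Affine a b) = yc" by (rule ext) (simp add: True)
      then have "ord (Affine a b) yc = 1" using ord_unif[OF b] by simp
      ultimately have oBy: "ord (Affine a b) (\<lambda>p. poly B (xc p) * yc p) = 1"
        by (simp add: ord_mult[OF P] poly_xc_rfun B0 rfun_yc)
      show False
      proof (cases "A = 0")
        case True
        have "ev (\<lambda>p. reg A B p = poly B (xc p) * yc p)"
          by (rule ev_affineI) (simp add: True)
        then show False using ord_cong[OF P rfun_reg[OF Suc(4)], of "\<lambda>p. poly B (xc p) * yc p"] oBy o2 by simp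
      next
        case False
        then have A'0: "A' \<noteq> 0" using A' by auto
        have fA: "rfun (\<lambda>p. poly A (xc p))" by (intro poly_xc_rfun False)
        then have nA: "rfun (\<lambda>p. - 1 * poly A (xc p))" by (intro rfun_mult rfun_const) simp_all
        have "ord (Affine a b) (\<lambda>p. poly A (xc p)) = ord (Affine a b) (\<lambda>p. (xc p - a) * poly A' (xc p))"
          by (rule arg_cong[where f = "ord _"]) (auto simp: A' algebra_simps)
        also have "\<dots> \<ge> 2"
          using ord_isreg_nonneg[OF b isreg_poly[of A']] ord_xc_diff_Affine[OF b, of a] \<open>b = 0\<close>
            ord_mult[OF P rfun_xc_diff[of a] poly_xc_rfun[OF A'0]] poly_xc_rfun[OF A'0, unfolded rfun_def]
          by simp
        finally have "ord (Affine a b) (\<lambda>p. - 1 * poly A (xc p)) \<ge> 2"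
          using ord_mult[OF P rfun_const[of "-1"] fA] ord_const[OF P, of "-1"] by simp
        moreover have eq: "ev (\<lambda>p. reg A B p + - 1 * poly A (xc p) = poly B (xc p) * yc p)"
          by (rule ev_affineI) simp
        moreover have "ev (\<lambda>p. reg A B p + - 1 * poly A (xc p) \<noteq> 0)"
          using eq By[unfolded rfun_def, THEN conjunct2] by eventually_elim simp
        moreover have "rfun (\<lambda>p. reg A B p + - 1 * poly A (xc p))"
          by (rule rfun_cong[OF By]) (use eq in eventually_elim, simp)
        ultimately show False
          using ord_add_ge[OF P rfun_reg[OF Suc(4)] nA] o2 oBy
            ord_cong[OF P \<open>rfun (\<lambda>p. reg A B p + - 1 * poly A (xc p))\<close> eq] by linarith
      qed
    qed
    then show ?thesis using Aa by blast
  qed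
  then obtain A' B' where AB: "A = [:-a, 1:] * A'" "B = [:-a, 1:] * B'"
    by (auto simp: poly_eq_0_iff_dvd elim!: dvdE)
  have "ev (\<lambda>p. h p * poly D' (xc p) = reg A' B' p)"
    using Suc(5) ev_xc_neq[of a] ev_affine
  proof eventually_elim
    case (elim p)
    then obtain x y where p: "p = Affine x y" by blast
    have "(x - a) * (h p * poly D' x) = (x - a) * reg A' B' p"
      using elim(1) unfolding p D' AB by (simp add: algebra_simps)
    then show ?case using elim(2) p by (metis mult_cancel_left xc.simps(2))
  qed
  moreover have "A' \<noteq> 0 \<or> B' \<noteq> 0" using Suc(4) AB by auto
  moreover have "degree D = Suc (degree D')"
    unfolding D' using D'0 by (subst degree_mult_eq) auto
  then have "n = degree D'" using Suc(2) by simp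
  ultimately show ?case using Suc(1)[of D' A' B'] D'0 by blast
qed

text \<open>Multiplying by the conjugate of the denominator leaves a denominator in F[x].\<close>

lemma regular_if_ord_nonneg:
  assumes "rfun h" "\<And>x y. on_curve E x y \<Longrightarrow> ord (Affine x y) h \<ge> 0"
  obtains A B where "A \<noteq> 0 \<or> B \<noteq> 0" "ev (\<lambda>p. h p = reg A B p)"
proof -
  obtain A B C D where 1: "A \<noteq> 0 \<or> B \<noteq> 0" "C \<noteq> 0 \<or> D \<noteq> 0" "ev (\<lambda>p. h p = reg A B p / reg C D p)"
    using assms(1) by (rule rfun_obtain)
  have 2: "C \<noteq> 0 \<or> - D \<noteq> 0" using 1(2) by simp
  have "ev (\<lambda>p. h p * poly (nrm C D) (xc p) = reg (A * C + f * B * (- D)) (A * (- D) + B * C) p)"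
    using 1(3) ev_reg_neq_0[OF 1(2)] ev_affine
  proof eventually_elim
    case (elim p)
    then obtain x y where p: "p = Affine x y" "on_curve E x y" by blast
    show ?case
      unfolding elim(1) unfolding p xc.simps reg_conj[OF p(2), symmetric] reg_mult[OF p(2), symmetric]
      using elim(2) by (simp add: p field_simps)
  qed
  then show ?thesis
    using regular_if_ord_nonneg_aux[OF assms degree_nrm(1)[OF 1(2)] reg_mult_nonzero(1)[OF 1(1) 2]] that
    by blast
qed

text \<open>Without affine poles the function is some A + B y; without a pole at infinity its norm
  has degree 0, which only constants satisfy.\<close>

lemma const_if_ord_nonneg:
  assumes "rfun h" "\<And>P. P \<in> points E \<Longrightarrow> ord P h \<ge> 0"
  obtains c where "c \<noteq> 0" "ev (\<lambda>p. h p = c)"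
proof -
  obtain A B where AB: "A \<noteq> 0 \<or> B \<noteq> 0" "ev (\<lambda>p. h p = reg A B p)"
    using regular_if_ord_nonneg[OF assms(1)] assms(2) by auto
  have "ord Infinity (reg A B) \<ge> 0"
    using ord_cong[OF Infinity_in_points assms(1) AB(2)] assms(2)[OF Infinity_in_points] by simp
  then have "degree (nrm A B) = 0" using ord_Infinity_reg[OF AB(1)] by simp
  then have "degree A = 0" "B = 0" using degree_nrm(2)[OF AB(1)] by (auto split: if_splits)
  then obtain c where "A = [:c:]" "c \<noteq> 0" using AB(1) by (metis degree_eq_zeroE pCons_0_0)
  moreover from AB(2) ev_affine have "ev (\<lambda>p. h p = c)"
    by eventually_elim (auto simp: \<open>A = [:c:]\<close> \<open>B = 0\<close>)
  ultimately show ?thesis using that by blast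
qed

lemma proportional_if_same_ord:
  assumes "rfun h" "rfun k" "\<And>P. P \<in> points E \<Longrightarrow> ord P h = ord P k"
  obtains c where "c \<noteq> 0" "ev (\<lambda>p. h p = c * k p)"
proof -
  obtain c where c: "c \<noteq> 0" "ev (\<lambda>p. h p / k p = c)"
    using const_if_ord_nonneg[OF rfun_divide[OF assms(1,2)]] assms by (metis diff_self ord_divide order_refl)
  from c(2) assms(2)[unfolded rfun_def, THEN conjunct2] have "ev (\<lambda>p. h p = c * k p)"
    by eventually_elim (auto simp: field_simps)
  with c(1) show ?thesis using that by blast
qed

subsection \<open>Negation and the degree of a divisor\<close>

fun neg :: "'a point \<Rightarrow> 'a point" where
  "neg Infinity = Infinity"
| "neg (Affine x y) = Affine x (- y)"

lemma neg_neg [simp]: "neg (neg P) = P"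
  by (cases P) auto

lemma neg_in_points [simp]: "neg P \<in> points E \<longleftrightarrow> P \<in> points E"
  by (cases P) (auto simp: on_curve_iff)

lemma neg_eq_Infinity_iff [simp]: "neg P = Infinity \<longleftrightarrow> P = Infinity"
  by (cases P) auto

lemma neg_eq_iff [simp]: "neg P = neg Q \<longleftrightarrow> P = Q"
  by (metis neg_neg)

text \<open>Finite exceptional sets pull back to finite ones. Applied to negation, to translations
  and to field automorphisms.\<close>

lemma ev_inj:
  assumes "ev Q" "inj_on \<phi> (points E)" "\<phi> ` points E \<subseteq> points E"
  shows "ev (\<lambda>p. Q (\<phi> p))"
proof -
  have "finite (\<phi> -` {p \<in> points E. \<not> Q p} \<inter> points E)"
    using assms(1,2) by (intro finite_vimage_IntI) (auto simp: ev_iff)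
  then show ?thesis unfolding ev_iff by (rule rev_finite_subset) (use assms(3) in auto)
qed

lemma ev_neg: "ev Q \<Longrightarrow> ev (\<lambda>p. Q (neg p))"
  by (rule ev_inj) (auto simp: inj_on_def)

lemma isreg_neg: "isreg h \<Longrightarrow> isreg (\<lambda>p. h (neg p))"
proof (elim isreg_obtain)
  fix A B assume *: "\<And>x y. on_curve E x y \<Longrightarrow> h (Affine x y) = reg A B (Affine x y)"
  show "isreg (\<lambda>p. h (neg p))"
    by (rule isregI[of _ A "- B"]) (use * in \<open>simp add: on_curve_iff\<close>)
qed

lemma rat_neg: "rat h \<Longrightarrow> rat (\<lambda>p. h (neg p))"
proof -
  assume "rat h"
  then obtain u v where *: "isreg u" "isreg v" "ev (\<lambda>p. v p \<noteq> 0)" "ev (\<lambda>p. h p = u p / v p)"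
    unfolding rat_def by blast
  then show ?thesis
    by (intro ratI[OF isreg_neg[OF *(1)] isreg_neg[OF *(2)] ev_neg[OF *(3)] ev_neg[OF *(4)]])
qed

lemma rfun_neg: "rfun h \<Longrightarrow> rfun (\<lambda>p. h (neg p))"
  unfolding rfun_def using rat_neg ev_neg[of "\<lambda>p. h p \<noteq> 0"] by blast

lemma ord_neg:
  assumes "P \<in> points E" "rfun h"
  shows "ord P (\<lambda>p. h (neg p)) = ord (neg P) h"
proof (rule ord_eqI[OF assms(1) rfun_neg[OF assms(2)]])
  have ho: "has_ord (neg P) h (ord (neg P) h)" using has_ord_ord assms by simp
  show "has_ord P (\<lambda>p. h (neg p)) (ord (neg P) h)"
  proof (cases P)
    case Infinity
    obtain A B C D where *: "A \<noteq> 0 \<or> B \<noteq> 0" "C \<noteq> 0 \<or> D \<noteq> 0" "ev (\<lambda>p. reg C D p * h p = reg A B p)"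
      "ord (neg P) h = int (degree (nrm C D)) - int (degree (nrm A B))"
      using ho unfolding Infinity neg.simps has_ord.simps by blast
    have "reg F G (neg p) = reg F (- G) p" for F G p by (cases p) auto
    with ev_neg[OF *(3)] have "ev (\<lambda>p. reg C (- D) p * h (neg p) = reg A (- B) p)" by simp
    then show ?thesis using * unfolding Infinity
      by (intro has_ord_InfinityI[of A "- B" C "- D"]) (auto simp: nrm_def)
  next
    case (Affine a b)
    obtain s t where *: "isreg s" "isreg t" "s (neg P) \<noteq> 0" "t (neg P) \<noteq> 0"
      "ev (\<lambda>p. s p * h p = t p * unif (neg P) p powi ord (neg P) h)"
      using ho unfolding Affine neg.simps has_ord.simps by blast
    \<comment> \<open>Negation sends the parameter y to -y at a point with b = 0 and fixes x - a
      otherwise; \<open>e\<close> is this unit.\<close>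
    define e :: 'a where "e = (if b = 0 then - 1 else 1)"
    have u: "unif (Affine a (- b)) (neg p) = e * unif (Affine a b) p" for p
      by (cases p) (auto simp: e_def)
    have e0: "e \<noteq> 0" by (simp add: e_def)
    show ?thesis unfolding Affine
    proof (rule has_ord_AffineI)
      show "isreg (\<lambda>p. s (neg p))" by (intro isreg_neg *)
      show "isreg (\<lambda>p. t (neg p) * e powi ord (neg P) h)" by (intro isreg_intros isreg_neg *)
      show "ev (\<lambda>p. s (neg p) * h (neg p) = t (neg p) * e powi ord (neg P) h *
          unif (Affine a b) p powi ord (neg (Affine a b)) h)"
        using ev_neg[OF *(5)] unfolding Affine neg.simps u
        by eventually_elim (simp add: power_int_mult_distrib mult_ac)
    qed (use * Affine e0 in auto)
  qed
qed

lemma finite_ord_support: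
  assumes "rfun h" shows "finite {P \<in> points E. ord P h \<noteq> 0}"
proof -
  have *: "finite {P \<in> points E. ord P (reg A B) \<noteq> 0}" if "A \<noteq> 0 \<or> B \<noteq> 0" for A B
  proof -
    have "finite {P \<in> points E. \<not> (reg A B P \<noteq> 0)}" using ev_reg_neq_0[OF that] unfolding ev_iff .
    moreover have "{P \<in> points E. ord P (reg A B) \<noteq> 0} \<subseteq> insert Infinity {P \<in> points E. \<not> (reg A B P \<noteq> 0)}"
      using ord_isreg_eq_0[OF _ isreg_reg] by (auto elim!: points_cases simp del: reg.simps)
    ultimately show ?thesis using finite_subset by blast
  qed
  obtain A B C D where 1: "A \<noteq> 0 \<or> B \<noteq> 0" "C \<noteq> 0 \<or> D \<noteq> 0" "ev (\<lambda>p. h p = reg A B p / reg C D p)"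
    using assms(1) by (rule rfun_obtain)
  have "ord P h = ord P (reg A B) - ord P (reg C D)" if "P \<in> points E" for P
    using ord_cong[OF that assms 1(3)] ord_divide[OF that rfun_reg[OF 1(1)] rfun_reg[OF 1(2)]] by simp
  then have "{P \<in> points E. ord P h \<noteq> 0} \<subseteq> {P \<in> points E. ord P (reg A B) \<noteq> 0} \<union> {P \<in> points E. ord P (reg C D) \<noteq> 0}"
    by auto
  then show ?thesis using *[OF 1(1)] *[OF 1(2)] finite_subset by blast
qed

text \<open>The degree of the divisor of h; for a nonzero rational function the support is
  finite.\<close>

definition dg :: "('a point \<Rightarrow> 'a) \<Rightarrow> int" where
  "dg h = (\<Sum>P\<in>{P \<in> points E. ord P h \<noteq> 0}. ord P h)"

lemma dg_eq_sum:
  assumes "finite S" "S \<subseteq> points E" "\<And>P. P \<in> points E \<Longrightarrow> P \<notin> S \<Longrightarrow> ord P h = 0"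
  shows "dg h = (\<Sum>P\<in>S. ord P h)"
  unfolding dg_def by (rule sum.mono_neutral_left) (use assms in auto)

lemma dg_mult:
  assumes "rfun h" "rfun k" shows "dg (\<lambda>p. h p * k p) = dg h + dg k"
proof -
  define S where "S = {P \<in> points E. ord P h \<noteq> 0} \<union> {P \<in> points E. ord P k \<noteq> 0}"
  have S: "finite S" "S \<subseteq> points E" unfolding S_def using finite_ord_support assms by auto
  have "dg (\<lambda>p. h p * k p) = (\<Sum>P\<in>S. ord P (\<lambda>p. h p * k p))"
    using S by (rule dg_eq_sum) (auto simp: ord_mult assms S_def)
  also have "\<dots> = (\<Sum>P\<in>S. ord P h + ord P k)"
    by (rule sum.cong) (use S ord_mult assms in auto)
  also have "\<dots> = dg h + dg k"
    using dg_eq_sum[OF S, of h] dg_eq_sum[OF S, of k] by (simp add: sum.distrib S_def)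
  finally show ?thesis .
qed

lemma dg_cong: assumes "rfun h" "ev (\<lambda>p. h p = k p)" shows "dg k = dg h"
  unfolding dg_def using ord_cong[OF _ assms] by (intro sum.cong) auto

lemma dg_const: "c \<noteq> 0 \<Longrightarrow> dg (\<lambda>p. c) = 0"
  unfolding dg_def by (rule sum.neutral) (auto simp: ord_const)

lemma dg_xc_diff: "dg (\<lambda>p. xc p - a) = 0"
proof -
  obtain b where b: "on_curve E a b" using sqrt_f_exists by blast
  have pts: "on_curve E a y \<longleftrightarrow> y = b \<or> y = - b" for y
    using b power2_eq_iff[of y b] by (auto simp: on_curve_iff)
  have "dg (\<lambda>p. xc p - a) = (\<Sum>P\<in>{Infinity, Affine a b, Affine a (- b)}. ord P (\<lambda>p. xc p - a))"
  proof (rule dg_eq_sum)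
    show "{Infinity, Affine a b, Affine a (- b)} \<subseteq> points E" using pts by auto
    fix P assume P: "P \<in> points E" "P \<notin> {Infinity, Affine a b, Affine a (- b)}"
    from P(1) show "ord P (\<lambda>p. xc p - a) = 0"
      by (cases rule: points_cases) (use P(2) pts in \<open>auto simp: ord_xc_diff_Affine\<close>)
  qed simp
  also have "\<dots> = 0"
    using pts[of b] pts[of "- b"] eq_minus_self_iff[of b]
    by (cases "b = 0") (auto simp: ord_xc_diff_Infinity ord_xc_diff_Affine)
  finally show ?thesis .
qed

lemma dg_poly: "D \<noteq> 0 \<Longrightarrow> dg (\<lambda>p. poly D (xc p)) = 0"
proof (induction "degree D" arbitrary: D)
  case 0
  then obtain c where "D = [:c:]" "c \<noteq> 0" by (metis degree_eq_zeroE pCons_0_0)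
  then show ?case by (simp add: dg_const)
next
  case (Suc n)
  obtain a where "poly D a = 0"
    using alg_closed_imp_poly_has_root[of D] Suc(2) by auto
  then obtain D' where D': "D = [:-a, 1:] * D'" by (auto simp: poly_eq_0_iff_dvd elim: dvdE)
  then have D'0: "D' \<noteq> 0" using Suc by auto
  have "(\<lambda>p. poly D (xc p)) = (\<lambda>p. (xc p - a) * poly D' (xc p))"
    by (auto simp: D' algebra_simps)
  moreover have "degree D = Suc (degree D')"
    unfolding D' using D'0 by (subst degree_mult_eq) auto
  then have "dg (\<lambda>p. poly D' (xc p)) = 0"
    using Suc(1)[of D'] Suc(2) D'0 by simp
  ultimately show ?case
    using dg_mult[OF rfun_xc_diff[of a] poly_xc_rfun[OF D'0]] dg_xc_diff by simp
qed

text \<open>Negation acts as conjugation and preserves the degree. The product with the conjugate is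
  the norm, a polynomial in x and thus of degree 0, so twice the degree vanishes.\<close>

lemma dg_reg:
  assumes "A \<noteq> 0 \<or> B \<noteq> 0" shows "dg (reg A B) = 0"
proof -
  have *: "dg (\<lambda>p. reg A B (neg p)) = dg (reg A B)"
    unfolding dg_def
    by (rule sum.reindex_bij_witness[of _ neg neg]) (auto simp: ord_neg rfun_reg[OF assms])
  have "ev (\<lambda>p. poly (nrm A B) (xc p) = reg A B p * reg A B (neg p))"
    by (rule ev_affineI) (use reg_conj[of _ _ A B] in simp)
  from dg_cong[OF poly_xc_rfun[OF degree_nrm(1)[OF assms]] this]
  have "dg (\<lambda>p. reg A B p * reg A B (neg p)) = 0"
    using dg_poly[OF degree_nrm(1)[OF assms]] by simp
  then show ?thesis
    using dg_mult[OF rfun_reg[OF assms] rfun_neg[OF rfun_reg[OF assms]]] * by simp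
qed

lemma dg_eq_0: assumes "rfun h" shows "dg h = 0"
proof -
  obtain A B C D where 1: "A \<noteq> 0 \<or> B \<noteq> 0" "C \<noteq> 0 \<or> D \<noteq> 0" "ev (\<lambda>p. h p = reg A B p / reg C D p)"
    using assms(1) by (rule rfun_obtain)
  have "ev (\<lambda>p. h p * reg C D p = reg A B p)"
    using 1(3) ev_reg_neq_0[OF 1(2)] by eventually_elim simp
  from dg_cong[OF rfun_mult[OF assms rfun_reg[OF 1(2)]] this]
  show ?thesis using dg_mult[OF assms rfun_reg[OF 1(2)]] dg_reg 1 by simp
qed


subsection \<open>Lines and the group law\<close>

abbreviation pa :: "'a point \<Rightarrow> 'a point \<Rightarrow> 'a point" (infixl "\<uplus>" 65) where
  "P \<uplus> Q \<equiv> add_pt E P Q"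

lemma add_Infinity_right [simp]: "P \<uplus> Infinity = P"
  by (cases P) auto

text \<open>The chord, or the tangent when the points coincide. Inserting it into the equation gives
  a cubic in x with leading coefficient -1 and roots x1, x2; the coefficient of x^2 yields the third
  root x3.\<close>

lemma line_identity:
  fixes x1 y1 x2 y2 :: 'a
  assumes oc: "on_curve E x1 y1" "on_curve E x2 y2" and ne: "\<not> (x1 = x2 \<and> y1 + y2 = 0)"
  obtains l x3 where "Affine x1 y1 \<uplus> Affine x2 y2 = Affine x3 (- (y1 + l * (x3 - x1)))"
    "y2 = y1 + l * (x2 - x1)"
    "\<And>x. (y1 + l * (x - x1)) ^ 2 - poly f x = - ((x - x1) * (x - x2) * (x - x3))"
proof -
  have e1: "y1 ^ 2 = x1 ^ 3 + wa2 E * x1 ^ 2 + wa4 E * x1 + wa6 E"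
    and e2: "y2 ^ 2 = x2 ^ 3 + wa2 E * x2 ^ 2 + wa4 E * x2 + wa6 E"
    using oc by (simp_all add: on_curve_iff poly_f)
  define l where "l = (if x1 = x2 then (3 * x1 ^ 2 + 2 * wa2 E * x1 + wa4 E) / (2 * y1)
    else (y2 - y1) / (x2 - x1))"
  define x3 where "x3 = l ^ 2 - wa2 E - x1 - x2"
  have sum: "Affine x1 y1 \<uplus> Affine x2 y2 = Affine x3 (- (y1 + l * (x3 - x1)))"
    using ne by (auto simp: a1 a3 Let_def l_def x3_def algebra_simps)
  show ?thesis
  proof (cases "x1 = x2")
    case True
    then have "y1 ^ 2 = y2 ^ 2" using e1 e2 by simp
    then have y: "y1 = y2" "y1 + y1 \<noteq> 0" using ne True power2_eq_iff[of y1 y2] by auto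
    then have "y1 \<noteq> 0" using double_eq_0_iff by simp
    then have l: "2 * y1 * l = 3 * x1 ^ 2 + 2 * wa2 E * x1 + wa4 E"
      using True two_neq_0 by (simp add: l_def)
    have "(y1 + l * (x - x1)) ^ 2 - poly f x = - ((x - x1) * (x - x2) * (x - x3))" for x
      unfolding poly_f x3_def True[symmetric] using e1 l by Groebner_Basis.algebra
    then show ?thesis using that[OF sum] True y by simp
  next
    case False
    then have l: "l * (x2 - x1) = y2 - y1" by (simp add: l_def)
    have "(y1 + l * (x - x1)) ^ 2 - poly f x = - ((x - x1) * (x - x2) * (x - x3))" for x
    proof -
      \<comment> \<open>The slope is only known through l (x2 - x1) = y2 - y1; the factor x2 - x1
        makes the claim a polynomial consequence of this and of the two curve equations.\<close>
      have "(x2 - x1) * ((y1 + l * (x - x1)) ^ 2 - poly f x + (x - x1) * (x - x2) * (x - x3)) = 0"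
        unfolding poly_f x3_def using e1 e2 l by Groebner_Basis.algebra
      then have "(y1 + l * (x - x1)) ^ 2 - poly f x + (x - x1) * (x - x2) * (x - x3) = 0"
        using False by simp
      then show ?thesis by (simp add: eq_neg_iff_add_eq_0)
    qed
    then show ?thesis using that[OF sum] l by (simp add: algebra_simps)
  qed
qed

text \<open>The function is y minus the line. Its norm -(x - x1)(x - x2)(x - x3) gives the sum of
  the orders at R and -R. For R on the line, either R = -R and the sum is halved, or -R is off the
  line and contributes 0.\<close>

lemma line_function:
  fixes x1 y1 x2 y2 :: 'a
  assumes oc: "on_curve E x1 y1" "on_curve E x2 y2" and ne: "\<not> (x1 = x2 \<and> y1 + y2 = 0)"
  shows "Affine x1 y1 \<uplus> Affine x2 y2 \<in> points E - {Infinity}"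
    "\<exists>h. rfun h \<and> (\<forall>R\<in>points E. ord R h = of_bool (R = Affine x1 y1) + of_bool (R = Affine x2 y2)
      + of_bool (R = neg (Affine x1 y1 \<uplus> Affine x2 y2)) - 3 * of_bool (R = Infinity))"
proof -
  obtain l x3 where sum: "Affine x1 y1 \<uplus> Affine x2 y2 = Affine x3 (- (y1 + l * (x3 - x1)))"
    and y2: "y2 = y1 + l * (x2 - x1)"
    and id: "\<And>x. (y1 + l * (x - x1)) ^ 2 - poly f x = - ((x - x1) * (x - x2) * (x - x3))"
    using line_identity[OF assms] by blast
  define y3 where "y3 = y1 + l * (x3 - x1)"
  have oc3: "on_curve E x3 y3" using id[of x3] by (simp add: on_curve_iff y3_def)
  then show "Affine x1 y1 \<uplus> Affine x2 y2 \<in> points E - {Infinity}"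
    unfolding sum y3_def[symmetric] by (simp add: on_curve_iff)
  define A where "A = [:- y1 + l * x1, - l:]"
  have A: "poly A x = - (y1 + l * (x - x1))" for x by (simp add: A_def algebra_simps)
  have nz: "A \<noteq> 0 \<or> (1 :: 'a poly) \<noteq> 0" by simp
  define h where "h = reg A 1"
  have h: "rfun h" unfolding h_def using rfun_reg[OF nz] .
  have hval: "h (Affine x y) = 0 \<longleftrightarrow> y = y1 + l * (x - x1)" for x y
    by (simp add: h_def A algebra_simps)
  have hir: "isreg h" and hev: "ev (\<lambda>p. h p \<noteq> 0)"
    using h by (auto simp: h_def rfun_def isreg_intros)
  have nrmA: "ev (\<lambda>p. - 1 * ((xc p - x1) * ((xc p - x2) * (xc p - x3))) = h p * h (neg p))"
  proof (rule ev_affineI)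
    fix x y assume "on_curve E x y"
    then have "h (Affine x y) * h (neg (Affine x y)) = poly (nrm A 1) x"
      using reg_conj[of x y A 1] by (simp add: h_def)
    also have "\<dots> = (y1 + l * (x - x1)) ^ 2 - poly f x" by (simp add: nrm_def A power2_eq_square algebra_simps)
    finally show "- 1 * ((xc (Affine x y) - x1) * ((xc (Affine x y) - x2) * (xc (Affine x y) - x3))) =
      h (Affine x y) * h (neg (Affine x y))" using id[of x] by (simp add: mult_ac)
  qed
  have rf: "rfun (\<lambda>p. - 1 * ((xc p - x1) * ((xc p - x2) * (xc p - x3))))"
    by (intro rfun_mult rfun_const rfun_xc_diff) simp
  have "ord R h = of_bool (R = Affine x1 y1) + of_bool (R = Affine x2 y2)
      + of_bool (R = Affine x3 y3) - 3 * of_bool (R = Infinity)" if R: "R \<in> points E" for R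
  proof (cases R)
    case Infinity
    have "degree (nrm A 1) = 3"
      using degree_nrm(2)[OF nz] by (simp add: A_def split: if_splits)
    then show ?thesis unfolding Infinity h_def using ord_Infinity_reg[OF nz] by simp
  next
    case (Affine a b)
    then have ab: "on_curve E a b" using R by simp
    have sumord: "ord R h + ord (neg R) h =
        ord R (\<lambda>p. xc p - x1) + (ord R (\<lambda>p. xc p - x2) + ord R (\<lambda>p. xc p - x3))"
    proof -
      have "ord R (\<lambda>p. - 1 * ((xc p - x1) * ((xc p - x2) * (xc p - x3)))) =
          0 + (ord R (\<lambda>p. xc p - x1) + (ord R (\<lambda>p. xc p - x2) + ord R (\<lambda>p. xc p - x3)))"
        by (subst ord_mult[OF R]; (subst ord_mult[OF R])?; (subst ord_mult[OF R])?)
          (auto intro!: rfun_mult rfun_const rfun_xc_diff simp: ord_const[OF R])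
      then show ?thesis
        using ord_cong[OF R rf nrmA] ord_mult[OF R h rfun_neg[OF h]] ord_neg[OF R h] by linarith
    qed
    show ?thesis
    proof (cases "h R = 0")
      case False
      then have "ord R h = 0" using ord_isreg_eq_0[OF ab hir] Affine by simp
      moreover have "R \<noteq> Affine x1 y1" "R \<noteq> Affine x2 y2" "R \<noteq> Affine x3 y3"
        using False hval y2 y3_def by auto
      ultimately show ?thesis using Affine by simp
    next
      case True
      then have b: "b = y1 + l * (a - x1)" using hval Affine by simp
      have mem: "R = Affine x1 y1 \<longleftrightarrow> a = x1" "R = Affine x2 y2 \<longleftrightarrow> a = x2" "R = Affine x3 y3 \<longleftrightarrow> a = x3"
        using b y2 y3_def Affine by auto
      have o: "ord R (\<lambda>p. xc p - x1) = (if b = 0 then 2 else 1) * of_bool (R = Affine x1 y1)"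
        "ord R (\<lambda>p. xc p - x2) = (if b = 0 then 2 else 1) * of_bool (R = Affine x2 y2)"
        "ord R (\<lambda>p. xc p - x3) = (if b = 0 then 2 else 1) * of_bool (R = Affine x3 y3)"
        unfolding mem using ord_xc_diff_Affine[OF ab] by (auto simp: Affine)
      have R': "R \<noteq> Infinity" using Affine by simp
      show ?thesis
      proof (cases "b = 0")
        case True
        then have "neg R = R" using Affine by simp
        then show ?thesis using sumord unfolding o using True R' by simp
      next
        case False
        have "h (Affine a (- b)) \<noteq> 0"
          using hval[of a "- b"] b False eq_minus_self_iff[of b] by auto
        moreover have "on_curve E a (- b)" using ab by (simp add: on_curve_iff)
        ultimately have "ord (neg R) h = 0" using ord_isreg_eq_0[OF _ hir] Affine by simp
        then show ?thesis using sumord unfolding o using False R' by simp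
      qed
    qed
  qed
  moreover have "neg (Affine x1 y1 \<uplus> Affine x2 y2) = Affine x3 y3" unfolding sum y3_def by simp
  ultimately show "\<exists>h. rfun h \<and> (\<forall>R\<in>points E. ord R h = of_bool (R = Affine x1 y1) + of_bool (R = Affine x2 y2)
      + of_bool (R = neg (Affine x1 y1 \<uplus> Affine x2 y2)) - 3 * of_bool (R = Infinity))"
    using h by auto
qed

text \<open>The vertical line through P; for P at infinity all three terms cancel and the constant 1
  serves.\<close>

lemma vertical_function:
  assumes "P \<in> points E"
  shows "\<exists>h. rfun h \<and> (\<forall>R\<in>points E. ord R h = of_bool (R = P) + of_bool (R = neg P) - 2 * of_bool (R = Infinity))"
proof (cases P)
  case Infinity
  then show ?thesis by (intro exI[of _ "\<lambda>p. 1"]) (auto simp: rfun_const ord_one)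
next
  case (Affine a b)
  have ab: "on_curve E a b" using assms Affine by simp
  have "ord R (\<lambda>p. xc p - a) = of_bool (R = P) + of_bool (R = neg P) - 2 * of_bool (R = Infinity)"
    if R: "R \<in> points E" for R
    using R
  proof (cases rule: points_cases)
    case 1
    then show ?thesis using Affine by (simp add: ord_xc_diff_Infinity)
  next
    case (2 x y)
    then have "x = a \<Longrightarrow> y = b \<or> y = - b" using ab power2_eq_iff[of y b] by (simp add: on_curve_iff)
    then show ?thesis using 2 Affine eq_minus_self_iff[of b] eq_minus_self_iff[of "- b"]
      by (auto simp: ord_xc_diff_Affine)
  qed
  then show ?thesis using rfun_xc_diff[of a] by (intro exI[of _ "\<lambda>p. xc p - a"]) auto
qed

text \<open>The line through P and Q divided by the vertical line through P + Q, whose zeros at -(P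
  + Q) cancel. Thus (P) + (Q) is equivalent to (P + Q) + (O), and the group law becomes a statement
  on divisor classes.\<close>

lemma add_function:
  assumes "P \<in> points E" "Q \<in> points E"
  shows "P \<uplus> Q \<in> points E"
    "\<exists>h. rfun h \<and> (\<forall>R\<in>points E. ord R h =
      of_bool (R = P) + of_bool (R = Q) - of_bool (R = P \<uplus> Q) - of_bool (R = Infinity))"
proof -
  have "P \<uplus> Q \<in> points E \<and> (\<exists>h. rfun h \<and> (\<forall>R\<in>points E. ord R h =
      of_bool (R = P) + of_bool (R = Q) - of_bool (R = P \<uplus> Q) - of_bool (R = Infinity)))"
  proof (cases "P = Infinity \<or> Q = Infinity")
    case True
    then show ?thesis using assms by (auto intro!: exI[of _ "\<lambda>p. 1"] simp: rfun_const ord_one)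
  next
    case False
    then obtain x1 y1 x2 y2 where P: "P = Affine x1 y1" and Q: "Q = Affine x2 y2"
      by (metis point.exhaust)
    have oc: "on_curve E x1 y1" "on_curve E x2 y2" using assms P Q by auto
    show ?thesis
    proof (cases "x1 = x2 \<and> y1 + y2 = 0")
      case True
      then have "Q = neg P" "P \<uplus> Q = Infinity" using P Q by (auto simp: a1 a3 add_eq_0_iff)
      then show ?thesis using vertical_function[OF assms(1)] by simp
    next
      case F: False
      note lf = line_function[OF oc F, folded P Q]
      obtain h where h: "rfun h" "\<And>R. R \<in> points E \<Longrightarrow> ord R h = of_bool (R = P) + of_bool (R = Q)
          + of_bool (R = neg (P \<uplus> Q)) - 3 * of_bool (R = Infinity)" using lf(2) by blast
      obtain v where v: "rfun v" "\<And>R. R \<in> points E \<Longrightarrow> ord R v = of_bool (R = P \<uplus> Q)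
          + of_bool (R = neg (P \<uplus> Q)) - 2 * of_bool (R = Infinity)"
        using vertical_function lf(1) by blast
      have "ord R (\<lambda>p. h p / v p) =
          of_bool (R = P) + of_bool (R = Q) - of_bool (R = P \<uplus> Q) - of_bool (R = Infinity)"
        if "R \<in> points E" for R
        using ord_divide[OF that h(1) v(1)] h(2)[OF that] v(2)[OF that] by simp
      then show ?thesis using rfun_divide[OF h(1) v(1)] lf(1) by blast
    qed
  qed
  then show "P \<uplus> Q \<in> points E" "\<exists>h. rfun h \<and> (\<forall>R\<in>points E. ord R h =
      of_bool (R = P) + of_bool (R = Q) - of_bool (R = P \<uplus> Q) - of_bool (R = Infinity))" by blast+
qed

lemma add_closed [simp, intro]: "P \<in> points E \<Longrightarrow> Q \<in> points E \<Longrightarrow> P \<uplus> Q \<in> points E"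
  by (rule add_function)

text \<open>No polynomial function has a simple pole at infinity; this is what separates divisor classes of points.\<close>

lemma principal_difference_eq:
  assumes A: "A \<in> points E" and B: "B \<in> points E" and h: "rfun h"
    "\<And>R. R \<in> points E \<Longrightarrow> ord R h = of_bool (R = A) - of_bool (R = B)"
  shows "A = B"
proof -
  obtain v where v: "rfun v" "\<And>R. R \<in> points E \<Longrightarrow> ord R v = of_bool (R = B)
          + of_bool (R = neg B) - 2 * of_bool (R = Infinity)"
    using vertical_function[OF B] by blast
  \<comment> \<open>The vertical line through B removes the pole at B and leaves the divisor (A) +
    (-B) - 2 (O).\<close>
  define k where "k = (\<lambda>p. h p * v p)"
  have k: "rfun k" unfolding k_def by (intro rfun_mult h v)
  have ordk: "ord R k = of_bool (R = A) + of_bool (R = neg B) - 2 * of_bool (R = Infinity)"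
    if "R \<in> points E" for R
    unfolding k_def using ord_mult[OF that h(1) v(1)] h(2)[OF that] v(2)[OF that] by simp
  obtain C D where CD: "C \<noteq> 0 \<or> D \<noteq> 0" "ev (\<lambda>p. k p = reg C D p)"
    using regular_if_ord_nonneg[OF k] ordk by auto
  have "ord Infinity (reg C D) = of_bool (Infinity = A) + of_bool (Infinity = neg B) - 2"
    using ordk[OF Infinity_in_points] ord_cong[OF Infinity_in_points k CD(2)] by simp
  then have dn: "int (degree (nrm C D)) = 2 - of_bool (Infinity = A) - of_bool (Infinity = neg B)"
    using ord_Infinity_reg[OF CD(1)] by simp
  then have "degree (nrm C D) \<le> 2" by (simp add: of_bool_def split: if_splits)
  \<comment> \<open>A nonzero D would give degree at least 3. The remaining degree 2 deg C is even,
    so \<open>A\<close> and \<open>neg B\<close> are both at infinity or both affine.\<close>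
  then have D: "D = 0" and C: "C \<noteq> 0" using degree_nrm(2)[OF CD(1)] CD(1) by (auto split: if_splits)
  then have dC: "int (2 * degree C) = 2 - of_bool (Infinity = A) - of_bool (Infinity = neg B)"
    using dn degree_nrm(2)[OF CD(1)] by simp
  show ?thesis
  proof (cases "A = Infinity")
    case True
    then have "neg B = Infinity" using dC by (cases "neg B = Infinity") (simp_all, presburger)
    then show ?thesis using True by simp
  next
    case False
    then have "neg B \<noteq> Infinity" using dC by (auto, presburger)
    then have "Infinity \<noteq> neg B" "Infinity \<noteq> A" using False by metis+
    then have dC: "degree C = 1" using dC by simp
    obtain xA yA xB yB where AB: "A = Affine xA yA" "B = Affine xB yB"
      using False \<open>neg B \<noteq> Infinity\<close> by (metis neg.simps(1) point.exhaust)
    then have oc: "on_curve E xA yA" "on_curve E xB yB" using A B by auto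
    obtain a where "poly C a = 0" using alg_closed_imp_poly_has_root[of C] dC by auto
    then obtain C' where C': "C = [:-a, 1:] * C'" by (auto simp: poly_eq_0_iff_dvd elim: dvdE)
    with C have "C' \<noteq> 0" by auto
    then have "degree C = Suc (degree C')" unfolding C' by (subst degree_mult_eq) auto
    then obtain c where c: "C' = [:c:]" "c \<noteq> 0" using dC \<open>C' \<noteq> 0\<close> by (metis degree_eq_zeroE nat.inject One_nat_def pCons_0_0)
    have ek: "ev (\<lambda>p. k p = c * (xc p - a))"
      using CD(2) ev_affine by eventually_elim (auto simp: D C' c algebra_simps)
    have ord: "ord R (\<lambda>p. xc p - a) = of_bool (R = A) + of_bool (R = neg B) - 2 * of_bool (R = Infinity)"
      if "R \<in> points E" for R
      using ordk[OF that] ord_cong[OF that k ek] ord_mult[OF that rfun_const[OF c(2)] rfun_xc_diff[of a]]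
        ord_const[OF that c(2)] by simp
    have pos: "(1 :: int) + of_bool b > 0" "of_bool b + (1 :: int) > 0" for b by (cases b; simp)+
    have "ord A (\<lambda>p. xc p - a) > 0" using ord[OF A] pos AB by simp
    then have "xA = a" using ord_xc_diff_Affine[OF oc(1), of a] AB by (auto split: if_splits)
    have "on_curve E xB (- yB)" using oc by (simp add: on_curve_iff)
    moreover have "ord (neg B) (\<lambda>p. xc p - a) > 0" 
      using ord[OF iffD2[OF neg_in_points B]] pos AB by simp
    ultimately have "xB = a" using ord_xc_diff_Affine[of xB "- yB" a] AB by (auto split: if_splits)
    with \<open>xA = a\<close> have x: "xA = xB" by simp
    then have "yA = yB \<or> yA = - yB" using oc power2_eq_iff[of yA yB] by (simp add: on_curve_iff)
    \<comment> \<open>If A = -B had a nonzero ordinate, the divisor would ask for a double zero at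
      A, where x - a has a simple one.\<close>
    moreover have "yA = yB" if "yA = - yB"
    proof (rule ccontr)
      assume "yA \<noteq> yB"
      then have "yA \<noteq> 0" using that by auto
      then show False using ord[OF A] ord_xc_diff_Affine[OF oc(1), of a] AB \<open>xA = a\<close> x that by simp
    qed
    ultimately show ?thesis using AB x by auto
  qed
qed

lemma add_comm:
  assumes "P \<in> points E" "Q \<in> points E" shows "P \<uplus> Q = Q \<uplus> P"
proof -
  obtain h where h: "rfun h" "\<And>R. R \<in> points E \<Longrightarrow> ord R h =
      of_bool (R = P) + of_bool (R = Q) - of_bool (R = P \<uplus> Q) - of_bool (R = Infinity)"
    using add_function(2)[OF assms] by blast
  obtain k where k: "rfun k" "\<And>R. R \<in> points E \<Longrightarrow> ord R k =
      of_bool (R = Q) + of_bool (R = P) - of_bool (R = Q \<uplus> P) - of_bool (R = Infinity)"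
    using add_function(2)[OF assms(2,1)] by blast
  show ?thesis
    by (rule principal_difference_eq[OF _ _ rfun_divide[OF k(1) h(1)]])
      (use assms in \<open>auto simp: ord_divide h k simp del: add_pt.simps\<close>)
qed

text \<open>In the quotient of the four functions from \<open>add_function\<close> the intermediate
  terms cancel, leaving the difference of the two triple sums as a principal divisor.\<close>

lemma add_assoc:
  assumes "P \<in> points E" "Q \<in> points E" "R \<in> points E" shows "P \<uplus> Q \<uplus> R = P \<uplus> (Q \<uplus> R)"
proof -
  obtain h1 where h1: "rfun h1" "\<And>S. S \<in> points E \<Longrightarrow> ord S h1 =
      of_bool (S = P) + of_bool (S = Q) - of_bool (S = P \<uplus> Q) - of_bool (S = Infinity)"
    using add_function(2)[OF assms(1,2)] by blast
  obtain h2 where h2: "rfun h2" "\<And>S. S \<in> points E \<Longrightarrow> ord S h2 =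
      of_bool (S = P \<uplus> Q) + of_bool (S = R) - of_bool (S = P \<uplus> Q \<uplus> R) - of_bool (S = Infinity)"
    using add_function(2)[OF add_closed[OF assms(1,2)] assms(3)] by blast
  obtain k1 where k1: "rfun k1" "\<And>S. S \<in> points E \<Longrightarrow> ord S k1 =
      of_bool (S = Q) + of_bool (S = R) - of_bool (S = Q \<uplus> R) - of_bool (S = Infinity)"
    using add_function(2)[OF assms(2,3)] by blast
  obtain k2 where k2: "rfun k2" "\<And>S. S \<in> points E \<Longrightarrow> ord S k2 =
      of_bool (S = P) + of_bool (S = Q \<uplus> R) - of_bool (S = P \<uplus> (Q \<uplus> R)) - of_bool (S = Infinity)"
    using add_function(2)[OF assms(1) add_closed[OF assms(2,3)]] by blast
  show ?thesis
  proof (rule principal_difference_eq)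
    show "rfun (\<lambda>p. (k1 p * k2 p) / (h1 p * h2 p))"
      by (intro rfun_divide rfun_mult h1 h2 k1 k2)
    fix S assume S: "S \<in> points E"
    show "ord S (\<lambda>p. (k1 p * k2 p) / (h1 p * h2 p)) =
        of_bool (S = P \<uplus> Q \<uplus> R) - of_bool (S = P \<uplus> (Q \<uplus> R))"
      by (simp add: ord_divide[OF S] ord_mult[OF S] rfun_mult h1(1) h2(1) k1(1) k2(1)
          h1(2)[OF S] h2(2)[OF S] k1(2)[OF S] k2(2)[OF S] del: add_pt.simps)
  qed (use assms in auto)
qed

lemma add_neg [simp]: "P \<uplus> neg P = Infinity"
  by (cases P) (auto simp: a1 a3)

lemma neg_add [simp]: "neg P \<uplus> P = Infinity"
  using add_neg[of "neg P"] by simp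

lemma add_cancel_right [simp]:
  assumes "P \<in> points E" "Q \<in> points E" "R \<in> points E" shows "P \<uplus> R = Q \<uplus> R \<longleftrightarrow> P = Q"
proof
  assume "P \<uplus> R = Q \<uplus> R"
  then have "P \<uplus> R \<uplus> neg R = Q \<uplus> R \<uplus> neg R" by simp
  then show "P = Q" using assms by (simp add: add_assoc)
qed simp

lemma add_neg_cancel [simp]:
  "P \<in> points E \<Longrightarrow> R \<in> points E \<Longrightarrow> P \<uplus> R \<uplus> neg R = P"
  "P \<in> points E \<Longrightarrow> R \<in> points E \<Longrightarrow> P \<uplus> neg R \<uplus> R = P"
  by (simp_all add: add_assoc)

lemma neg_unique: "P \<in> points E \<Longrightarrow> Q \<in> points E \<Longrightarrow> P \<uplus> Q = Infinity \<Longrightarrow> P = neg Q"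
  using add_neg_cancel(1)[of P Q] by simp

lemma add_left_comm:
  assumes "P \<in> points E" "Q \<in> points E" "R \<in> points E" shows "P \<uplus> (Q \<uplus> R) = Q \<uplus> (P \<uplus> R)"
  using assms by (metis add_assoc add_comm)

lemmas add_ac = add_assoc add_comm add_left_comm

lemma neg_add_distrib:
  assumes "P \<in> points E" "Q \<in> points E" shows "neg (P \<uplus> Q) = neg P \<uplus> neg Q"
proof -
  have "neg P \<uplus> neg Q \<uplus> (P \<uplus> Q) = neg P \<uplus> P \<uplus> (neg Q \<uplus> Q)"
    using assms by (metis add_assoc add_left_comm add_closed neg_in_points)
  then show ?thesis using neg_unique[of "neg P \<uplus> neg Q" "P \<uplus> Q"] assms by simp
qed


subsection \<open>Translations\<close>

lemma ev_trans: "S \<in> points E \<Longrightarrow> ev Q \<Longrightarrow> ev (\<lambda>p. Q (p \<uplus> S))"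
  by (rule ev_inj) (auto simp: inj_on_def)

lemma rat_poly [rat_intros]: "rat h \<Longrightarrow> rat (\<lambda>p. poly A (h p))"
  by (induction A) (auto intro: rat_intros)

text \<open>The chord formula, valid off the points with the abscissa of S and hence
  generically.\<close>

lemma rat_trans_coords:
  assumes "S \<in> points E"
  shows "rat (\<lambda>p. xc (p \<uplus> S)) \<and> rat (\<lambda>p. yc (p \<uplus> S))"
proof (cases S)
  case Infinity
  then show ?thesis using rat_intros by simp
next
  case (Affine a b)
  define l where "l = (\<lambda>p. (b - yc p) / (a - xc p))"
  define x' where "x' = (\<lambda>p. l p ^ 2 - wa2 E - xc p - a)"
  have l: "rat l" unfolding l_def by (intro rat_intros)
  have x': "rat x'" unfolding x'_def by (intro rat_intros l)
  have y': "rat (\<lambda>p. - l p * x' p - (yc p - l p * xc p))" by (intro rat_intros l x')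
  have e: "ev (\<lambda>p. p \<uplus> S = Affine (x' p) (- l p * x' p - (yc p - l p * xc p)))"
    using ev_affine ev_xc_neq[of a] by eventually_elim (auto simp: Affine a1 a3 Let_def l_def x'_def)
  have "ev (\<lambda>p. x' p = xc (p \<uplus> S))" "ev (\<lambda>p. - l p * x' p - (yc p - l p * xc p) = yc (p \<uplus> S))"
    using e by (eventually_elim, simp)+
  then show ?thesis by (intro conjI rat_cong[OF x'] rat_cong[OF y'])
qed

lemma rat_trans:
  assumes "S \<in> points E" "rat h" shows "rat (\<lambda>p. h (p \<uplus> S))"
proof -
  have *: "rat (\<lambda>p. u (p \<uplus> S))" if u: "isreg u" for u
  proof -
    obtain A B where AB: "ev (\<lambda>p. u p = reg A B p)" using u by (rule isreg_obtain)
    have "ev (\<lambda>p. u p = poly A (xc p) + poly B (xc p) * yc p)"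
      using AB ev_affine by eventually_elim auto
    from ev_trans[OF assms(1) this]
    have "ev (\<lambda>p. poly A (xc (p \<uplus> S)) + poly B (xc (p \<uplus> S)) * yc (p \<uplus> S) = u (p \<uplus> S))"
      by eventually_elim simp
    then show ?thesis
      by (rule rat_cong[rotated]) (intro rat_intros rat_trans_coords[OF assms(1), THEN conjunct1]
        rat_trans_coords[OF assms(1), THEN conjunct2])
  qed
  obtain u v where uv: "isreg u" "isreg v" "ev (\<lambda>p. h p = u p / v p)"
    using assms(2) unfolding rat_def by blast
  from ev_trans[OF assms(1) uv(3)] have "ev (\<lambda>p. u (p \<uplus> S) / v (p \<uplus> S) = h (p \<uplus> S))"
    by eventually_elim simp
  then show ?thesis by (rule rat_cong[rotated]) (intro rat_intros * uv)
qed

lemma rfun_trans: "S \<in> points E \<Longrightarrow> rfun h \<Longrightarrow> rfun (\<lambda>p. h (p \<uplus> S))"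
  unfolding rfun_def using rat_trans ev_trans[of S "\<lambda>p. h p \<noteq> 0"] by blast

section \<open>Valuations of the function field and invariance of orders under translation\<close>

text \<open>Trivial on constants and not normalised, so that \<open>ord P\<close> composed with a
  translation qualifies before its scale is known.\<close>

definition valuation :: "(('a point \<Rightarrow> 'a) \<Rightarrow> int) \<Rightarrow> bool" where
  "valuation w \<longleftrightarrow>
    (\<forall>h k. rfun h \<longrightarrow> rfun k \<longrightarrow> w (\<lambda>p. h p * k p) = w h + w k) \<and>
    (\<forall>h k. rfun h \<longrightarrow> rfun k \<longrightarrow> ev (\<lambda>p. h p + k p \<noteq> 0) \<longrightarrow> min (w h) (w k) \<le> w (\<lambda>p. h p + k p)) \<and>
    (\<forall>h k. rfun h \<longrightarrow> ev (\<lambda>p. h p = k p) \<longrightarrow> w k = w h) \<and>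
    (\<forall>c. c \<noteq> 0 \<longrightarrow> w (\<lambda>p. c) = 0)"

lemma valuation_ord: "P \<in> points E \<Longrightarrow> valuation (ord P)"
  unfolding valuation_def by (intro conjI allI impI) (rule ord_mult ord_add_ge ord_cong ord_const; assumption)+

lemma valuationD:
  assumes "valuation w"
  shows "rfun h \<Longrightarrow> rfun k \<Longrightarrow> w (\<lambda>p. h p * k p) = w h + w k"
    "rfun h \<Longrightarrow> rfun k \<Longrightarrow> ev (\<lambda>p. h p + k p \<noteq> 0) \<Longrightarrow> min (w h) (w k) \<le> w (\<lambda>p. h p + k p)"
    "rfun h \<Longrightarrow> ev (\<lambda>p. h p = k p) \<Longrightarrow> w k = w h"
    "c \<noteq> 0 \<Longrightarrow> w (\<lambda>p. c) = 0"
  using assms unfolding valuation_def by blast+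

lemma valuation_trans:
  assumes w: "valuation w" and S: "S \<in> points E"
  shows "valuation (\<lambda>h. w (\<lambda>p. h (p \<uplus> S)))"
  unfolding valuation_def
proof (intro conjI allI impI)
  fix h k assume "rfun h" "rfun k"
  then show "w (\<lambda>p. h (p \<uplus> S) * k (p \<uplus> S)) = w (\<lambda>p. h (p \<uplus> S)) + w (\<lambda>p. k (p \<uplus> S))"
    by (intro valuationD(1)[OF w] rfun_trans[OF S])
next
  fix h k assume *: "rfun h" "rfun k" "ev (\<lambda>p. h p + k p \<noteq> 0)"
  show "min (w (\<lambda>p. h (p \<uplus> S))) (w (\<lambda>p. k (p \<uplus> S))) \<le> w (\<lambda>p. h (p \<uplus> S) + k (p \<uplus> S))"
    by (rule valuationD(2)[OF w rfun_trans[OF S *(1)] rfun_trans[OF S *(2)] ev_trans[OF S *(3)]])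
next
  fix h k assume *: "rfun h" "ev (\<lambda>p. h p = k p)"
  show "w (\<lambda>p. k (p \<uplus> S)) = w (\<lambda>p. h (p \<uplus> S))"
    by (rule valuationD(3)[OF w rfun_trans[OF S *(1)] ev_trans[OF S *(2)]])
next
  fix c :: 'a assume "c \<noteq> 0"
  then show "w (\<lambda>p. c) = 0" by (rule valuationD(4)[OF w])
qed

text \<open>The zero function satisfies every lower bound, its order being infinite.\<close>

definition vge :: "(('a point \<Rightarrow> 'a) \<Rightarrow> int) \<Rightarrow> int \<Rightarrow> ('a point \<Rightarrow> 'a) \<Rightarrow> bool" where
  "vge w n h \<longleftrightarrow> rat h \<and> (rfun h \<longrightarrow> n \<le> w h)"

context
  fixes w assumes w: "valuation w"
begin

lemmas val_mult = valuationD(1)[OF w] and val_cong = valuationD(3)[OF w] and val_const = valuationD(4)[OF w]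

lemma vge_cong: assumes "vge w n h" "ev (\<lambda>p. h p = k p)" shows "vge w n k"
proof -
  have "rfun h" if "rfun k"
    by (rule rfun_cong[OF that]) (use assms(2) in eventually_elim, simp)
  then show ?thesis
    using assms rat_cong[OF _ assms(2)] val_cong[OF _ assms(2)] unfolding vge_def by metis
qed

lemma vge_add: assumes "vge w n h" "vge w n k" shows "vge w n (\<lambda>p. h p + k p)"
proof -
  have r: "rat h" "rat k" using assms by (auto simp: vge_def)
  consider "ev (\<lambda>p. h p = 0)" | "ev (\<lambda>p. k p = 0)" | "rfun h" "rfun k"
    using rat_cases[OF r(1)] rat_cases[OF r(2)] by blast
  then show ?thesis
  proof cases
    assume "ev (\<lambda>p. h p = 0)"
    then have "ev (\<lambda>p. k p = h p + k p)" by eventually_elim simp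
    then show ?thesis by (rule vge_cong[OF assms(2)])
  next
    assume "ev (\<lambda>p. k p = 0)"
    then have "ev (\<lambda>p. h p = h p + k p)" by eventually_elim simp
    then show ?thesis by (rule vge_cong[OF assms(1)])
  next
    assume *: "rfun h" "rfun k"
    have "n \<le> w (\<lambda>p. h p + k p)" if "rfun (\<lambda>p. h p + k p)"
    proof -
      have "min (w h) (w k) \<le> w (\<lambda>p. h p + k p)"
        using valuationD(2)[OF w *] that unfolding rfun_def by blast
      then show ?thesis using assms * unfolding vge_def by linarith
    qed
    then show ?thesis using r by (auto simp: vge_def intro: rat_intros)
  qed
qed

lemma vge_mult: assumes "vge w n h" "vge w m k" shows "vge w (n + m) (\<lambda>p. h p * k p)"
proof -
  have r: "rat h" "rat k" using assms by (auto simp: vge_def)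
  have "n + m \<le> w (\<lambda>p. h p * k p)" if *: "rfun (\<lambda>p. h p * k p)"
  proof -
    have "ev (\<lambda>p. h p * k p \<noteq> 0)" using * by (simp add: rfun_def)
    then have "ev (\<lambda>p. h p \<noteq> 0)" "ev (\<lambda>p. k p \<noteq> 0)" by (eventually_elim, simp)+
    then have "rfun h" "rfun k" using r by (auto simp: rfun_def)
    then show ?thesis using val_mult assms unfolding vge_def by fastforce
  qed
  then show ?thesis using r by (auto simp: vge_def intro: rat_intros)
qed

lemma vge_const: "vge w 0 (\<lambda>p. c)"
  by (cases "c = 0") (auto simp: vge_def val_const rfun_def intro: rat_intros)

lemma vge_mono: "vge w n h \<Longrightarrow> m \<le> n \<Longrightarrow> vge w m h"
  by (auto simp: vge_def)

text \<open>A valuation centred at (a, b) is 0 on regular functions that are nonzero there. Writing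
  s h = t \<pi>^n with such s and t gives w h = n w(\<pi>), so the factor is the value at the local
  parameter.\<close>

lemma valuation_affine:
  assumes ab: "on_curve E a b" and x: "w (\<lambda>p. xc p - a) > 0" and y: "vge w 1 (\<lambda>p. yc p - b)"
  shows "\<exists>e>0. \<forall>h. rfun h \<longrightarrow> w h = e * ord (Affine a b) h"
proof -
  have x1: "vge w 1 (\<lambda>p. xc p - a)" using x by (auto simp: vge_def intro: rat_intros)
  have x0: "vge w 0 xc"
    using vge_add[OF vge_mono[OF x1, of 0] vge_const[of a]] by simp
  have y0: "vge w 0 yc"
    using vge_add[OF vge_mono[OF y, of 0] vge_const[of b]] by simp
  have poly0: "vge w 0 (\<lambda>p. poly A (xc p))" for A
  proof (induction A)
    case 0
    then show ?case using vge_const[of 0] by simp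
  next
    case (pCons c A)
    then show ?case using vge_add[OF vge_const[of c] vge_mult[OF x0 pCons(2), simplified]] by simp
  qed
  have poly1: "vge w 1 (\<lambda>p. poly A (xc p) - poly A a)" for A
  proof -
    have "poly (A - [:poly A a:]) a = 0" by simp
    then obtain q where q: "A - [:poly A a:] = [:-a, 1:] * q"
      using poly_eq_0_iff_dvd[of "A - [:poly A a:]" a] by (auto elim: dvdE)
    have "poly A x - poly A a = (x - a) * poly q x" for x
    proof -
      have "poly A x - poly A a = poly (A - [:poly A a:]) x" by simp
      also have "\<dots> = (x - a) * poly q x" unfolding q by (simp add: algebra_simps)
      finally show ?thesis .
    qed
    then show ?thesis using vge_mult[OF x1 poly0[of q]] by simp
  qed
  have zero: "vge w 1 (\<lambda>p. h p - h (Affine a b))" if h: "isreg h" for h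
  proof -
    obtain A B where AB: "\<And>x y. on_curve E x y \<Longrightarrow> h (Affine x y) = reg A B (Affine x y)"
      "ev (\<lambda>p. h p = reg A B p)" using isreg_obtain[OF h] by blast
    have "vge w 1 (\<lambda>p. (poly A (xc p) - poly A a) +
        ((poly B (xc p) - poly B a) * yc p + poly B a * (yc p - b)))"
      using vge_add[OF poly1[of A] vge_add[OF vge_mult[OF poly1[of B] y0, simplified]
        vge_mult[OF vge_const[of "poly B a"] y, simplified]]] .
    moreover have "ev (\<lambda>p. (poly A (xc p) - poly A a) +
        ((poly B (xc p) - poly B a) * yc p + poly B a * (yc p - b)) = h p - h (Affine a b))"
      using AB(2) ev_affine by eventually_elim (auto simp: AB(1)[OF ab] algebra_simps)
    ultimately show ?thesis by (rule vge_cong)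
  qed
  have unit: "rfun s \<and> w s = 0" if s: "isreg s" "s (Affine a b) \<noteq> 0" for s
  proof -
    have rs: "rfun s" using rfun_isreg[OF s(1) isreg_ev_neq_0[OF s(1) ab s(2)]] .
    have "vge w 0 s"
      using vge_add[OF vge_mono[OF zero[OF s(1)], of 0] vge_const[of "s (Affine a b)"]] by simp
    then have ge: "w s \<ge> 0" using rs by (simp add: vge_def)
    \<comment> \<open>Otherwise the nonzero constant s(a, b) = s - (s - s(a, b)) would have positive
      value.\<close>
    have "\<not> w s > 0"
    proof
      assume "w s > 0"
      then have "vge w 1 s" using rs by (auto simp: vge_def rfun_def)
      moreover have "vge w 1 (\<lambda>p. - 1 * (s p - s (Affine a b)))"
        using vge_mult[OF vge_const[of "-1"] zero[OF s(1)]] by simp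
      ultimately have "vge w 1 (\<lambda>p. s p + - 1 * (s p - s (Affine a b)))" by (rule vge_add)
      then have "vge w 1 (\<lambda>p. s (Affine a b))" by simp
      then show False using val_const[OF s(2)] rfun_const[OF s(2)] by (simp add: vge_def)
    qed
    then show ?thesis using ge rs by simp
  qed
  define \<pi> where "\<pi> = unif (Affine a b)"
  have \<pi>: "rfun \<pi>" unfolding \<pi>_def by (intro rfun_isreg isreg_unif ev_unif_neq_0)
  have "w \<pi> > 0"
  proof (cases "b = 0")
    case True
    then have "\<pi> = (\<lambda>p. yc p - b)" by (auto simp: \<pi>_def)
    then show ?thesis using y \<pi> by (simp add: vge_def)
  next
    case False
    then have "\<pi> = (\<lambda>p. xc p - a)" by (auto simp: \<pi>_def)
    then show ?thesis using x by simp
  qed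
  moreover have "w h = w \<pi> * ord (Affine a b) h" if h: "rfun h" for h
  proof -
    obtain s t where st: "isreg s" "isreg t" "s (Affine a b) \<noteq> 0" "t (Affine a b) \<noteq> 0"
      "ev (\<lambda>p. s p * h p = t p * \<pi> p powi ord (Affine a b) h)"
      using has_ord_ord[of "Affine a b" h] ab h unfolding \<pi>_def has_ord.simps by auto
    have pow: "rfun (\<lambda>p. \<pi> p ^ n) \<and> w (\<lambda>p. \<pi> p ^ n) = int n * w \<pi>" for n
    proof (induction n)
      case 0
      then show ?case using val_const[of 1] rfun_const[of 1] by simp
    next
      case (Suc n)
      then show ?case using val_mult[OF \<pi>, of "\<lambda>p. \<pi> p ^ n"] rfun_mult[OF \<pi>, of "\<lambda>p. \<pi> p ^ n"]
        by (simp add: algebra_simps)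
    qed
    have ws: "w (\<lambda>p. s p * h p) = w h" "rfun (\<lambda>p. s p * h p)"
      using val_mult[of s h] rfun_mult[of s h] unit[of s] st h by auto
    show ?thesis
    proof (cases "ord (Affine a b) h \<ge> 0")
      case True
      then obtain n where n: "ord (Affine a b) h = int n" using nonneg_int_cases by blast
      have "w (\<lambda>p. t p * \<pi> p ^ n) = int n * w \<pi>"
        using val_mult[of t "\<lambda>p. \<pi> p ^ n"] unit[of t] st pow[of n] by simp
      moreover have "w (\<lambda>p. t p * \<pi> p ^ n) = w (\<lambda>p. s p * h p)"
        using val_cong[OF ws(2), of "\<lambda>p. t p * \<pi> p ^ n"] st(5) unfolding n by simp
      ultimately show ?thesis using ws(1) n by simp
    next
      case False
      then obtain n where n: "ord (Affine a b) h = - int n"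
        by (metis int_cases2 of_nat_0_le_iff)
      \<comment> \<open>For a negative order the relation is multiplied by \<pi>^n, so that only
        natural powers occur.\<close>
      have "w (\<lambda>p. (s p * h p) * \<pi> p ^ n) = w h + int n * w \<pi>"
        using val_mult[OF ws(2), of "\<lambda>p. \<pi> p ^ n"] pow[of n] ws(1) by simp
      moreover have "ev (\<lambda>p. (s p * h p) * \<pi> p ^ n = t p)"
        using st(5) \<pi>[unfolded rfun_def, THEN conjunct2]
        by eventually_elim (simp add: n power_int_minus field_simps)
      then have "w t = w (\<lambda>p. (s p * h p) * \<pi> p ^ n)"
        using val_cong[OF rfun_mult[OF ws(2)], of "\<lambda>p. \<pi> p ^ n" t] pow[of n] by simp
      ultimately show ?thesis using unit[of t] st(2,4) n by (simp add: mult.commute)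
    qed
  qed
  ultimately show ?thesis by blast
qed

end

lemma vge_quotient:
  assumes "on_curve E x y" "isreg u" "isreg v" "u (Affine x y) = 0" "v (Affine x y) \<noteq> 0"
    "ev (\<lambda>p. k p = u p / v p)"
  shows "vge (ord (Affine x y)) 1 k"
proof -
  have v: "ev (\<lambda>p. v p \<noteq> 0)" using isreg_ev_neq_0 assms by blast
  have rk: "rat k" by (rule ratI[OF assms(2,3) v assms(6)])
  have "1 \<le> ord (Affine x y) k" if k: "rfun k"
  proof -
    have P: "Affine x y \<in> points E" using assms by simp
    have "ev (\<lambda>p. k p \<noteq> 0)" using k by (simp add: rfun_def)
    with assms(6) have u: "ev (\<lambda>p. u p \<noteq> 0)" by eventually_elim auto
    have "ord (Affine x y) k = ord (Affine x y) u - ord (Affine x y) v"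
      using ord_cong[OF P k assms(6)] ord_divide[OF P rfun_isreg rfun_isreg] assms u v by simp
    moreover have "ord (Affine x y) u > 0" using ord_isreg_pos_iff[OF assms(1,2) u] assms by simp
    ultimately show ?thesis using ord_isreg_eq_0[OF assms(1,3,5)] by simp
  qed
  then show ?thesis using rk by (simp add: vge_def)
qed

lemma vge_quotient_Infinity:
  assumes "C \<noteq> 0 \<or> D \<noteq> 0" "A \<noteq> 0 \<or> B \<noteq> 0 \<Longrightarrow> degree (nrm A B) < degree (nrm C D)"
    "ev (\<lambda>p. k p = reg A B p / reg C D p)"
  shows "vge (ord Infinity) 1 k"
proof -
  have rk: "rat k"
    by (rule ratI[OF isreg_reg isreg_reg ev_reg_neq_0[OF assms(1)] assms(3)])
  have "1 \<le> ord Infinity k" if k: "rfun k"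
  proof -
    have "A \<noteq> 0 \<or> B \<noteq> 0"
    proof (rule ccontr)
      assume "\<not> ?thesis"
      then have z: "A = 0" "B = 0" by auto
      from k have "ev (\<lambda>p. k p \<noteq> 0)" by (simp add: rfun_def)
      with assms(3) ev_affine have "ev (\<lambda>p. False)" by eventually_elim (auto simp: z)
      then show False by simp
    qed
    then show ?thesis
      using ord_cong[OF Infinity_in_points k assms(3)] assms(2)
        ord_divide[OF Infinity_in_points rfun_reg rfun_reg[OF assms(1)], of A B]
        ord_Infinity_reg[of A B] ord_Infinity_reg[OF assms(1)] by simp
  qed
  then show ?thesis using rk by (simp add: vge_def)
qed

text \<open>The chord formula with the slope cleared: both coordinates are quotients of regular
  functions with a power of a - x below.\<close>

lemma add_coords:
  assumes "x \<noteq> a"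
  shows "Affine x y \<uplus> Affine a b = Affine (((b - y) ^ 2 - (wa2 E + x + a) * (a - x) ^ 2) / (a - x) ^ 2)
    ((- (b - y) * ((b - y) ^ 2 - (wa2 E + x + a) * (a - x) ^ 2)
      - y * (a - x) ^ 3 + (b - y) * x * (a - x) ^ 2) / (a - x) ^ 3)"
proof -
  define d where "d = a - x"
  have d: "d \<noteq> 0" using assms by (simp add: d_def)
  define l where "l = (b - y) / d"
  have l: "b - y = l * d" using d by (simp add: l_def)
  have s: "Affine x y \<uplus> Affine a b = Affine (l ^ 2 - wa2 E - x - a) (- l * (l ^ 2 - wa2 E - x - a) - (y - l * x))"
    using assms by (simp add: a1 a3 Let_def l_def d_def)
  have "l ^ 2 - wa2 E - x - a = ((b - y) ^ 2 - (wa2 E + x + a) * d ^ 2) / d ^ 2"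
    unfolding l using d by (simp add: field_simps)
  moreover have "- l * (l ^ 2 - wa2 E - x - a) - (y - l * x) = (- (b - y) * ((b - y) ^ 2 - (wa2 E + x + a) * d ^ 2)
    - y * d ^ 3 + (b - y) * x * d ^ 2) / d ^ 3"
    unfolding l using d by (simp add: field_simps power2_eq_square power3_eq_cube)
  ultimately show ?thesis unfolding s d_def by simp
qed

lemma ev_add_coords:
  assumes "on_curve E a b"
  shows "ev (\<lambda>p. xc (p \<uplus> Affine a b) =
      ((b - yc p) ^ 2 - (wa2 E + xc p + a) * (a - xc p) ^ 2) / (a - xc p) ^ 2)"
    "ev (\<lambda>p. yc (p \<uplus> Affine a b) = (- (b - yc p) * ((b - yc p) ^ 2 - (wa2 E + xc p + a) * (a - xc p) ^ 2)
      - yc p * (a - xc p) ^ 3 + (b - yc p) * xc p * (a - xc p) ^ 2) / (a - xc p) ^ 3)"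
proof -
  have "ev (\<lambda>p. xc p \<noteq> a \<and> (\<exists>x y. p = Affine x y))"
    using ev_xc_neq[of a] ev_affine by eventually_elim auto
  then have **: "ev (\<lambda>p. xc (p \<uplus> Affine a b) =
      ((b - yc p) ^ 2 - (wa2 E + xc p + a) * (a - xc p) ^ 2) / (a - xc p) ^ 2 \<and>
    yc (p \<uplus> Affine a b) = (- (b - yc p) * ((b - yc p) ^ 2 - (wa2 E + xc p + a) * (a - xc p) ^ 2)
      - yc p * (a - xc p) ^ 3 + (b - yc p) * xc p * (a - xc p) ^ 2) / (a - xc p) ^ 3)"
  proof eventually_elim
    case (elim p)
    then obtain x y where "p = Affine x y" "x \<noteq> a" by auto
    then show ?case unfolding \<open>p = Affine x y\<close>  by (simp only: add_coords[OF \<open>x \<noteq> a\<close>] xc.simps yc.simps simp_thms)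
  qed
  show "ev (\<lambda>p. xc (p \<uplus> Affine a b) =
      ((b - yc p) ^ 2 - (wa2 E + xc p + a) * (a - xc p) ^ 2) / (a - xc p) ^ 2)"
    using ** by (rule eventually_mono) blast
  show "ev (\<lambda>p. yc (p \<uplus> Affine a b) = (- (b - yc p) * ((b - yc p) ^ 2 - (wa2 E + xc p + a) * (a - xc p) ^ 2)
      - yc p * (a - xc p) ^ 3 + (b - yc p) * xc p * (a - xc p) ^ 2) / (a - xc p) ^ 3)"
    using ** by (rule eventually_mono) blast
qed


declare add_pt.simps(3) [simp del]

lemma vge_trans:
  assumes S: "S \<in> points E" and "rat h" "vge w n (\<lambda>p. h (p \<uplus> S))"
  shows "vge (\<lambda>h. w (\<lambda>p. h (p \<uplus> S))) n h"
  using assms rfun_trans[OF S, of h] unfolding vge_def by blast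

text \<open>The translated order is a valuation centred at the sum: the coordinates of p + S, minus
  their values at P, are quotients whose numerator vanishes at P and whose denominator does not,
  since x \<noteq> a.\<close>

lemma ord_trans_scale_affine:
  assumes oc: "on_curve E x y" "on_curve E a b" and ne: "x \<noteq> a"
  shows "\<exists>e>0. \<forall>h. rfun h \<longrightarrow> ord (Affine x y) (\<lambda>p. h (p \<uplus> Affine a b)) =
    e * ord (Affine x y \<uplus> Affine a b) h"
proof -
  define P S where "P = Affine x y" and "S = Affine a b"
  have PS: "P \<in> points E" "S \<in> points E" using oc by (auto simp: P_def S_def)
  define nx where "nx = (\<lambda>p. (b - yc p) ^ 2 - (wa2 E + xc p + a) * (a - xc p) ^ 2)"
  define ny where "ny = (\<lambda>p. - (b - yc p) * nx p - yc p * (a - xc p) ^ 3 + (b - yc p) * xc p * (a - xc p) ^ 2)"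
  have nx: "isreg nx" unfolding nx_def by (intro isreg_intros)
  have ny: "isreg ny" unfolding ny_def by (intro isreg_intros nx)
  define a' b' where "a' = nx P / (a - x) ^ 2" and "b' = ny P / (a - x) ^ 3"
  have sum: "P \<uplus> S = Affine a' b'"
    unfolding P_def S_def a'_def b'_def ny_def nx_def add_coords[OF ne] by simp
  have d: "a - x \<noteq> 0" using ne by simp
  have ab: "on_curve E a' b'" using add_closed[OF PS] sum by simp
  have "vge (ord P) 1 (\<lambda>p. xc (p \<uplus> S) - a')"
    unfolding P_def
  proof (rule vge_quotient[OF oc(1)])
    show "isreg (\<lambda>p. nx p - a' * (a - xc p) ^ 2)" "isreg (\<lambda>p. (a - xc p) ^ 2)"
      by (intro isreg_intros nx)+
    show "nx (Affine x y) - a' * (a - xc (Affine x y)) ^ 2 = 0" "(a - xc (Affine x y)) ^ 2 \<noteq> 0"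
      using d by (auto simp: a'_def P_def)
    show "ev (\<lambda>p. xc (p \<uplus> S) - a' = (nx p - a' * (a - xc p) ^ 2) / (a - xc p) ^ 2)"
      using ev_add_coords(1)[OF oc(2)] ev_xc_neq[of a] unfolding S_def nx_def
      by eventually_elim (simp add: diff_divide_distrib)
  qed
  moreover have "rfun (\<lambda>p. xc (p \<uplus> S) - a')" using rfun_trans[OF PS(2) rfun_xc_diff[of a']] .
  ultimately have x: "ord P (\<lambda>p. xc (p \<uplus> S) - a') > 0" by (simp add: vge_def)
  have y: "vge (ord P) 1 (\<lambda>p. yc (p \<uplus> S) - b')"
    unfolding P_def
  proof (rule vge_quotient[OF oc(1)])
    show "isreg (\<lambda>p. ny p - b' * (a - xc p) ^ 3)" "isreg (\<lambda>p. (a - xc p) ^ 3)"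
      by (intro isreg_intros ny)+
    show "ny (Affine x y) - b' * (a - xc (Affine x y)) ^ 3 = 0" "(a - xc (Affine x y)) ^ 3 \<noteq> 0"
      using d by (auto simp: b'_def P_def)
    show "ev (\<lambda>p. yc (p \<uplus> S) - b' = (ny p - b' * (a - xc p) ^ 3) / (a - xc p) ^ 3)"
      using ev_add_coords(2)[OF oc(2)] ev_xc_neq[of a] unfolding S_def ny_def nx_def
      by eventually_elim (simp add: diff_divide_distrib)
  qed
  have "vge (\<lambda>h. ord P (\<lambda>p. h (p \<uplus> S))) 1 (\<lambda>p. yc p - b')"
    by (rule vge_trans[OF PS(2) _ y]) (intro rat_intros)
  from valuation_affine[OF valuation_trans[OF valuation_ord[OF PS(1)] PS(2)] ab x this]
  show ?thesis unfolding sum[symmetric] P_def S_def .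
qed

text \<open>The valuation is centred at S. Once y^2 is replaced by f(x), leading terms cancel and
  the numerators of both coordinate differences have smaller norm degree than (a - x)^2 and (a -
  x)^3.\<close>

lemma ord_trans_scale_Infinity:
  assumes oc: "on_curve E a b"
  shows "\<exists>e>0. \<forall>h. rfun h \<longrightarrow> ord Infinity (\<lambda>p. h (p \<uplus> Affine a b)) = e * ord (Affine a b) h"
proof -
  define S where "S = Affine a b"
  have S: "S \<in> points E" using oc by (simp add: S_def)
  have bb: "b ^ 2 = a ^ 3 + wa2 E * a ^ 2 + wa4 E * a + wa6 E"
    using oc by (simp add: on_curve_iff poly_f)
  \<comment> \<open>The numerator of x(p + S) - a over (a - x)^2 reduces to \<beta> + \<alpha> x - 2
    b y, of norm degree at most 3 against 4.\<close>
  define \<alpha> \<beta> where "\<alpha> = wa4 E - a ^ 2 + 2 * a * (wa2 E + 2 * a)"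
    and "\<beta> = wa6 E - a ^ 2 * (wa2 E + 2 * a) + b ^ 2"
  have d: "[:a, -1:] ^ n \<noteq> 0 \<or> (0 :: 'a poly) \<noteq> 0" for n by simp
  have dg: "degree (nrm ([:a, -1:] ^ n) 0) = 2 * n" for n
    using degree_nrm(2)[OF d[of n]] by (simp add: degree_power_eq)
  have "vge (ord Infinity) 1 (\<lambda>p. xc (p \<uplus> S) - a)"
  proof (rule vge_quotient_Infinity[OF d[of 2]])
    show "degree (nrm [:\<beta>, \<alpha>:] [:-2 * b:]) < degree (nrm ([:a, -1:] ^ 2) 0)"
      if "[:\<beta>, \<alpha>:] \<noteq> 0 \<or> [:-2 * b:] \<noteq> 0"
      unfolding degree_nrm(2)[OF that] dg by (simp add: degree_pCons_eq_if)
    show "ev (\<lambda>p. xc (p \<uplus> S) - a = reg [:\<beta>, \<alpha>:] [:-2 * b:] p / reg ([:a, -1:] ^ 2) 0 p)"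
      using ev_add_coords(1)[OF oc] ev_xc_neq[of a] ev_affine
    proof eventually_elim
      case (elim p)
      then obtain x y where p: "p = Affine x y" "on_curve E x y" by blast
      have yy: "y ^ 2 = x ^ 3 + wa2 E * x ^ 2 + wa4 E * x + wa6 E"
        using p by (simp add: on_curve_iff poly_f)
      have "(b - y) ^ 2 - (wa2 E + x + a) * (a - x) ^ 2 - a * (a - x) ^ 2 = \<beta> + x * \<alpha> - 2 * b * y"
        unfolding \<alpha>_def \<beta>_def using yy by Groebner_Basis.algebra
      moreover have "a - x \<noteq> 0" using elim(2) p by simp
      then have "((b - y) ^ 2 - (wa2 E + x + a) * (a - x) ^ 2) / (a - x) ^ 2 - a =
          ((b - y) ^ 2 - (wa2 E + x + a) * (a - x) ^ 2 - a * (a - x) ^ 2) / (a - x) ^ 2"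
        by (simp add: diff_divide_distrib)
      moreover have "reg [:\<beta>, \<alpha>:] [:-2 * b:] p = \<beta> + x * \<alpha> - 2 * b * y" by (simp add: p)
      ultimately show ?case using elim(1) unfolding S_def by (simp add: p)
    qed
  qed
  moreover have "rfun (\<lambda>p. xc (p \<uplus> S) - a)" using rfun_trans[OF S rfun_xc_diff[of a]] .
  ultimately have x: "ord Infinity (\<lambda>p. xc (p \<uplus> S) - a) > 0" by (simp add: vge_def)
  \<comment> \<open>The numerator of y(p + S) - b over (a - x)^3 reduces to \<open>A2\<close> plus
    \<open>B2\<close> times y, of norm degree at most 5 against 6.\<close>
  define A2 where "A2 = [:- 2 * b * (wa6 E + a ^ 3) - b * \<beta>, - 2 * b * (wa4 E - 3 * a ^ 2) - b * \<alpha>,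
    - 2 * b * (wa2 E + 3 * a):]"
  define B2 where "B2 = [:\<beta> + 2 * b ^ 2, \<alpha>:]"
  have y: "vge (ord Infinity) 1 (\<lambda>p. yc (p \<uplus> S) - b)"
  proof (rule vge_quotient_Infinity[OF d[of 3]])
    show "degree (nrm A2 B2) < degree (nrm ([:a, -1:] ^ 3) 0)" if "A2 \<noteq> 0 \<or> B2 \<noteq> 0"
      unfolding degree_nrm(2)[OF that] dg by (simp add: degree_pCons_eq_if A2_def B2_def)
    show "ev (\<lambda>p. yc (p \<uplus> S) - b = reg A2 B2 p / reg ([:a, -1:] ^ 3) 0 p)"
      using ev_add_coords(2)[OF oc] ev_xc_neq[of a] ev_affine
    proof eventually_elim
      case (elim p)
      then obtain x y where p: "p = Affine x y" "on_curve E x y" by blast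
      have yy: "y ^ 2 = x ^ 3 + wa2 E * x ^ 2 + wa4 E * x + wa6 E"
        using p by (simp add: on_curve_iff poly_f)
      have r: "reg A2 B2 p = (- 2 * b * (wa6 E + a ^ 3) - b * \<beta>) + x * (- 2 * b * (wa4 E - 3 * a ^ 2) - b * \<alpha>)
        + x ^ 2 * (- 2 * b * (wa2 E + 3 * a)) + (\<beta> + 2 * b ^ 2 + x * \<alpha>) * y"
        by (simp add: p A2_def B2_def power2_eq_square algebra_simps)
      have "- (b - y) * ((b - y) ^ 2 - (wa2 E + x + a) * (a - x) ^ 2)
        - y * (a - x) ^ 3 + (b - y) * x * (a - x) ^ 2 - b * (a - x) ^ 3 = reg A2 B2 p"
        unfolding r \<alpha>_def \<beta>_def using yy by Groebner_Basis.algebra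
      moreover have "a - x \<noteq> 0" using elim(2) p by simp
      then have "(- (b - y) * ((b - y) ^ 2 - (wa2 E + x + a) * (a - x) ^ 2)
        - y * (a - x) ^ 3 + (b - y) * x * (a - x) ^ 2) / (a - x) ^ 3 - b = (- (b - y) * ((b - y) ^ 2 - (wa2 E + x + a) * (a - x) ^ 2)
        - y * (a - x) ^ 3 + (b - y) * x * (a - x) ^ 2 - b * (a - x) ^ 3) / (a - x) ^ 3"
        by (simp add: diff_divide_distrib)
      moreover have "reg ([:a, -1:] ^ 3) 0 p = (a - x) ^ 3" by (simp add: p)
      moreover have "xc p = x" "yc p = y" by (simp_all add: p)
      ultimately show ?case using elim(1) unfolding S_def by simp
    qed
  qed
  have "vge (\<lambda>h. ord Infinity (\<lambda>p. h (p \<uplus> S))) 1 (\<lambda>p. yc p - b)"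
    by (rule vge_trans[OF S _ y]) (intro rat_intros)
  from valuation_affine[OF valuation_trans[OF valuation_ord[OF Infinity_in_points] S] oc x this]
  show ?thesis unfolding S_def .
qed

lemma ord_attains_1:
  assumes "P \<in> points E" shows "\<exists>h. rfun h \<and> ord P h = 1"
  using assms
proof (cases rule: points_cases)
  case 1
  have "rfun (\<lambda>p. (xc p - 0) / yc p)" by (intro rfun_divide rfun_xc_diff rfun_yc)
  moreover have "ord Infinity (\<lambda>p. (xc p - 0) / yc p) = 1"
    using ord_divide[OF Infinity_in_points rfun_xc_diff[of 0] rfun_yc] ord_xc_diff_Infinity[of 0]
      ord_yc_Infinity by simp
  ultimately show ?thesis unfolding 1 by blast
next
  case (2 x y)
  then show ?thesis using ord_unif[OF 2(2)] rfun_isreg[OF isreg_unif ev_unif_neq_0] by blast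
qed

text \<open>Translating a function of order 1 at P back by -S exhibits 1 as a multiple of
  \<open>e\<close>, so the scale is 1.\<close>

lemma ord_trans_unscale:
  assumes P: "P \<in> points E" and S: "S \<in> points E"
    and e: "e > 0" "\<And>h. rfun h \<Longrightarrow> ord P (\<lambda>p. h (p \<uplus> S)) = e * ord (P \<uplus> S) h"
    and h: "rfun h"
  shows "ord P (\<lambda>p. h (p \<uplus> S)) = ord (P \<uplus> S) h"
proof -
  obtain g where g: "rfun g" "ord P g = 1" using ord_attains_1[OF P] by blast
  have "ev (\<lambda>p. g p = g (p \<uplus> S \<uplus> neg S))" using ev_points by eventually_elim (use S in simp)
  then have "ord P (\<lambda>p. g (p \<uplus> S \<uplus> neg S)) = 1" using ord_cong[OF P g(1)] g(2) by simp
  moreover have "ord P (\<lambda>p. g (p \<uplus> S \<uplus> neg S)) = e * ord (P \<uplus> S) (\<lambda>p. g (p \<uplus> neg S))"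
    using e(2)[OF rfun_trans[of "neg S", OF _ g(1)]] S by simp
  ultimately have "e dvd 1" by (metis dvd_triv_left)
  then have "e = 1" using e(1) by simp
  then show ?thesis using e(2)[OF h] by simp
qed

lemma ord_trans_generic:
  assumes "on_curve E x y" "on_curve E a b" "x \<noteq> a" "rfun h"
  shows "ord (Affine x y) (\<lambda>p. h (p \<uplus> Affine a b)) = ord (Affine x y \<uplus> Affine a b) h"
  using ord_trans_scale_affine[OF assms(1-3)] ord_trans_unscale[of "Affine x y" "Affine a b" _ h] assms
  by auto

lemma ord_trans_Infinity:
  assumes "S \<in> points E" "rfun h"
  shows "ord Infinity (\<lambda>p. h (p \<uplus> S)) = ord S h"
  using assms(1)
proof (cases rule: points_cases)
  case (2 a b)
  then show ?thesis
    using ord_trans_scale_Infinity[OF 2(2)] ord_trans_unscale[of Infinity S _ h] assms by auto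
qed simp

lemma same_xc:
  assumes "P \<in> points E" "Q \<in> points E" "P \<noteq> Infinity" "Q \<noteq> Infinity"
  shows "xc P = xc Q \<longleftrightarrow> P = Q \<or> P = neg Q"
proof -
  obtain x y x' y' where *: "P = Affine x y" "Q = Affine x' y'" using assms by (metis point.exhaust)
  then have "x = x' \<Longrightarrow> y ^ 2 = y' ^ 2" using assms by (simp add: on_curve_iff)
  then show ?thesis using * by (auto simp: power2_eq_iff)
qed

lemma ord_trans_generic':
  assumes P: "P \<in> points E" and S: "S \<in> points E" and "P \<noteq> Infinity" "S \<noteq> Infinity" "P \<noteq> S" "P \<noteq> neg S"
    and h: "rfun h"
  shows "ord P (\<lambda>p. h (p \<uplus> S)) = ord (P \<uplus> S) h"
proof -
  obtain x y a b where *: "P = Affine x y" "S = Affine a b" using assms by (metis point.exhaust)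
  then have "x \<noteq> a" using same_xc[OF P S assms(3,4)] assms(5,6) by auto
  then show ?thesis using ord_trans_generic[of x y a b h] P S h unfolding * by simp
qed

text \<open>The formulas for the generic case miss P = -S and P = S. The former is undone by
  translating back to infinity. For the latter, translation by S is split into translations by a
  generic T and by U = S - T.\<close>

lemma ord_trans:
  assumes P: "P \<in> points E" and S: "S \<in> points E" and h: "rfun h"
  shows "ord P (\<lambda>p. h (p \<uplus> S)) = ord (P \<uplus> S) h"
proof -
  consider "P = Infinity" | "S = Infinity" | "P \<noteq> Infinity" "S \<noteq> Infinity" "P = neg S"
    | "P \<noteq> Infinity" "S \<noteq> Infinity" "P = S" "P \<noteq> neg S"
    | "P \<noteq> Infinity" "S \<noteq> Infinity" "P \<noteq> S" "P \<noteq> neg S" by blast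
  then show ?thesis
  proof cases
    case 1
    then show ?thesis using ord_trans_Infinity[OF S h] by simp
  next
    case 2
    then show ?thesis by simp
  next
    case 3
    have nS: "neg S \<in> points E" using S by simp
    have "ev (\<lambda>p. h p = h (p \<uplus> neg S \<uplus> S))" using ev_points by eventually_elim (use S in simp)
    then have "ord Infinity (\<lambda>p. h (p \<uplus> neg S \<uplus> S)) = ord Infinity h"
      by (rule ord_cong[OF Infinity_in_points h])
    moreover have "ord Infinity (\<lambda>p. h (p \<uplus> neg S \<uplus> S)) = ord (neg S) (\<lambda>p. h (p \<uplus> S))"
      by (rule ord_trans_Infinity[OF nS rfun_trans[OF S h]])
    ultimately show ?thesis using 3 by simp
  next
    case 4
    \<comment> \<open>These conditions keep both partial translations generic; the nonzero ordinate
      gives T \<noteq> -T, which rules out S + T = U.\<close>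
    have "ev (\<lambda>p. p \<in> points E \<and> p \<noteq> Infinity \<and> p \<noteq> S \<and> p \<noteq> neg S \<and> yc p \<noteq> 0)"
      using ev_points ev_neq[of Infinity] ev_neq[of S] ev_neq[of "neg S"] ev_yc_neq
      by eventually_elim simp
    then obtain T where T: "T \<in> points E" "T \<noteq> Infinity" "T \<noteq> S" "T \<noteq> neg S" "yc T \<noteq> 0"
      using ev_ex by blast
    define U where "U = S \<uplus> neg T"
    have nT: "T \<noteq> neg T" using T(5,2) eq_minus_self_iff by (cases T) auto
    have U: "U \<in> points E" unfolding U_def using S T by auto
    have TU: "T \<uplus> U = S" unfolding U_def using S T by (metis add_neg_cancel(2) add_comm add_closed neg_in_points)
    have ST: "S \<uplus> T \<in> points E" using S T by auto
    have U0: "U \<noteq> Infinity"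
    proof
      assume "U = Infinity"
      then have "S = neg (neg T)" unfolding U_def using neg_unique[of S "neg T"] S T by simp
      then show False using T by simp
    qed
    have ST0: "S \<uplus> T \<noteq> Infinity"
    proof
      assume "S \<uplus> T = Infinity"
      then have "S = neg T" using neg_unique[of S T] S T by simp
      then show False using T by simp
    qed
    have "S \<uplus> T \<noteq> U"
    proof
      assume "S \<uplus> T = U"
      then have "T \<uplus> S = neg T \<uplus> S" unfolding U_def using S T by (metis add_comm neg_in_points)
      then show False using S T nT add_cancel_right[of T "neg T" S] by simp
    qed
    moreover have "S \<uplus> T \<noteq> neg U"
    proof
      assume "S \<uplus> T = neg U"
      then have "S \<uplus> T = neg S \<uplus> T" unfolding U_def using S T neg_add_distrib[of S "neg T"] by simp
      then show False using S T 4 add_cancel_right[of S "neg S" T] by simp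
    qed
    ultimately have "ord (S \<uplus> T) (\<lambda>p. h (p \<uplus> U)) = ord (S \<uplus> T \<uplus> U) h"
      by (intro ord_trans_generic' ST U ST0 U0 h)
    moreover have "ord S (\<lambda>p. h (p \<uplus> T \<uplus> U)) = ord (S \<uplus> T) (\<lambda>p. h (p \<uplus> U))"
      using T(3,4) by (intro ord_trans_generic' S T(1,2) 4 rfun_trans[OF U h]) auto
    moreover have "ev (\<lambda>p. h (p \<uplus> S) = h (p \<uplus> T \<uplus> U))"
      using ev_points by eventually_elim (use T U TU in \<open>simp add: add_assoc\<close>)
    then have "ord S (\<lambda>p. h (p \<uplus> T \<uplus> U)) = ord S (\<lambda>p. h (p \<uplus> S))"
      by (rule ord_cong[OF S rfun_trans[OF S h]])
    ultimately show ?thesis using 4 S T U TU by (simp add: add_assoc)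
  next
    case 5
    then show ?thesis using ord_trans_generic'[OF P S _ _ _ _ h] by simp
  qed
qed

subsection \<open>Multiples of points\<close>

lemma mult_pt_0 [simp]: "mult_pt E 0 P = Infinity"
  by (simp add: mult_pt_def)

lemma mult_pt_Suc: "mult_pt E (Suc n) P = P \<uplus> mult_pt E n P"
  by (simp add: mult_pt_def)

lemma mult_pt_1 [simp]: "mult_pt E (Suc 0) P = P"
  by (simp add: mult_pt_Suc)

lemma mult_pt_closed [simp, intro]: "P \<in> points E \<Longrightarrow> mult_pt E n P \<in> points E"
  by (induction n) (auto simp: mult_pt_Suc)

lemma mult_pt_add: "P \<in> points E \<Longrightarrow> mult_pt E (m + n) P = mult_pt E m P \<uplus> mult_pt E n P"
  by (induction m) (auto simp: mult_pt_Suc add_assoc)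

lemma mult_pt_Infinity [simp]: "mult_pt E n Infinity = Infinity"
  by (induction n) (auto simp: mult_pt_Suc)

lemma mult_pt_distrib:
  "P \<in> points E \<Longrightarrow> Q \<in> points E \<Longrightarrow> mult_pt E n (P \<uplus> Q) = mult_pt E n P \<uplus> mult_pt E n Q"
  by (induction n) (auto simp: mult_pt_Suc add_ac)

lemma mult_pt_mult: "P \<in> points E \<Longrightarrow> mult_pt E (m * n) P = mult_pt E m (mult_pt E n P)"
  by (induction m) (auto simp: mult_pt_Suc mult_pt_add)

lemma mult_pt_neg: "P \<in> points E \<Longrightarrow> mult_pt E n (neg P) = neg (mult_pt E n P)"
  by (induction n) (auto simp: mult_pt_Suc neg_add_distrib)


subsection \<open>Surjectivity of multiplication\<close>

text \<open>Any P is the difference of q + P and q, and for generic q both lie in G.\<close>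

lemma cofinite_subgroup:
  assumes "\<And>P Q. P \<in> G \<Longrightarrow> Q \<in> G \<Longrightarrow> P \<uplus> neg Q \<in> G" "ev (\<lambda>p. p \<in> G)" "P \<in> points E"
  shows "P \<in> G"
proof -
  have "ev (\<lambda>p. p \<in> points E \<and> p \<in> G \<and> p \<uplus> P \<in> G)"
    using ev_points assms(2) ev_trans[OF assms(3,2)] by eventually_elim simp
  then obtain q where q: "q \<in> points E" "q \<in> G" "q \<uplus> P \<in> G" using ev_ex by blast
  have "q \<uplus> P \<uplus> neg q = P"
    using q assms(3) add_comm[of q P] by simp
  then show ?thesis using assms(1)[OF q(3,2)] by simp
qed

lemma finite_if_at_most_one: "(\<And>x y. x \<in> S \<Longrightarrow> y \<in> S \<Longrightarrow> x = y) \<Longrightarrow> finite S"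
  by (metis finite.emptyI finite_insert insertI1 subsetI rev_finite_subset all_not_in_conv)

lemma vge_ordI: "rfun h \<Longrightarrow> n \<le> ord P h \<Longrightarrow> vge (ord P) n h"
  by (simp add: vge_def rfun_def)

lemma vge_scale: "P \<in> points E \<Longrightarrow> vge (ord P) n h \<Longrightarrow> vge (ord P) n (\<lambda>p. c * h p)"
  using vge_mult[OF valuation_ord vge_const[OF valuation_ord, of P c], of n h] by simp

text \<open>Let \<xi> = u/v. If c and c' are missed, u - c v and u - c' v have no zeros off a finite
  set F, and equal orders on F unless one of the values is exceptional there. They are then
  proportional, which makes \<xi> constant. Only finitely many values are exceptional.\<close>

lemma rational_image_cofinite:
  assumes \<xi>: "rat \<xi>" and nc: "\<And>c. \<not> ev (\<lambda>p. \<xi> p = c)" and Q: "ev Q"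
  shows "finite {c. \<not> (\<exists>p\<in>points E. Q p \<and> \<xi> p = c)}" (is "finite ?T")
proof -
  obtain u v where uv: "isreg u" "isreg v" "ev (\<lambda>p. v p \<noteq> 0)" "ev (\<lambda>p. \<xi> p = u p / v p)"
    using \<xi> unfolding rat_def by blast
  have v: "rfun v" using uv rfun_isreg by blast
  define U where "U = (\<lambda>c p. u p - c * v p)"
  have U: "rfun (U c)" "isreg (U c)" for c
  proof -
    show i: "isreg (U c)" unfolding U_def by (intro isreg_intros uv)
    have "\<not> ev (\<lambda>p. U c p = 0)"
    proof
      assume "ev (\<lambda>p. U c p = 0)"
      with uv(3,4) have "ev (\<lambda>p. \<xi> p = c)" by eventually_elim (simp add: U_def)
      then show False using nc by blast
    qed
    then show "rfun (U c)" using rat_cases[OF isreg_rat[OF i]] by blast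
  qed
  have u: "rfun u" using U(1)[of 0] by (simp add: U_def)
  define F where "F = {p \<in> points E. \<not> (Q p \<and> \<xi> p = u p / v p \<and> v p \<noteq> 0 \<and> p \<noteq> Infinity)}"
  have "ev (\<lambda>p. Q p \<and> \<xi> p = u p / v p \<and> v p \<noteq> 0 \<and> p \<noteq> Infinity)"
    using Q uv(3,4) ev_neq[of Infinity] by eventually_elim simp
  then have F: "finite F" unfolding F_def ev_iff .
  \<comment> \<open>At each P at most one c lifts the order of u - c v above the minimum of the
    orders of u and v: with two such values u and v, being combinations of the two differences,
    would both lie above that minimum.\<close>
  define bad where "bad = (\<lambda>P. {c. ord P (U c) \<noteq> min (ord P u) (ord P v)})"
  have gt: "ord P (U c) > min (ord P u) (ord P v)" if "P \<in> points E" "c \<in> bad P" for P c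
  proof -
    have "vge (ord P) (min (ord P u) (ord P v)) (\<lambda>p. u p + (- c) * v p)"
      using that by (intro vge_add[OF valuation_ord] vge_scale vge_ordI u v) auto
    then have "min (ord P u) (ord P v) \<le> ord P (U c)"
      using U(1)[of c] by (simp add: vge_def U_def)
    then show ?thesis using that by (simp add: bad_def)
  qed
  have bad: "finite (bad P)" if P: "P \<in> points E" for P
  proof (rule finite_if_at_most_one, rule ccontr)
    fix c c' assume c: "c \<in> bad P" "c' \<in> bad P" "c \<noteq> c'"
    define n where "n = min (ord P u) (ord P v) + 1"
    have vU: "vge (ord P) n (U c)" "vge (ord P) n (U c')"
      using gt[OF P c(1)] gt[OF P c(2)] by (intro vge_ordI U, simp add: n_def)+
    have "vge (ord P) n (\<lambda>p. (1 / (c - c')) * (U c' p + (- 1) * U c p))"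
      by (intro vge_scale vge_add[OF valuation_ord] P vU)
    moreover have "(\<lambda>p. (1 / (c - c')) * (U c' p + (- 1) * U c p)) = v"
      using c(3) by (auto simp: U_def field_simps)
    ultimately have vv: "vge (ord P) n v" by simp
    have "vge (ord P) n (\<lambda>p. U c p + c * v p)"
      by (intro vge_scale vge_add[OF valuation_ord] P vU vv)
    then have "vge (ord P) n u" by (simp add: U_def)
    then show False using vv u v by (simp add: vge_def n_def min_def split: if_splits)
  qed
  have "finite (?T - (\<Union>P\<in>F. bad P))"
  proof (rule finite_if_at_most_one, rule ccontr)
    fix c c' assume c: "c \<in> ?T - (\<Union>P\<in>F. bad P)" and c': "c' \<in> ?T - (\<Union>P\<in>F. bad P)" and ne: "c \<noteq> c'"
    have out: "ord P (U d) = 0" if P': "P \<in> points E" "P \<notin> F" and d: "d \<in> ?T" for P d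
    proof -
      obtain x y where P: "P = Affine x y" "on_curve E x y"
        using P' by (cases P) (auto simp: F_def)
      have "U d P \<noteq> 0" using P' d by (auto simp: F_def U_def)
      then show ?thesis using ord_isreg_eq_0[OF P(2) U(2)] P by simp
    qed
    have "ord P (U c) = ord P (U c')" if P: "P \<in> points E" for P
      using out[OF P, of c] out[OF P, of c'] c c' by (cases "P \<in> F") (auto simp: bad_def)
    then obtain k where k: "ev (\<lambda>p. U c p = k * U c' p)"
      using proportional_if_same_ord[OF U(1) U(1)] by blast
    show False
    proof (cases "k = 1")
      case True
      from k uv(3) have "ev (\<lambda>p. False)" by eventually_elim (use ne True in \<open>auto simp: U_def\<close>)
      then show False by simp
    next
      case False
      have "ev (\<lambda>p. \<xi> p = (c - k * c') / (1 - k))"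
        using k uv(3,4)
      proof eventually_elim
        case (elim p)
        have "u p * (1 - k) = v p * (c - k * c')" using elim(1) unfolding U_def by Groebner_Basis.algebra
        then show ?case unfolding elim(3) using elim(2) False by (simp add: frac_eq_eq mult.commute)
      qed
      then show False using nc by blast
    qed
  qed
  moreover have "finite (\<Union>P\<in>F. bad P)" using F bad by (auto simp: F_def)
  ultimately show ?thesis using finite_Diff2 by blast
qed

lemma not_ev_torsion:
  assumes "\<exists>P\<in>points E. mult_pt E n P \<noteq> Infinity"
  shows "\<not> ev (\<lambda>p. mult_pt E n p = Infinity)"
proof
  assume *: "ev (\<lambda>p. mult_pt E n p = Infinity)"
  obtain P where P: "P \<in> points E" "mult_pt E n P \<noteq> Infinity" using assms by blast
  have "P \<in> {p \<in> points E. mult_pt E n p = Infinity}"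
  proof (rule cofinite_subgroup[OF _ _ P(1)])
    show "ev (\<lambda>p. p \<in> {p \<in> points E. mult_pt E n p = Infinity})"
      using * ev_points by eventually_elim simp
  qed (auto simp: mult_pt_distrib mult_pt_neg)
  then show False using P by simp
qed

text \<open>The chord formula is applied over the function field unless n p and p have the same
  abscissa identically. In that case n p = p and the tangent formula applies, since n p = -p would
  make all points (n + 1)-torsion.\<close>

lemma mult_pt_rational:
  assumes "\<And>k. 0 < k \<Longrightarrow> k \<le> n \<Longrightarrow> \<exists>P\<in>points E. mult_pt E k P \<noteq> Infinity" "0 < n"
  shows "\<exists>\<xi> \<eta>. rat \<xi> \<and> rat \<eta> \<and> ev (\<lambda>p. mult_pt E n p = Affine (\<xi> p) (\<eta> p))"
  using assms
proof (induction n)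
  case (Suc n)
  show ?case
  proof (cases "n = 0")
    case True
    have "ev (\<lambda>p. mult_pt E (Suc n) p = Affine (xc p) (yc p))"
      unfolding True by (rule ev_affineI) simp
    then show ?thesis using rat_intros by blast
  next
    case False
    then obtain \<xi> \<eta> where XY: "rat \<xi>" "rat \<eta>" "ev (\<lambda>p. mult_pt E n p = Affine (\<xi> p) (\<eta> p))"
      using Suc by (metis le_SucI neq0_conv)
    have oc: "ev (\<lambda>p. on_curve E (\<xi> p) (\<eta> p))"
      using XY(3) ev_points by eventually_elim (metis Affine_in_points mult_pt_closed)
    have rX: "rat (\<lambda>p. \<xi> p - xc p)" and rY: "rat (\<lambda>p. \<eta> p + yc p)" by (intro rat_intros XY)+
    from rat_cases[OF rX] show ?thesis
    proof
      assume eqx: "ev (\<lambda>p. \<xi> p - xc p = 0)"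
      from rat_cases[OF rY] show ?thesis
      proof
        assume "ev (\<lambda>p. \<eta> p + yc p = 0)"
        with eqx XY(3) ev_affine have "ev (\<lambda>p. mult_pt E (Suc n) p = Infinity)"
        proof eventually_elim
          case (elim p)
          then have "mult_pt E n p = neg p" by (auto simp: eq_neg_iff_add_eq_0)
          then show ?case by (simp add: mult_pt_Suc)
        qed
        then show ?thesis using not_ev_torsion[of "Suc n"] Suc(2)[of "Suc n"] by blast
      next
        assume "rfun (\<lambda>p. \<eta> p + yc p)"
        then have nz: "ev (\<lambda>p. \<eta> p + yc p \<noteq> 0)" by (simp add: rfun_def)
        define l where "l = (\<lambda>p. (3 * xc p ^ 2 + 2 * wa2 E * xc p + wa4 E) / (2 * yc p))"
        define x' where "x' = (\<lambda>p. l p ^ 2 - wa2 E - xc p - xc p)"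
        have l: "rat l" unfolding l_def by (intro rat_intros)
        have x': "rat x'" unfolding x'_def by (intro rat_intros l)
        have y': "rat (\<lambda>p. - l p * x' p - (yc p - l p * xc p))" by (intro rat_intros l x')
        have "ev (\<lambda>p. mult_pt E (Suc n) p = Affine (x' p) (- l p * x' p - (yc p - l p * xc p)))"
          using eqx nz XY(3) oc ev_affine
        proof eventually_elim
          case (elim p)
          then obtain x y where p: "p = Affine x y" "on_curve E x y" by blast
          have \<xi>: "\<xi> p = x" using elim(1) p by simp
          have "\<eta> p ^ 2 = y ^ 2" using elim(4) p \<xi> by (simp add: on_curve_iff)
          then have \<eta>: "\<eta> p = y" using elim(2) p by (auto simp: power2_eq_iff)
          have "y + y \<noteq> 0" using elim(2) \<eta> p by simp
          then show ?case using elim(3) \<xi> \<eta> p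
            by (simp add: mult_pt_Suc add_pt.simps(3) a1 a3 l_def x'_def Let_def)
        qed
        then show ?thesis using x' y' by blast
      qed
    next
      assume "rfun (\<lambda>p. \<xi> p - xc p)"
      then have nz: "ev (\<lambda>p. \<xi> p - xc p \<noteq> 0)" by (simp add: rfun_def)
      define l where "l = (\<lambda>p. (\<eta> p - yc p) / (\<xi> p - xc p))"
      define x' where "x' = (\<lambda>p. l p ^ 2 - wa2 E - xc p - \<xi> p)"
      have l: "rat l" unfolding l_def by (intro rat_intros XY)
      have x': "rat x'" unfolding x'_def by (intro rat_intros l XY)
      have y': "rat (\<lambda>p. - l p * x' p - (yc p - l p * xc p))" by (intro rat_intros l x')
      have "ev (\<lambda>p. mult_pt E (Suc n) p = Affine (x' p) (- l p * x' p - (yc p - l p * xc p)))"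
        using nz XY(3) ev_affine
        by eventually_elim (auto simp: mult_pt_Suc add_pt.simps(3) a1 a3 l_def x'_def Let_def)
      then show ?thesis using x' y' by blast
    qed
  qed
qed simp

text \<open>The abscissa of n p is nonconstant and so takes almost every value. As the image is
  closed under negation, it contains almost all points, and it is a subgroup.\<close>

lemma mult_pt_surj:
  assumes H: "\<And>k. 0 < k \<Longrightarrow> k \<le> n \<Longrightarrow> \<exists>P\<in>points E. mult_pt E k P \<noteq> Infinity" and n: "0 < n"
    and Q: "Q \<in> points E"
  obtains P where "P \<in> points E" "mult_pt E n P = Q"
proof -
  obtain \<xi> \<eta> where XY: "rat \<xi>" "rat \<eta>" "ev (\<lambda>p. mult_pt E n p = Affine (\<xi> p) (\<eta> p))"
    using mult_pt_rational[OF H n] by blast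
  have oc: "ev (\<lambda>p. on_curve E (\<xi> p) (\<eta> p))"
    using XY(3) ev_points by eventually_elim (metis Affine_in_points mult_pt_closed)
  have nc: "\<not> ev (\<lambda>p. \<xi> p = c)" for c
  proof
    \<comment> \<open>A constant abscissa leaves two candidates for n p, hence generically a single
      point R; translating by P with n P \<noteq> O would give R = R + n P.\<close>
    assume c: "ev (\<lambda>p. \<xi> p = c)"
    obtain d where d: "on_curve E c d" using sqrt_f_exists by blast
    have e2: "ev (\<lambda>p. \<eta> p = d \<or> \<eta> p = - d)"
      using oc c 
    proof eventually_elim
      case (elim p)
      then have "\<eta> p ^ 2 = d ^ 2" using d by (simp add: on_curve_iff)
      then show ?case by (simp add: power2_eq_iff)
    qed
    have "rat (\<lambda>p. \<eta> p - d)" by (intro rat_intros XY)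
    from rat_cases[OF this] have "ev (\<lambda>p. \<eta> p = d) \<or> ev (\<lambda>p. \<eta> p = - d)"
    proof
      assume "ev (\<lambda>p. \<eta> p - d = 0)"
      then show ?thesis by simp
    next
      assume "rfun (\<lambda>p. \<eta> p - d)"
      then have "ev (\<lambda>p. \<eta> p - d \<noteq> 0)" by (simp add: rfun_def)
      with e2 have "ev (\<lambda>p. \<eta> p = - d)" by eventually_elim auto
      then show ?thesis ..
    qed
    then obtain R where R: "ev (\<lambda>p. mult_pt E n p = R)"
    proof
      assume "ev (\<lambda>p. \<eta> p = d)"
      with c XY(3) have "ev (\<lambda>p. mult_pt E n p = Affine c d)" by eventually_elim simp
      then show ?thesis using that by blast
    next
      assume "ev (\<lambda>p. \<eta> p = - d)"
      with c XY(3) have "ev (\<lambda>p. mult_pt E n p = Affine c (- d))" by eventually_elim simp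
      then show ?thesis using that by blast
    qed
    obtain P where P: "P \<in> points E" "mult_pt E n P \<noteq> Infinity" using H[of n] n by blast
    have "ev (\<lambda>p. p \<in> points E \<and> mult_pt E n p = R \<and> mult_pt E n (p \<uplus> P) = R)"
      using ev_points R ev_trans[OF P(1) R] by eventually_elim simp
    then obtain p where "p \<in> points E" "mult_pt E n p = R" "mult_pt E n (p \<uplus> P) = R"
      using ev_ex by blast
    then have "Infinity \<uplus> R = mult_pt E n P \<uplus> R"
      using P(1) by (metis add_comm mult_pt_closed mult_pt_distrib add_pt.simps(1))
    moreover have "R \<in> points E" using \<open>p \<in> points E\<close> \<open>mult_pt E n p = R\<close> by auto
    ultimately show False using P add_cancel_right[of Infinity "mult_pt E n P" R] by auto
  qed
  define T where "T = {c. \<not> (\<exists>p\<in>points E. mult_pt E n p = Affine (\<xi> p) (\<eta> p) \<and> \<xi> p = c)}"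
  have T: "finite T" unfolding T_def by (rule rational_image_cofinite[OF XY(1) nc XY(3)])
  define G where "G = mult_pt E n ` points E"
  have "Q \<in> G"
  proof (rule cofinite_subgroup[OF _ _ Q])
    fix A B assume "A \<in> G" "B \<in> G"
    then obtain A' B' where "A' \<in> points E" "B' \<in> points E" "A = mult_pt E n A'" "B = mult_pt E n B'"
      by (auto simp: G_def)
    then have "A \<uplus> neg B = mult_pt E n (A' \<uplus> neg B')" "A' \<uplus> neg B' \<in> points E"
      by (auto simp: mult_pt_distrib mult_pt_neg)
    then show "A \<uplus> neg B \<in> G" by (auto simp: G_def)
  next
    have "ev (\<lambda>p. p \<notin> {Affine x y | x y. on_curve E x y \<and> x \<in> T})"
      by (intro ev_notin_finite finite_points_over T)
    with ev_affine show "ev (\<lambda>p. p \<in> G)"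
    proof eventually_elim
      case (elim p)
      then obtain x y where p: "p = Affine x y" "on_curve E x y" "x \<notin> T" by auto
      then obtain q where q: "q \<in> points E" "mult_pt E n q = Affine x (\<eta> q)"
        by (auto simp: T_def)
      then have "on_curve E x (\<eta> q)" by (metis Affine_in_points mult_pt_closed)
      then have "y ^ 2 = \<eta> q ^ 2" using p by (simp add: on_curve_iff)
      then have "y = \<eta> q \<or> y = - \<eta> q" by (simp add: power2_eq_iff)
      then have "p = mult_pt E n q \<or> p = mult_pt E n (neg q)"
        using p q by (auto simp: mult_pt_neg)
      then show ?case using q(1) by (auto simp: G_def)
    qed
  qed
  then show ?thesis using that by (auto simp: G_def)
qed

end

section \<open>Evaluation of polynomials in x and y\<close>

lemma eval2_pCons: "eval2 (pCons c u) x y = poly c x + y * eval2 u x y"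
  by (simp add: eval2_def)

lemma eval2_0 [simp]: "eval2 0 x y = 0"
  by (simp add: eval2_def)

lemma eval2_add: "eval2 (u + v) x y = eval2 u x y + eval2 v x y"
  by (simp add: eval2_def)

lemma eval2_diff: "eval2 (u - v) x y = eval2 u x y - eval2 v x y"
  by (simp add: eval2_def)

lemma eval2_mult: "eval2 (u * v) x y = eval2 u x y * eval2 v x y"
  by (simp add: eval2_def)

lemma eval2_power: "eval2 (u ^ n) x y = eval2 u x y ^ n"
  by (simp add: eval2_def poly_power)

lemma eval2_sum: "eval2 (\<Sum>i\<in>I. u i) x y = (\<Sum>i\<in>I. eval2 (u i) x y)"
  by (induction I rule: infinite_finite_induct) (auto simp: eval2_add)

context weierstrass_curve begin

subsection \<open>Comparison with orders defined by powers of the maximal ideal\<close>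

lemma weierstrass_poly_eq: "weierstrass_poly E = [:-f, 0, 1:]"
  by (simp add: weierstrass_poly_def f_def a1 a3)

lemma eval2_weierstrass: "on_curve E x y \<Longrightarrow> eval2 (weierstrass_poly E) x y = 0"
  by (simp add: weierstrass_poly_eq eval2_def on_curve_iff power2_eq_square)

fun ef :: "'a poly poly \<Rightarrow> 'a point \<Rightarrow> 'a" where
  "ef u Infinity = 0"
| "ef u (Affine x y) = eval2 u x y"

lemma isreg_ef [isreg_intros]: "isreg (ef u)"
proof (induction u)
  case 0
  show ?case by (rule isregI[of _ 0 0]) simp
next
  case (pCons c u)
  from pCons(2) obtain A B where AB: "\<And>x y. on_curve E x y \<Longrightarrow> ef u (Affine x y) = reg A B (Affine x y)"
    unfolding isreg_def by blast
  show ?case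
  proof (rule isregI[of _ "c + f * B" A])
    fix x y assume oc: "on_curve E x y"
    have "y * y = poly f x" using oc by (simp add: on_curve_iff power2_eq_square)
    then show "ef (pCons c u) (Affine x y) = reg (c + f * B) A (Affine x y)"
      using AB[OF oc] by (simp add: eval2_pCons algebra_simps flip: \<open>y * y = poly f x\<close>)
  qed
qed

text \<open>The Weierstrass polynomial is monic in y, so pseudo-division scales by 1 and its
  remainder A + B y is a true remainder.\<close>

lemma weierstrass_dvd_diff_pseudo_mod:
  "weierstrass_poly E dvd u - pseudo_mod u (weierstrass_poly E)"
    "degree (pseudo_mod u (weierstrass_poly E)) < 2"
proof -
  let ?W = "weierstrass_poly E"
  have W: "?W \<noteq> 0" "degree ?W = 2" "coeff ?W (degree ?W) = 1" by (simp_all add: weierstrass_poly_eq)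
  obtain q r where qr: "pseudo_divmod u ?W = (q, r)" by fastforce
  then have r: "pseudo_mod u ?W = r" by (simp add: pseudo_mod_def)
  from pseudo_divmod[OF W(1) qr] W(3) have "u = ?W * q + r" and d: "r = 0 \<or> degree r < degree ?W"
    by auto
  then have "u - r = ?W * q" by simp
  then show "?W dvd u - pseudo_mod u ?W" unfolding r by simp
  show "degree (pseudo_mod u ?W) < 2" unfolding r using d W(2) by auto
qed

lemma ef_eq_reg:
  fixes u :: "'a poly poly"
  assumes "on_curve E x y"
  defines "r \<equiv> pseudo_mod u (weierstrass_poly E)"
  shows "ef u (Affine x y) = reg (coeff r 0) (coeff r 1) (Affine x y)"
proof -
  obtain q where q: "u - r = weierstrass_poly E * q"
    using weierstrass_dvd_diff_pseudo_mod(1)[of u] unfolding r_def by (elim dvdE)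
  have "eval2 (u - r) x y = 0" unfolding q eval2_mult eval2_weierstrass[OF assms(1)] by simp
  then have "eval2 u x y = eval2 r x y" by (simp add: eval2_diff)
  also have "r = [:coeff r 0, coeff r 1:]"
    using weierstrass_dvd_diff_pseudo_mod(2)[of u] unfolding r_def[symmetric]
    by (intro poly_eqI) (auto simp: coeff_pCons coeff_eq_0 split: nat.splits)
  then have "eval2 r x y = reg (coeff r 0) (coeff r 1) (Affine x y)"
    by (metis eval2_0 eval2_pCons reg.simps(2) mult.commute mult_zero_right add_0_right)
  finally show ?thesis by simp
qed

text \<open>The Nullstellensatz for this curve: a remainder A + B y vanishing at all points has A =
  B = 0.\<close>

lemma weierstrass_dvd_iff:
  "weierstrass_poly E dvd u \<longleftrightarrow> (\<forall>x y. on_curve E x y \<longrightarrow> ef u (Affine x y) = 0)"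
proof
  assume "weierstrass_poly E dvd u"
  then show "\<forall>x y. on_curve E x y \<longrightarrow> ef u (Affine x y) = 0"
    by (auto elim!: dvdE simp: eval2_mult eval2_weierstrass)
next
  assume *: "\<forall>x y. on_curve E x y \<longrightarrow> ef u (Affine x y) = 0"
  define r where "r = pseudo_mod u (weierstrass_poly E)"
  have "coeff r 0 = 0 \<and> coeff r 1 = 0"
  proof (rule ccontr)
    assume "\<not> ?thesis"
    then have "ev (\<lambda>p. reg (coeff r 0) (coeff r 1) p \<noteq> 0)" by (intro ev_reg_neq_0) auto
    with ev_affine have "ev (\<lambda>p. False)"
      by eventually_elim (use * ef_eq_reg[of _ _ u, folded r_def] in auto)
    then show False by simp
  qed
  then have "r = 0"
    using weierstrass_dvd_diff_pseudo_mod(2)[of u] unfolding r_def[symmetric]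
    by (intro poly_eqI) (metis coeff_0 coeff_eq_0 less_2_cases not_less_eq linorder_not_less less_le_trans One_nat_def)
  then show "weierstrass_poly E dvd u"
    using weierstrass_dvd_diff_pseudo_mod(1)[of u] unfolding r_def[symmetric] by simp
qed

lemma nonzero_on_iff: "nonzero_on E u \<longleftrightarrow> rfun (ef u)"
proof
  assume "nonzero_on E u"
  then obtain x y where "on_curve E x y" "ef u (Affine x y) \<noteq> 0"
    unfolding nonzero_on_def weierstrass_dvd_iff by blast
  then show "rfun (ef u)" using isreg_ev_neq_0[OF isreg_ef] rfun_isreg[OF isreg_ef] by blast
next
  assume "rfun (ef u)"
  then have "ev (\<lambda>p. ef u p \<noteq> 0)" by (simp add: rfun_def)
  then show "nonzero_on E u" unfolding nonzero_on_def weierstrass_dvd_iff using ev_ex by blast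
qed

lemma ord_at_Infinity:
  assumes "rfun (ef u)" shows "ord_at E Infinity u = ord Infinity (ef u)"
proof -
  define r where "r = pseudo_mod u (weierstrass_poly E)"
  have e: "ev (\<lambda>p. ef u p = reg (coeff r 0) (coeff r 1) p)"
    unfolding r_def by (intro ev_affineI ef_eq_reg)
  have nz: "coeff r 0 \<noteq> 0 \<or> coeff r 1 \<noteq> 0"
  proof (rule ccontr)
    assume "\<not> ?thesis"
    then have z: "coeff r 0 = 0" "coeff r 1 = 0" by auto
    from assms have "ev (\<lambda>p. ef u p \<noteq> 0)" by (simp add: rfun_def)
    with e ev_affine have "ev (\<lambda>p. False)" by eventually_elim (auto simp: z z[unfolded One_nat_def])
    then show False by simp
  qed
  show ?thesis
    using ord_cong[OF Infinity_in_points assms e] ord_Infinity_reg[OF nz] degree_nrm(2)[OF nz]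
    by (simp add: Let_def r_def)
qed

lemma vge_power: "P \<in> points E \<Longrightarrow> vge (ord P) 1 h \<Longrightarrow> vge (ord P) (int n) (\<lambda>p. h p ^ n)"
proof (induction n)
  case 0
  then show ?case using vge_const[OF valuation_ord] by simp
next
  case (Suc n)
  then show ?case using vge_mult[OF valuation_ord Suc(3), of "int n" "\<lambda>p. h p ^ n"] by simp
qed

lemma vge_sum: "finite I \<Longrightarrow> P \<in> points E \<Longrightarrow> (\<And>i. i \<in> I \<Longrightarrow> vge (ord P) (int n) (h i)) \<Longrightarrow>
    vge (ord P) (int n) (\<lambda>p. \<Sum>i\<in>I. h i p)"
proof (induction I rule: finite_induct)
  case empty
  then show ?case by (auto simp: vge_def rfun_def intro: rat_intros)
next
  case (insert i I)
  then show ?case using vge_add[OF valuation_ord, of P "int n" "h i"] by simp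
qed

lemma vge_isreg: "on_curve E x y \<Longrightarrow> isreg h \<Longrightarrow> vge (ord (Affine x y)) 0 h"
  using ord_isreg_nonneg by (auto simp: vge_def rfun_def isreg_rat)

lemma vge_isreg_zero:
  assumes "on_curve E x y" "isreg h" "h (Affine x y) = 0"
  shows "vge (ord (Affine x y)) 1 h"
  using ord_isreg_pos_iff[OF assms(1,2)] assms by (fastforce simp: vge_def rfun_def isreg_rat)

text \<open>The products (x - a)^i (y - b)^(n - i) have order at least n. Conversely s u = t \<pi>^N
  with N \<ge> n, where s is the localisation denominator and \<pi> is itself x - a or y -
  b.\<close>

lemma in_max_ideal_power_iff:
  assumes oc: "on_curve E a b" and u: "rfun (ef u)"
  shows "in_max_ideal_power E a b n u \<longleftrightarrow> int n \<le> ord (Affine a b) (ef u)"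
proof
  have P: "Affine a b \<in> points E" using oc by simp
  assume "in_max_ideal_power E a b n u"
  then obtain s h c where s: "eval2 s a b \<noteq> 0" and eq: "s * u = h * weierstrass_poly E +
      (\<Sum>i\<le>n. c i * [:[:- a, 1:]:] ^ i * [:[:- b:], 1:] ^ (n - i))"
    unfolding in_max_ideal_power_def by blast
  have "vge (ord (Affine a b)) (int n) (\<lambda>p. \<Sum>i\<le>n. ef (c i) p * (xc p - a) ^ i * (yc p - b) ^ (n - i))"
  proof (rule vge_sum[OF _ P])
    fix i assume "i \<in> {..n}"
    then have n: "0 + int i + int (n - i) = int n" by simp
    have vx: "vge (ord (Affine a b)) 1 (\<lambda>p. xc p - a)" and vy: "vge (ord (Affine a b)) 1 (\<lambda>p. yc p - b)"
      using vge_isreg_zero[OF oc isreg_diff[OF isreg_xc isreg_const[of a]]]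
        vge_isreg_zero[OF oc isreg_diff[OF isreg_yc isreg_const[of b]]] by simp_all
    have "vge (ord (Affine a b)) (0 + int i + int (n - i))
        (\<lambda>p. ef (c i) p * (xc p - a) ^ i * (yc p - b) ^ (n - i))"
      using vge_mult[OF valuation_ord[OF P] vge_mult[OF valuation_ord[OF P] vge_isreg[OF oc isreg_ef[of "c i"]]
        vge_power[OF P vx, of i]] vge_power[OF P vy, of "n - i"]] .
    then show "vge (ord (Affine a b)) (int n) (\<lambda>p. ef (c i) p * (xc p - a) ^ i * (yc p - b) ^ (n - i))"
      unfolding n .
  qed simp
  moreover have e: "ev (\<lambda>p. (\<Sum>i\<le>n. ef (c i) p * (xc p - a) ^ i * (yc p - b) ^ (n - i)) = ef s p * ef u p)"
  proof (rule ev_affineI)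
    fix x y assume xy: "on_curve E x y"
    have "eval2 s x y * eval2 u x y = eval2 (s * u) x y" by (simp add: eval2_mult)
    also have "\<dots> = (\<Sum>i\<le>n. eval2 (c i) x y * (x - a) ^ i * (y - b) ^ (n - i))"
      unfolding eq by (simp add: eval2_add eval2_mult eval2_weierstrass[OF xy] eval2_sum eval2_power eval2_pCons)
    finally show "(\<Sum>i\<le>n. ef (c i) (Affine x y) * (xc (Affine x y) - a) ^ i * (yc (Affine x y) - b) ^ (n - i)) =
        ef s (Affine x y) * ef u (Affine x y)" by simp
  qed
  ultimately have "vge (ord (Affine a b)) (int n) (\<lambda>p. ef s p * ef u p)"
    by (rule vge_cong[OF valuation_ord[OF P]])
  moreover have s': "rfun (ef s)" using rfun_isreg[OF isreg_ef isreg_ev_neq_0[OF isreg_ef oc]] s by simp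
  moreover have "ord (Affine a b) (ef s) = 0" using ord_isreg_eq_0[OF oc isreg_ef] s by simp
  ultimately show "int n \<le> ord (Affine a b) (ef u)"
    using ord_mult[OF P s' u] rfun_mult[OF s' u] by (simp add: vge_def)
next
  have P: "Affine a b \<in> points E" using oc by simp
  assume n: "int n \<le> ord (Affine a b) (ef u)"
  define N where "N = nat (ord (Affine a b) (ef u))"
  have N: "ord (Affine a b) (ef u) = int N" "n \<le> N" using n by (auto simp: N_def)
  obtain s t where st: "isreg s" "isreg t" "s (Affine a b) \<noteq> 0" "t (Affine a b) \<noteq> 0"
      "ev (\<lambda>p. s p * ef u p = t p * unif (Affine a b) p ^ N)"
    using has_ord_ord[OF P u] unfolding N has_ord.simps power_int_of_nat by blast
  have poly: "\<exists>w. \<forall>x y. on_curve E x y \<longrightarrow> eval2 w x y = h (Affine x y)" if h: "isreg h" for h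
  proof -
    from h obtain A B where "\<And>x y. on_curve E x y \<Longrightarrow> h (Affine x y) = reg A B (Affine x y)"
      unfolding isreg_def by blast
    then show ?thesis by (intro exI[of _ "[:A, B:]"]) (simp add: eval2_pCons mult.commute)
  qed
  obtain s' where s': "\<And>x y. on_curve E x y \<Longrightarrow> eval2 s' x y = s (Affine x y)" using poly[OF st(1)] by blast
  obtain t' where t': "\<And>x y. on_curve E x y \<Longrightarrow> eval2 t' x y = t (Affine x y)" using poly[OF st(2)] by blast
  define X1 where "X1 = ([:[:- a, 1:]:] :: 'a poly poly)"
  define Y1 where "Y1 = ([:[:- b:], 1:] :: 'a poly poly)"
  define U1 where "U1 = (if b = 0 then Y1 else X1)"
  have U1: "eval2 U1 x y = unif (Affine a b) (Affine x y)" for x y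
    by (simp add: U1_def X1_def Y1_def eval2_pCons)
  \<comment> \<open>A single index contributes: i = 0 selects (y - b)^n when the parameter is y, and
    i = n selects (x - a)^n otherwise.\<close>
  define c where "c = (\<lambda>i. if i = (if b = 0 then 0 else n) then t' * U1 ^ (N - n) else 0)"
  have "(\<Sum>i\<le>n. c i * X1 ^ i * Y1 ^ (n - i)) =
      (\<Sum>i\<le>n. if i = (if b = 0 then 0 else n) then t' * U1 ^ (N - n) * X1 ^ i * Y1 ^ (n - i) else 0)"
    by (rule sum.cong) (auto simp: c_def)
  also have "\<dots> = t' * U1 ^ (N - n) * U1 ^ n"
    by (subst sum.delta) (auto simp: U1_def)
  also have "\<dots> = t' * U1 ^ N" using N(2) by (simp add: mult.assoc flip: power_add)
  finally have sum: "(\<Sum>i\<le>n. c i * X1 ^ i * Y1 ^ (n - i)) = t' * U1 ^ N" .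
  have "weierstrass_poly E dvd s' * u - t' * U1 ^ N"
    unfolding weierstrass_dvd_iff
  proof (intro allI impI)
    fix x y assume xy: "on_curve E x y"
    have "s (Affine x y) * ef u (Affine x y) = t (Affine x y) * unif (Affine a b) (Affine x y) ^ N"
      by (rule isreg_ev_eqD[OF _ _ st(5) xy]) (intro isreg_intros st)+
    then show "ef (s' * u - t' * U1 ^ N) (Affine x y) = 0"
      by (simp add: eval2_diff eval2_mult eval2_power U1 s'[OF xy] t'[OF xy] del: unif.simps)
  qed
  then obtain h where "s' * u - t' * U1 ^ N = weierstrass_poly E * h" by (elim dvdE)
  then have "s' * u = h * weierstrass_poly E + (\<Sum>i\<le>n. c i * X1 ^ i * Y1 ^ (n - i))"
    unfolding sum by (simp add: algebra_simps diff_eq_eq)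
  moreover have "eval2 s' a b \<noteq> 0" using s'[OF oc] st(3) by simp
  ultimately show "in_max_ideal_power E a b n u"
    unfolding in_max_ideal_power_def X1_def Y1_def by blast
qed

lemma ord_at_eq:
  assumes P: "P \<in> points E" and u: "rfun (ef u)" shows "ord_at E P u = ord P (ef u)"
  using P
proof (cases rule: points_cases)
  case 1
  then show ?thesis using ord_at_Infinity[OF u] by simp
next
  case (2 a b)
  define N where "N = nat (ord P (ef u))"
  have N: "ord P (ef u) = int N"
    using ord_isreg_nonneg[OF 2(2) isreg_ef] u 2 by (simp add: N_def rfun_def)
  have "(GREATEST n. in_max_ideal_power E a b n u) = N"
    using N 2 by (intro Greatest_equality) (auto simp: in_max_ideal_power_iff[OF 2(2) u])
  then show ?thesis using 2 N by simp
qed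

lemma has_divisor_iff:
  "has_divisor E u v D \<longleftrightarrow> rfun (ef u) \<and> rfun (ef v) \<and> (\<forall>P\<in>points E. ord P (\<lambda>p. ef u p / ef v p) = D P)"
  unfolding has_divisor_def nonzero_on_iff by (auto simp: ord_at_eq ord_divide)

lemma rfun_ef_obtain:
  assumes "rfun g"
  obtains u v where "rfun (ef u)" "rfun (ef v)" "ev (\<lambda>p. g p = ef u p / ef v p)"
proof -
  obtain A B C D where 1: "A \<noteq> 0 \<or> B \<noteq> 0" "C \<noteq> 0 \<or> D \<noteq> 0" "ev (\<lambda>p. g p = reg A B p / reg C D p)"
    using assms(1) by (rule rfun_obtain)
  have *: "ef [:A, B:] p = reg A B p" for A B p by (cases p) (auto simp: eval2_pCons mult.commute)
  then have "ef [:A, B:] = reg A B" for A B by (rule ext)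
  then show ?thesis using that[of "[:A, B:]" "[:C, D:]"] 1 rfun_reg by simp
qed

end

subsection \<open>The Weil pairing\<close>

locale weil = weierstrass_curve +
  fixes m :: nat and P1 P2 :: "'a point"
  assumes m: "m \<ge> 2" and basis: "torsion_basis E m P1 P2"
begin

abbreviation tors :: "'a point set" where
  "tors \<equiv> torsion E m"

abbreviation mm :: "'a point \<Rightarrow> 'a point" where
  "mm \<equiv> mult_pt E m"

lemma tors_iff: "P \<in> tors \<longleftrightarrow> P \<in> points E \<and> mm P = Infinity"
  by (simp add: torsion_def)

lemma tors_points: "P \<in> tors \<Longrightarrow> P \<in> points E"
  by (simp add: tors_iff)

lemma tors_add: "P \<in> tors \<Longrightarrow> Q \<in> tors \<Longrightarrow> P \<uplus> Q \<in> tors"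
  by (simp add: tors_iff mult_pt_distrib)

lemma tors_neg: "P \<in> tors \<Longrightarrow> neg P \<in> tors"
  by (simp add: tors_iff mult_pt_neg)

lemma Infinity_tors: "Infinity \<in> tors"
  by (simp add: tors_iff)

lemma tors_mult: "P \<in> tors \<Longrightarrow> mult_pt E n P \<in> tors"
  by (induction n) (auto simp: mult_pt_Suc tors_add Infinity_tors)

lemma P12: "P1 \<in> tors" "P2 \<in> tors"
  using basis by (auto simp: torsion_basis_def)

lemma independent: "mult_pt E a P1 \<uplus> mult_pt E b P2 = Infinity \<Longrightarrow> m dvd a \<and> m dvd b"
  using basis by (auto simp: torsion_basis_def)

lemma generating: "R \<in> tors \<Longrightarrow> \<exists>a b. R = mult_pt E a P1 \<uplus> mult_pt E b P2"
  using basis by (auto simp: torsion_basis_def)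

lemma mult_mod: assumes "P \<in> tors" shows "mult_pt E n P = mult_pt E (n mod m) P"
proof -
  have "mult_pt E (n div m * m + n mod m) P = mult_pt E (n div m) (mm P) \<uplus> mult_pt E (n mod m) P"
    using assms by (subst mult_pt_add) (auto simp: tors_points mult_pt_mult)
  then show ?thesis using assms by (simp add: tors_iff)
qed

text \<open>The order m^2 of E[m] is read off the basis: coefficients may be reduced modulo m, and
  the residues are unique.\<close>

lemma tors_bij:
  "bij_betw (\<lambda>(a, b). mult_pt E a P1 \<uplus> mult_pt E b P2) ({..<m} \<times> {..<m}) tors"
proof (rule bij_betwI')
  have P: "P1 \<in> points E" "P2 \<in> points E" using P12 by (auto simp: tors_iff)
  have *: "a = a' \<and> b = b'" if lt: "a < m" "b < m" "a' < m" "b' < m"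
    and eq: "mult_pt E a P1 \<uplus> mult_pt E b P2 = mult_pt E a' P1 \<uplus> mult_pt E b' P2" for a b a' b'
  proof -
    \<comment> \<open>Coefficients are natural numbers, so a' is subtracted by adding m -
      a'.\<close>
    have "mult_pt E (a + (m - a')) P1 \<uplus> mult_pt E (b + (m - b')) P2 =
        mult_pt E a P1 \<uplus> mult_pt E b P2 \<uplus> (mult_pt E (m - a') P1 \<uplus> mult_pt E (m - b') P2)"
      using P by (simp add: mult_pt_add add_ac)
    also have "\<dots> = mult_pt E (a' + (m - a')) P1 \<uplus> mult_pt E (b' + (m - b')) P2"
      unfolding eq using P by (simp add: mult_pt_add add_ac)
    also have "\<dots> = Infinity" using lt P12 by (simp add: tors_iff)
    finally have "m dvd a + (m - a')" "m dvd b + (m - b')" using independent by blast+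
    moreover have "x = y" if dvd: "m dvd x + (m - y)" and lt: "x < m" "y < m" for x y
    proof -
      obtain k where k: "x + (m - y) = m * k" using dvd by (elim dvdE)
      have "m * k < m * 2" "m * 0 < m * k" using k lt by linarith+
      then have "k = 1" by (simp only: nat_mult_less_cancel_disj) linarith
      then have "x + (m - y) = m" using k by simp
      then show ?thesis using lt by simp
    qed
    ultimately show ?thesis using lt by blast
  qed
  fix x y assume "x \<in> {..<m} \<times> {..<m}" "y \<in> {..<m} \<times> {..<m}"
  then show "((case x of (a, b) \<Rightarrow> mult_pt E a P1 \<uplus> mult_pt E b P2) =
      (case y of (a, b) \<Rightarrow> mult_pt E a P1 \<uplus> mult_pt E b P2)) = (x = y)"
    using * by (auto split: prod.splits)
next
  fix x assume "x \<in> {..<m} \<times> {..<m}"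
  then show "(case x of (a, b) \<Rightarrow> mult_pt E a P1 \<uplus> mult_pt E b P2) \<in> tors"
    by (auto intro: tors_add tors_mult P12)
next
  fix R assume "R \<in> tors"
  then obtain a b where "R = mult_pt E a P1 \<uplus> mult_pt E b P2" using generating by blast
  then have "R = mult_pt E (a mod m) P1 \<uplus> mult_pt E (b mod m) P2"
    using mult_mod P12 by metis
  then show "\<exists>x\<in>{..<m} \<times> {..<m}. R = (case x of (a, b) \<Rightarrow> mult_pt E a P1 \<uplus> mult_pt E b P2)"
    using m by (intro bexI[of _ "(a mod m, b mod m)"]) auto
qed

lemma finite_tors: "finite tors"
  using bij_betw_finite[OF tors_bij] by simp

lemma card_tors: "card tors = m * m"
  using bij_betw_same_card[OF tors_bij] by simp

text \<open>Input for the surjectivity of multiplication by m: m itself does not kill all points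
  because E[m] is finite, and smaller k do not kill P1.\<close>

lemma mult_not_all_zero:
  assumes "0 < k" "k \<le> m" shows "\<exists>P\<in>points E. mult_pt E k P \<noteq> Infinity"
proof (cases "k = m")
  case True
  have "\<not> points E \<subseteq> tors" using finite_tors infinite_points finite_subset by blast
  then show ?thesis using True by (auto simp: tors_iff)
next
  case False
  have "mult_pt E k P1 \<noteq> Infinity"
  proof
    assume "mult_pt E k P1 = Infinity"
    then have "m dvd k" using independent[of k 0] by simp
    then show False using assms False by (auto dest: dvd_imp_le)
  qed
  then show ?thesis using P12 tors_points by blast
qed

lemma mm_surj: assumes "Q \<in> points E" obtains P where "P \<in> points E" "mm P = Q"
  by (rule mult_pt_surj[of m Q]) (use mult_not_all_zero m assms that in auto)

text \<open>The closed form of the divisor of \<open>g\<close>: a point \<open>P\<close> lies in the coset \<open>T' + E[m]\<close> if and only if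
  \<open>m P = m T'\<close>.\<close>

definition wd :: "'a point \<Rightarrow> 'a point \<Rightarrow> int" where
  "wd T P = of_bool (mm P = T) - of_bool (mm P = Infinity)"

lemma mm_add_tors: "P \<in> points E \<Longrightarrow> S \<in> tors \<Longrightarrow> mm (P \<uplus> S) = mm P"
  by (simp add: mult_pt_distrib tors_iff)

lemma mm_eq_iff: "P \<in> points E \<Longrightarrow> Q \<in> points E \<Longrightarrow> mm P = mm Q \<longleftrightarrow> P \<uplus> neg Q \<in> tors"
  using neg_unique[of "mm P" "neg (mm Q)"]
  by (auto simp: tors_iff mult_pt_distrib mult_pt_neg)

lemma sum_coset:
  assumes "T' \<in> points E" "P \<in> points E"
  shows "(\<Sum>R\<in>tors. of_bool (P = T' \<uplus> R)) = (of_bool (mm P = mm T') :: int)"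
proof -
  have "P = T' \<uplus> R \<longleftrightarrow> R = P \<uplus> neg T'" if "R \<in> tors" for R
    using assms tors_points[OF that] by (metis add_comm add_neg_cancel(1) add_neg_cancel(2))
  then have "(\<Sum>R\<in>tors. of_bool (P = T' \<uplus> R)) = (\<Sum>R\<in>tors. if R = P \<uplus> neg T' then 1 else 0 :: int)"
    by (intro sum.cong) auto
  also have "\<dots> = of_bool (P \<uplus> neg T' \<in> tors)" using finite_tors by (simp add: sum.delta')
  finally show ?thesis using mm_eq_iff[OF assms(2,1)] by simp
qed

lemma sum_tors: "P \<in> points E \<Longrightarrow> (\<Sum>R\<in>tors. of_bool (P = R)) = (of_bool (mm P = Infinity) :: int)"
  using sum_coset[of Infinity P] by simp

lemma weil_divisor_eq:
  assumes "T' \<in> points E" "P \<in> points E" shows "weil_divisor E m T' P = wd (mm T') P"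
  using sum_coset[OF assms] sum_tors[OF assms(2)]
  by (simp add: weil_divisor_def wd_def sum_subtractf)

text \<open>The divisor is n (T) - (n T) - (n - 1) (O); the function is a product of those from
  \<open>add_function\<close>.\<close>

lemma multiple_function:
  assumes T: "T \<in> points E"
  shows "\<exists>h. rfun h \<and> (\<forall>R\<in>points E. ord R h =
    int n * (of_bool (R = T) - of_bool (R = Infinity)) - of_bool (R = mult_pt E n T) + of_bool (R = Infinity))"
proof (induction n)
  case 0
  then show ?case by (intro exI[of _ "\<lambda>p. 1"]) (auto simp: rfun_const ord_one)
next
  case (Suc n)
  then obtain h where h: "rfun h" "\<And>R. R \<in> points E \<Longrightarrow> ord R h = int n * (of_bool (R = T) - of_bool (R = Infinity))
      - of_bool (R = mult_pt E n T) + of_bool (R = Infinity)" by blast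
  obtain k where k: "rfun k" "\<And>R. R \<in> points E \<Longrightarrow> ord R k = of_bool (R = T) + of_bool (R = mult_pt E n T)
      - of_bool (R = mult_pt E (Suc n) T) - of_bool (R = Infinity)"
    using add_function(2)[OF T mult_pt_closed[OF T, of n]] unfolding mult_pt_Suc by blast
  have "ord R (\<lambda>p. h p * k p) = int (Suc n) * (of_bool (R = T) - of_bool (R = Infinity))
      - of_bool (R = mult_pt E (Suc n) T) + of_bool (R = Infinity)" if "R \<in> points E" for R
    using ord_mult[OF that h(1) k(1)] h(2)[OF that] k(2)[OF that] by (simp add: algebra_simps)
  then show ?case using rfun_mult[OF h(1) k(1)] by blast
qed

text \<open>For each R in E[m] there is a function with divisor (T') + (R) - (T' + R) - (O). Their
  product has the negated target divisor plus m^2 (T') - m^2 (O), and the latter is principal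
  because m^2 T' = m T = O.\<close>

lemma weil_function_exists:
  assumes T: "T \<in> tors"
  shows "\<exists>g. rfun g \<and> (\<forall>P\<in>points E. ord P g = wd T P)"
proof -
  obtain T' where T': "T' \<in> points E" "mm T' = T" using mm_surj tors_points[OF T] by blast
  have "\<exists>h. rfun h \<and> (\<forall>P\<in>points E. ord P h =
      of_bool (P = T') + of_bool (P = R) - of_bool (P = T' \<uplus> R) - of_bool (P = Infinity))"
    if "R \<in> tors" for R
    using add_function(2)[OF T'(1) tors_points[OF that]] .
  then obtain h where h: "\<And>R. R \<in> tors \<Longrightarrow> rfun (h R)"
    "\<And>R P. R \<in> tors \<Longrightarrow> P \<in> points E \<Longrightarrow> ord P (h R) =
      of_bool (P = T') + of_bool (P = R) - of_bool (P = T' \<uplus> R) - of_bool (P = Infinity)" by metis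
  obtain k where k: "rfun k" "\<And>R. R \<in> points E \<Longrightarrow> ord R k =
      int (m * m) * (of_bool (R = T') - of_bool (R = Infinity))
      - of_bool (R = mult_pt E (m * m) T') + of_bool (R = Infinity)"
    using multiple_function[OF T'(1), of "m * m"] by blast
  have z: "mult_pt E (m * m) T' = Infinity"
    using T T' by (simp add: mult_pt_mult tors_iff)
  define g where "g = (\<lambda>p. k p / (\<Prod>R\<in>tors. h R p))"
  have rp: "rfun (\<lambda>p. \<Prod>R\<in>tors. h R p)" using finite_tors h(1) by (rule rfun_prod)
  have "ord P g = wd T P" if P: "P \<in> points E" for P
  proof -
    have "ord P (\<lambda>p. \<Prod>R\<in>tors. h R p) = (\<Sum>R\<in>tors. ord P (h R))"
      by (rule ord_prod[OF finite_tors P h(1)])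
    also have "\<dots> = (\<Sum>R\<in>tors. (of_bool (P = T') - of_bool (P = Infinity)) + of_bool (P = R) - of_bool (P = T' \<uplus> R))"
      by (intro sum.cong) (auto simp: h(2) P)
    also have "\<dots> = int (m * m) * (of_bool (P = T') - of_bool (P = Infinity)) - wd T P"
      using sum_tors[OF P] sum_coset[OF T'(1) P]
      by (simp add: sum.distrib sum_subtractf card_tors wd_def T'(2) algebra_simps)
    finally show ?thesis
      unfolding g_def using ord_divide[OF P k(1) rp] k(2)[OF P] z by simp
  qed
  then show ?thesis using rfun_divide[OF k(1) rp] unfolding g_def by blast
qed

definition wfun :: "'a point \<Rightarrow> ('a point \<Rightarrow> 'a) \<Rightarrow> bool" where
  "wfun T g \<longleftrightarrow> rfun g \<and> (\<forall>P\<in>points E. ord P g = wd T P)"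

lemma wfun_proportional:
  assumes "wfun T g" "wfun T h" obtains c where "c \<noteq> 0" "ev (\<lambda>p. g p = c * h p)"
  using proportional_if_same_ord[of g h] assms unfolding wfun_def by auto

lemma wfun_trans: "wfun T g \<Longrightarrow> S \<in> tors \<Longrightarrow> wfun T (\<lambda>p. g (p \<uplus> S))"
  unfolding wfun_def using rfun_trans tors_points
  by (auto simp: ord_trans wd_def mm_add_tors)

lemma vge_trans_back:
  assumes P: "P \<in> points E" and S: "S \<in> points E" and h: "vge (ord (P \<uplus> S)) n h"
  shows "vge (ord P) n (\<lambda>p. h (p \<uplus> S))"
proof -
  have r: "rat h" using h by (simp add: vge_def)
  from rat_cases[OF r] show ?thesis
  proof
    assume "ev (\<lambda>p. h p = 0)"
    from ev_trans[OF S this] have "\<not> rfun (\<lambda>p. h (p \<uplus> S))"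
    proof (rule contrapos_pn)
      assume "rfun (\<lambda>p. h (p \<uplus> S))"
      then have "ev (\<lambda>p. h (p \<uplus> S) \<noteq> 0)" by (simp add: rfun_def)
      then show "\<not> ev (\<lambda>p. h (p \<uplus> S) = 0)"
        using eventually_conj[of "\<lambda>p. h (p \<uplus> S) \<noteq> 0" gen "\<lambda>p. h (p \<uplus> S) = 0"] by auto
    qed
    then show ?thesis using rat_trans[OF S r] by (simp add: vge_def)
  next
    assume "rfun h"
    then show ?thesis using ord_trans[OF P S] h rat_trans[OF S r] by (simp add: vge_def)
  qed
qed

lemma const_eq_0_if_vge:
  assumes "P \<in> points E" "vge (ord P) 1 (\<lambda>p. c)" shows "c = 0"
  using assms ord_const[of P c] rfun_const[of c] by (cases "c = 0") (auto simp: vge_def)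

text \<open>For existence a generic X serves. For uniqueness, any admissible k is a multiple of g,
  so k(p + S) = c k(p) generically. The given X need not be generic, so both sides are compared
  there through residues: a constant of positive order is 0.\<close>

lemma weil_pairing_eqI:
  assumes S: "S \<in> tors" and T: "T \<in> tors" and g: "wfun T g" and c: "ev (\<lambda>p. g (p \<uplus> S) = c * g p)"
  shows "weil_pairing E m S T = c"
  unfolding weil_pairing_def
proof (rule the_equality)
  have Sp: "S \<in> points E" using S by (rule tors_points)
  obtain T' where T': "T' \<in> points E" "mm T' = T" using mm_surj tors_points[OF T] by blast
  obtain u v where uv: "rfun (ef u)" "rfun (ef v)" "ev (\<lambda>p. g p = ef u p / ef v p)"
    using g rfun_ef_obtain unfolding wfun_def by blast
  have "has_divisor E u v (weil_divisor E m T')"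
    unfolding has_divisor_iff
  proof (intro conjI uv ballI)
    fix P assume P: "P \<in> points E"
    show "ord P (\<lambda>p. ef u p / ef v p) = weil_divisor E m T' P"
      using ord_cong[OF P _ uv(3)] g P weil_divisor_eq[OF T'(1) P] T'(2) by (simp add: wfun_def)
  qed
  moreover
  have nz: "ev (\<lambda>p. ef u p \<noteq> 0 \<and> ef v p \<noteq> 0)" using uv(1,2) unfolding rfun_def by (auto intro: eventually_conj)
  have "ev (\<lambda>p. ef u p \<noteq> 0 \<and> ef v p \<noteq> 0 \<and> ef u (p \<uplus> S) \<noteq> 0 \<and> ef v (p \<uplus> S) \<noteq> 0 \<and>
      (\<exists>x y. p \<uplus> S = Affine x y) \<and> c = (ef u (p \<uplus> S) / ef v (p \<uplus> S)) / (ef u p / ef v p))"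
    using nz ev_trans[OF Sp nz] ev_trans[OF Sp ev_affine] c uv(3) ev_trans[OF Sp uv(3)]
    by eventually_elim auto
  then obtain x y x' y' where "on_curve E x y" "ef u (Affine x y) \<noteq> 0" "ef v (Affine x y) \<noteq> 0"
    "ef u (Affine x y \<uplus> S) \<noteq> 0" "ef v (Affine x y \<uplus> S) \<noteq> 0" "Affine x y \<uplus> S = Affine x' y'"
    "c = (ef u (Affine x y \<uplus> S) / ef v (Affine x y \<uplus> S)) / (ef u (Affine x y) / ef v (Affine x y))"
    using ev_ex by blast
  ultimately show "\<exists>T' u v x y x' y'. T' \<in> points E \<and> mm T' = T \<and> has_divisor E u v (weil_divisor E m T') \<and>
      on_curve E x y \<and> Affine x y \<uplus> S = Affine x' y' \<and> eval2 u x y \<noteq> 0 \<and> eval2 v x y \<noteq> 0 \<and>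
      eval2 u x' y' \<noteq> 0 \<and> eval2 v x' y' \<noteq> 0 \<and> c = eval2 u x' y' / eval2 v x' y' / (eval2 u x y / eval2 v x y)"
    using T' by (rule_tac exI[of _ T'], rule_tac exI[of _ u], rule_tac exI[of _ v], rule_tac exI[of _ x],
      rule_tac exI[of _ y], rule_tac exI[of _ x'], rule_tac exI[of _ y']) simp
next
  have Sp: "S \<in> points E" using S by (rule tors_points)
  fix d assume "\<exists>T' u v x y x' y'. T' \<in> points E \<and> mm T' = T \<and> has_divisor E u v (weil_divisor E m T') \<and>
      on_curve E x y \<and> Affine x y \<uplus> S = Affine x' y' \<and> eval2 u x y \<noteq> 0 \<and> eval2 v x y \<noteq> 0 \<and>
      eval2 u x' y' \<noteq> 0 \<and> eval2 v x' y' \<noteq> 0 \<and> d = eval2 u x' y' / eval2 v x' y' / (eval2 u x y / eval2 v x y)"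
  then obtain T' u v x y x' y' where T': "T' \<in> points E" "mm T' = T"
    and div: "has_divisor E u v (weil_divisor E m T')"
    and xy: "on_curve E x y" and xy': "Affine x y \<uplus> S = Affine x' y'"
    and nz: "eval2 u x y \<noteq> 0" "eval2 v x y \<noteq> 0" "eval2 u x' y' \<noteq> 0" "eval2 v x' y' \<noteq> 0"
    and d: "d = eval2 u x' y' / eval2 v x' y' / (eval2 u x y / eval2 v x y)" by blast
  define P where "P = Affine x y"
  have P: "P \<in> points E" using xy by (simp add: P_def)
  have oc': "on_curve E x' y'" using add_closed[OF P Sp] xy' by (simp add: P_def)
  define k where "k = (\<lambda>p. ef u p / ef v p)"
  have uv: "rfun (ef u)" "rfun (ef v)" using div by (auto simp: has_divisor_iff)
  have k: "wfun T k"
    unfolding wfun_def k_def using div rfun_divide[OF uv] T' weil_divisor_eq[OF T'(1)]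
    by (auto simp: has_divisor_iff)
  obtain e where e: "e \<noteq> 0" "ev (\<lambda>p. k p = e * g p)" using wfun_proportional[OF k g] by blast
  have ck: "ev (\<lambda>p. k (p \<uplus> S) = c * k p)"
    using c e(2) ev_trans[OF Sp e(2)] by eventually_elim simp
  define c1 c2 where "c1 = eval2 u x' y' / eval2 v x' y'" and "c2 = eval2 u x y / eval2 v x y"
  \<comment> \<open>Where v is nonzero, the quotient of the values of u and v is the residue of
    k.\<close>
  have q: "vge (ord (Affine a b)) 1 (\<lambda>p. k p - eval2 u a b / eval2 v a b)"
    if "on_curve E a b" "eval2 v a b \<noteq> 0" for a b
  proof (rule vge_quotient[OF that(1)])
    show "isreg (\<lambda>p. ef u p - (eval2 u a b / eval2 v a b) * ef v p)" "isreg (ef v)"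
      by (intro isreg_intros)+
    have "ev (\<lambda>p. ef v p \<noteq> 0)" using uv by (simp add: rfun_def)
    then show "ev (\<lambda>p. k p - eval2 u a b / eval2 v a b =
        (ef u p - (eval2 u a b / eval2 v a b) * ef v p) / ef v p)"
      by eventually_elim (simp add: k_def diff_divide_distrib)
  qed (use that in auto)
  have v1: "vge (ord P) 1 (\<lambda>p. k (p \<uplus> S) - c1)"
    using vge_trans_back[OF P Sp, of 1 "\<lambda>p. k p - c1"] q[OF oc' nz(4)] by (simp add: P_def xy' c1_def)
  have v2: "vge (ord P) 1 (\<lambda>p. k p - c2)" using q[OF xy nz(2)] by (simp add: P_def c2_def)
  have "vge (ord P) 1 (\<lambda>p. (k (p \<uplus> S) - c1) + (- c) * (k p - c2))"
    by (intro vge_add[OF valuation_ord[OF P]] v1 vge_scale[OF P] v2)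
  moreover have "ev (\<lambda>p. (k (p \<uplus> S) - c1) + (- c) * (k p - c2) = c * c2 - c1)"
    using ck by eventually_elim (simp add: algebra_simps)
  ultimately have "vge (ord P) 1 (\<lambda>p. c * c2 - c1)" by (rule vge_cong[OF valuation_ord[OF P]])
  then have "c * c2 - c1 = 0" by (rule const_eq_0_if_vge[OF P])
  then have "c1 = c * c2" by simp
  then show "d = c" using nz by (simp add: d c1_def c2_def)
qed

section \<open>Multiplicativity and symmetries of the pairing\<close>

abbreviation wp :: "'a point \<Rightarrow> 'a point \<Rightarrow> 'a" where
  "wp \<equiv> weil_pairing E m"

lemma wpD:
  assumes S: "S \<in> tors" and T: "T \<in> tors" and g: "wfun T g"
  shows "wp S T \<noteq> 0" "ev (\<lambda>p. g (p \<uplus> S) = wp S T * g p)"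
proof -
  obtain c where c: "c \<noteq> 0" "ev (\<lambda>p. g (p \<uplus> S) = c * g p)"
    using wfun_proportional[OF wfun_trans[OF g S] g] by blast
  have "wp S T = c" by (rule weil_pairing_eqI[OF S T g c(2)])
  then show "wp S T \<noteq> 0" "ev (\<lambda>p. g (p \<uplus> S) = wp S T * g p)" using c by auto
qed

lemma wfun_exists: assumes "T \<in> tors" obtains g where "wfun T g"
  using weil_function_exists[OF assms] unfolding wfun_def by blast

lemma wp_Infinity_left: assumes T: "T \<in> tors" shows "wp Infinity T = 1"
proof -
  obtain g where g: "wfun T g" using wfun_exists[OF T] .
  show ?thesis by (rule weil_pairing_eqI[OF Infinity_tors T g]) simp
qed

lemma wp_add_left:
  assumes S: "S \<in> tors" "S' \<in> tors" and T: "T \<in> tors" shows "wp (S \<uplus> S') T = wp S T * wp S' T"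
proof -
  obtain g where g: "wfun T g" using wfun_exists[OF T] .
  show ?thesis
  proof (rule weil_pairing_eqI[OF tors_add[OF S] T g])
    show "ev (\<lambda>p. g (p \<uplus> (S \<uplus> S')) = wp S T * wp S' T * g p)"
      using wpD(2)[OF S(1) T g] ev_trans[OF tors_points[OF S(1)] wpD(2)[OF S(2) T g]] ev_points
      by eventually_elim (simp add: add_assoc tors_points S)
  qed
qed

lemma wp_neg_left:
  assumes S: "S \<in> tors" and T: "T \<in> tors" shows "wp (neg S) T = inverse (wp S T)"
  using wp_add_left[OF S tors_neg[OF S] T] wp_Infinity_left[OF T]
  by (simp add: inverse_unique)

lemma wp_mult_left:
  assumes S: "S \<in> tors" and T: "T \<in> tors" shows "wp (mult_pt E n S) T = wp S T ^ n"
  by (induction n) (auto simp: mult_pt_Suc wp_Infinity_left wp_add_left tors_mult S T)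

lemma wp_power_m: assumes "S \<in> tors" "T \<in> tors" shows "wp S T ^ m = 1"
  using wp_mult_left[OF assms, of m] assms wp_Infinity_left by (simp add: tors_iff)

text \<open>Composing g with negation gives a function for -T and turns translation by S into
  translation by -S.\<close>

lemma wp_neg_right:
  assumes S: "S \<in> tors" and T: "T \<in> tors" shows "wp S (neg T) = inverse (wp S T)"
proof -
  obtain g where g: "wfun T g" using wfun_exists[OF T] .
  have "wp S (neg T) = wp (neg S) T"
  proof (rule weil_pairing_eqI[OF S tors_neg[OF T]])
    have "mm (neg P) = T \<longleftrightarrow> mm P = neg T" if "P \<in> points E" for P
      using that by (metis mult_pt_neg neg_neg)
    then show "wfun (neg T) (\<lambda>p. g (neg p))"
      using g rfun_neg unfolding wfun_def by (auto simp: ord_neg wd_def mult_pt_neg)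
    show "ev (\<lambda>p. g (neg (p \<uplus> S)) = wp (neg S) T * g (neg p))"
      using ev_neg[OF wpD(2)[OF tors_neg[OF S] T g]] ev_points
      by eventually_elim (simp add: neg_add_distrib tors_points S)
  qed
  then show ?thesis using wp_neg_left[OF S T] by simp
qed

text \<open>The product of the translates of \<open>g\<close> by the multiples of \<open>T'\<close> has a telescoping, hence
  trivial, divisor.\<close>

lemma wp_self: assumes T: "T \<in> tors" shows "wp T T = 1"
proof -
  obtain g where g: "wfun T g" using wfun_exists[OF T] .
  obtain T' where T': "T' \<in> points E" "mm T' = T" using mm_surj tors_points[OF T] by blast
  have rg: "rfun (\<lambda>p. g (p \<uplus> mult_pt E i T'))" for i
    using g T' by (intro rfun_trans) (auto simp: wfun_def)
  define k where "k = (\<lambda>p. \<Prod>i<m. g (p \<uplus> mult_pt E i T'))"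
  have rk: "rfun k" unfolding k_def by (intro rfun_prod rg) simp
  have "ord P k = 0" if P: "P \<in> points E" for P
  proof -
    \<comment> \<open>\<open>a i\<close> indicates m P + i T = T. The pole term of each translate is
      the zero term of the next, and a 0 = a m because m T = O.\<close>
    define a where "a = (\<lambda>i. of_bool (mm P \<uplus> mult_pt E i T = T) :: int)"
    have mmi: "mm (P \<uplus> mult_pt E i T') = mm P \<uplus> mult_pt E i T" for i
      using P T' by (metis mult.commute mult_pt_closed mult_pt_distrib mult_pt_mult)
    have shift: "mm P \<uplus> mult_pt E (Suc i) T = T \<longleftrightarrow> mm P \<uplus> mult_pt E i T = Infinity" for i
    proof -
      have "mm P \<uplus> mult_pt E (Suc i) T = mm P \<uplus> mult_pt E i T \<uplus> T"
        using P tors_points[OF T] by (simp add: mult_pt_Suc add_ac)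
      then show ?thesis
        using add_cancel_right[of "mm P \<uplus> mult_pt E i T" Infinity T] P tors_points[OF T] by simp
    qed
    have "ord P k = (\<Sum>i<m. ord P (\<lambda>p. g (p \<uplus> mult_pt E i T')))"
      unfolding k_def by (rule ord_prod[OF _ P rg]) simp
    also have "\<dots> = (\<Sum>i<m. a i - a (Suc i))"
    proof (rule sum.cong[OF refl])
      fix i
      have "ord P (\<lambda>p. g (p \<uplus> mult_pt E i T')) = wd T (P \<uplus> mult_pt E i T')"
        using ord_trans[OF P, of "mult_pt E i T'" g] g P T' by (auto simp: wfun_def)
      then show "ord P (\<lambda>p. g (p \<uplus> mult_pt E i T')) = a i - a (Suc i)"
        unfolding wd_def mmi a_def shift .
    qed
    also have "\<dots> = a 0 - a m" by (rule sum_lessThan_telescope')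
    also have "\<dots> = 0" using T P by (simp add: a_def tors_iff)
    finally show ?thesis .
  qed
  then obtain c where c: "c \<noteq> 0" "ev (\<lambda>p. k p = c)" using const_if_ord_nonneg[OF rk] by force
  \<comment> \<open>Both sides are the product of g(p + i T') over i = 0, ..., m. As k is a nonzero
    constant, g(p + T) = g(p) follows.\<close>
  have prod: "k (p \<uplus> T') * g p = k p * g (p \<uplus> T)" if p: "p \<in> points E" for p
  proof -
    have s: "p \<uplus> T' \<uplus> mult_pt E i T' = p \<uplus> mult_pt E (Suc i) T'" for i
      using p T' by (simp add: mult_pt_Suc add_assoc)
    have "k (p \<uplus> T') * g p = g (p \<uplus> mult_pt E 0 T') * (\<Prod>i<m. g (p \<uplus> mult_pt E (Suc i) T'))"
      unfolding k_def s by simp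
    also have "\<dots> = (\<Prod>i<Suc m. g (p \<uplus> mult_pt E i T'))"
      by (rule prod.lessThan_Suc_shift[symmetric])
    also have "\<dots> = k p * g (p \<uplus> T)" unfolding k_def using T' by simp
    finally show ?thesis .
  qed
  have "ev (\<lambda>p. g (p \<uplus> T) = 1 * g p)"
    using c(2) ev_trans[OF T'(1) c(2)] ev_points
  proof eventually_elim
    case (elim p)
    then show ?case using prod[of p] c(1) by simp
  qed
  then show ?thesis by (rule weil_pairing_eqI[OF T T g])
qed


section \<open>Nondegeneracy of the pairing on the basis\<close>

lemma ord_add_eq:
  assumes P: "P \<in> points E" and h: "rfun h" and k: "vge (ord P) (ord P h + 1) k"
    and hk: "rfun (\<lambda>p. h p + k p)"
  shows "ord P (\<lambda>p. h p + k p) = ord P h"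
proof -
  note val = valuation_ord[OF P]
  have "vge (ord P) (ord P h) (\<lambda>p. h p + k p)"
    by (rule vge_add[OF val vge_ordI[OF h order_refl] vge_mono[OF val k]]) simp
  then have "ord P h \<le> ord P (\<lambda>p. h p + k p)" using hk by (simp add: vge_def)
  moreover have "\<not> ord P h + 1 \<le> ord P (\<lambda>p. h p + k p)"
  proof
    assume "ord P h + 1 \<le> ord P (\<lambda>p. h p + k p)"
    then have "vge (ord P) (ord P h + 1) (\<lambda>p. (h p + k p) + (- 1) * k p)"
      by (intro vge_add[OF val] vge_ordI hk vge_scale P k)
    then have "vge (ord P) (ord P h + 1) h" by simp
    then show False using h by (simp add: vge_def)
  qed
  ultimately show ?thesis by simp
qed

text \<open>The residue field is the base field: the value is read off s h = t \<pi>^n at the point,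
  and is 0 for the zero function.\<close>

lemma value_exists:
  assumes oc: "on_curve E a b" and h: "vge (ord (Affine a b)) 0 h"
  shows "\<exists>c. vge (ord (Affine a b)) 1 (\<lambda>p. h p - c)"
proof -
  have P: "Affine a b \<in> points E" using oc by simp
  have "rat h" using h by (simp add: vge_def)
  from rat_cases[OF this] show ?thesis
  proof
    assume "ev (\<lambda>p. h p = 0)"
    then have "\<not> rfun (\<lambda>p. h p - 0)"
      using eventually_conj[of "\<lambda>p. h p = 0" gen "\<lambda>p. h p \<noteq> 0"] by (auto simp: rfun_def)
    then have "vge (ord (Affine a b)) 1 (\<lambda>p. h p - 0)" using \<open>rat h\<close> by (simp add: vge_def)
    then show ?thesis by blast
  next
    assume r: "rfun h"
    then obtain n where n: "ord (Affine a b) h = int n" using h by (auto simp: vge_def intro: nonneg_int_cases)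
    obtain s t where st: "isreg s" "isreg t" "s (Affine a b) \<noteq> 0"
      "ev (\<lambda>p. s p * h p = t p * unif (Affine a b) p ^ n)"
      using has_ord_ord[OF P r] unfolding n has_ord.simps power_int_of_nat by blast
    define w where "w = (\<lambda>p. t p * unif (Affine a b) p ^ n)"
    have w: "isreg w" unfolding w_def by (intro isreg_intros st)
    define c where "c = w (Affine a b) / s (Affine a b)"
    have s: "ev (\<lambda>p. s p \<noteq> 0)" using isreg_ev_neq_0[OF st(1) oc st(3)] .
    have "vge (ord (Affine a b)) 1 (\<lambda>p. h p - c)"
    proof (rule vge_quotient[OF oc])
      show "isreg (\<lambda>p. w p - c * s p)" by (intro isreg_intros w st)
      show "ev (\<lambda>p. h p - c = (w p - c * s p) / s p)"
        using st(4) s by eventually_elim (simp add: w_def field_simps)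
    qed (use st in \<open>auto simp: c_def\<close>)
    then show ?thesis by blast
  qed
qed

lemma vge_neg:
  assumes P: "P \<in> points E" and h: "vge (ord P) n (\<lambda>p. h (neg p))"
  shows "vge (ord (neg P)) n h"
proof -
  have "rat (\<lambda>p. h (neg (neg p)))" by (rule rat_neg) (use h in \<open>simp add: vge_def\<close>)
  then have "rat h" by simp
  moreover have "n \<le> ord (neg P) h" if "rfun h"
    using h rfun_neg[OF that] ord_neg[OF P that] by (simp add: vge_def)
  ultimately show ?thesis by (simp add: vge_def)
qed

text \<open>Supplies two distinct points of order two for the involution argument.\<close>

lemma two_f_roots: obtains e1 e2 where "poly f e1 = 0" "poly f e2 = 0" "e1 \<noteq> e2"
proof -
  obtain e1 where e1: "poly f e1 = 0" using alg_closed_imp_poly_has_root[of f] degree_f by auto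
  obtain q where q: "f = [:-e1, 1:] * q" "poly q e1 \<noteq> 0" using f_root_decomp[OF e1] by blast
  then have "q \<noteq> 0" by auto
  then have "degree f = Suc (degree q)" unfolding q(1) by (subst degree_mult_eq) auto
  then have "degree q > 0" using degree_f by simp
  then obtain e2 where "poly q e2 = 0" using alg_closed_imp_poly_has_root by blast
  then show ?thesis using that[of e1 e2] e1 q by auto
qed


lemma card_coset:
  assumes A: "A \<in> points E"
  shows "finite {P \<in> points E. mm P = mm A}" "card {P \<in> points E. mm P = mm A} = card tors"
proof -
  have "{P \<in> points E. mm P = mm A} = (\<lambda>S. A \<uplus> S) ` tors"
  proof (intro equalityI subsetI)
    fix P assume P: "P \<in> {P \<in> points E. mm P = mm A}"
    then have "P \<uplus> neg A \<in> tors" using mm_eq_iff[of P A] A by simp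
    moreover have "P = A \<uplus> (P \<uplus> neg A)" using P A by (metis add_comm add_neg_cancel(2) add_closed neg_in_points mem_Collect_eq)
    ultimately show "P \<in> (\<lambda>S. A \<uplus> S) ` tors" by blast
  next
    fix P assume "P \<in> (\<lambda>S. A \<uplus> S) ` tors"
    then show "P \<in> {P \<in> points E. mm P = mm A}" using A by (auto simp: mm_add_tors tors_points)
  qed
  moreover have "inj_on (\<lambda>S. A \<uplus> S) tors"
    by (rule inj_onI) (metis A add_cancel_right add_comm tors_points)
  ultimately show "finite {P \<in> points E. mm P = mm A}" "card {P \<in> points E. mm P = mm A} = card tors"
    using finite_tors by (simp_all add: card_image)
qed

text \<open>An invariant function \<open>G\<close> with simple poles on \<open>E[m]\<close> would identify \<open>E/E[m]\<close> with the projective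
  line; the involution \<open>-1\<close> would then be an affine map fixing all three classes of order two.\<close>

lemma no_invariant_wfun:
  assumes T2: "T2 \<in> tors" "T2 \<noteq> Infinity" and G: "wfun T2 G"
    and inv: "\<And>S. S \<in> tors \<Longrightarrow> ev (\<lambda>p. G (p \<uplus> S) = G p)"
  shows False
proof -
  have rG: "rfun G" and oG: "\<And>P. P \<in> points E \<Longrightarrow> ord P G = wd T2 P" using G by (auto simp: wfun_def)
  have ratG: "rat G" using rG by (simp add: rfun_def)
  have nc: "\<not> ev (\<lambda>p. G p = c)" for c
  proof
    assume c: "ev (\<lambda>p. G p = c)"
    from rG have "ev (\<lambda>p. G p \<noteq> 0)" by (simp add: rfun_def)
    with c have "ev (\<lambda>p. c \<noteq> 0)" by eventually_elim simp
    then have "c \<noteq> 0" by simp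
    then have "ord Infinity G = 0"
      using ord_cong[OF Infinity_in_points rG c] ord_const[OF Infinity_in_points] by simp
    then show False using oG[of Infinity] T2 by (simp add: wd_def)
  qed
  have rGc: "rfun (\<lambda>p. G p - c)" for c
    using rat_cases[OF rat_diff[OF ratG isreg_rat[OF isreg_const[of c]]]] nc[of c] by auto
  have pole: "ord P (\<lambda>p. G p - c) = - 1" if P: "P \<in> tors" for P c
  proof -
    have Pp: "P \<in> points E" using P by (rule tors_points)
    have o: "ord P G = - 1" using oG[OF Pp] P T2 by (simp add: wd_def tors_iff)
    have "vge (ord P) (ord P G + 1) (\<lambda>p. - c)" using vge_const[OF valuation_ord[OF Pp], of "- c"] o by simp
    then have "ord P (\<lambda>p. G p + - c) = ord P G"
      using rGc[of c] by (intro ord_add_eq[OF Pp rG]) simp_all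
    then show ?thesis using o by simp
  qed
  have vG: "vge (ord P) 0 G" if "P \<in> points E" "P \<notin> tors" for P
    using that oG[OF that(1)] rG by (intro vge_ordI) (auto simp: wd_def tors_iff)
  have nonneg: "ord P (\<lambda>p. G p - c) \<ge> 0" if P: "P \<in> points E" "P \<notin> tors" for P c
    using vge_add[OF valuation_ord[OF P(1)] vG[OF P] vge_const[OF valuation_ord[OF P(1)], of "- c"]] rGc[of c]
    by (simp add: vge_def)
  \<comment> \<open>Invariance spreads the zero at A over its coset, which has as many points as
    there are simple poles on E[m]. As the degree is 0, these zeros are simple and there are no
    others.\<close>
  have fiber: "ord P (\<lambda>p. G p - c) = wd (mm A) P"
    if A: "A \<in> points E" "mm A \<noteq> Infinity" and c: "vge (ord A) 1 (\<lambda>p. G p - c)" and P: "P \<in> points E" for A c P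
  proof -
    define K where "K = {P \<in> points E. mm P = mm A}"
    have K: "finite K" "card K = card tors" unfolding K_def by (rule card_coset[OF A(1)])+
    have pos: "ord Q (\<lambda>p. G p - c) \<ge> 1" if Q: "Q \<in> K" for Q
    proof -
      define S where "S = Q \<uplus> neg A"
      have S: "S \<in> tors" "A \<uplus> S = Q"
        using Q A mm_eq_iff[of Q A] add_comm[of A S] unfolding K_def S_def by auto
      have "ev (\<lambda>p. G p - c = G (p \<uplus> S) - c)" using inv[OF S(1)] by eventually_elim simp
      from ord_cong[OF A(1) rGc this] have "ord A (\<lambda>p. G (p \<uplus> S) - c) = ord A (\<lambda>p. G p - c)" .
      moreover have "ord A (\<lambda>p. G (p \<uplus> S) - c) = ord Q (\<lambda>p. G p - c)"
        using ord_trans[OF A(1) tors_points[OF S(1)] rGc[of c]] S(2) by simp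
      ultimately show ?thesis using c rGc[of c] by (simp add: vge_def)
    qed
    define F where "F = {P \<in> points E. ord P (\<lambda>p. G p - c) \<noteq> 0} \<union> K \<union> tors"
    have F: "finite F" "F \<subseteq> points E"
      unfolding F_def using finite_ord_support[OF rGc] K finite_tors by (auto simp: K_def tors_points)
    have "(\<Sum>P\<in>F. ord P (\<lambda>p. G p - c)) = dg (\<lambda>p. G p - c)"
      by (rule dg_eq_sum[symmetric, OF F]) (auto simp: F_def)
    then have s1: "(\<Sum>P\<in>F. ord P (\<lambda>p. G p - c)) = 0" using dg_eq_0[OF rGc] by simp
    have "F \<inter> {P. mm P = mm A} = K" "F \<inter> {P. mm P = Infinity} = tors"
      using F(2) by (auto simp: F_def K_def tors_iff)
    then have s2: "(\<Sum>P\<in>F. wd (mm A) P) = 0"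
      using K(2) F(1) by (simp add: wd_def sum_subtractf sum_of_bool_eq)
    have ge: "0 \<le> ord Q (\<lambda>p. G p - c) - wd (mm A) Q" if Q: "Q \<in> F" for Q
    proof -
      consider "Q \<in> tors" | "Q \<in> K" "Q \<notin> tors" | "Q \<notin> K" "Q \<notin> tors" by blast
      then show ?thesis
      proof cases
        case 1
        then show ?thesis using pole[OF 1, of c] A(2) by (simp add: wd_def tors_iff)
      next
        case 2
        then show ?thesis using pos[OF 2(1)] A(2) by (simp add: wd_def K_def)
      next
        case 3
        then show ?thesis using nonneg[of Q c] Q F(2) by (auto simp: wd_def K_def tors_iff)
      qed
    qed
    have "(\<Sum>P\<in>F. ord P (\<lambda>p. G p - c) - wd (mm A) P) = 0" using s1 s2 by (simp add: sum_subtractf)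
    then have eq: "\<forall>Q\<in>F. ord Q (\<lambda>p. G p - c) - wd (mm A) Q = 0"
      using sum_nonneg_eq_0_iff[OF F(1), of "\<lambda>P. ord P (\<lambda>p. G p - c) - wd (mm A) P"] ge by blast
    show ?thesis
    proof (cases "P \<in> F")
      case True
      then show ?thesis using eq by simp
    next
      case False
      then show ?thesis using P by (auto simp: F_def K_def wd_def tors_iff)
    qed
  qed
  have val: "\<exists>c. vge (ord A) 1 (\<lambda>p. G p - c)" if A: "A \<in> points E" "mm A \<noteq> Infinity" for A
  proof -
    obtain a b where ab: "A = Affine a b" "on_curve E a b" using A by (cases A) auto
    have "vge (ord A) 0 G" using vG[OF A(1)] A(2) by (simp add: tors_iff)
    then show ?thesis using value_exists[OF ab(2)] ab(1) by blast
  qed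
  have same_fiber: "mm A = mm B" if A: "A \<in> points E" "mm A \<noteq> Infinity" and B: "B \<in> points E" "mm B \<noteq> Infinity"
    and c: "vge (ord A) 1 (\<lambda>p. G p - c)" "vge (ord B) 1 (\<lambda>p. G p - c)" for A B c
    using fiber[OF A c(1) A(1)] fiber[OF B c(2) A(1)] A(2) by (simp add: wd_def)
  obtain Z where Z: "Z \<in> points E" "mm Z = T2" using mm_surj tors_points[OF T2(1)] by blast
  have nZ: "neg Z \<in> points E" "mm (neg Z) \<noteq> Infinity" using Z T2 by (auto simp: mult_pt_neg)
  obtain d where d: "vge (ord (neg Z)) 1 (\<lambda>p. G p - d)" using val[OF nZ] by blast
  \<comment> \<open>Negation moves the zeros of G to the coset of -Z, which is the fibre of G over
    d, and keeps the poles.\<close>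
  have "ord P (\<lambda>p. G (neg p)) = ord P (\<lambda>p. G p - d)" if P: "P \<in> points E" for P
  proof -
    have "mm (neg P) = T2 \<longleftrightarrow> mm P = neg T2" using P by (metis mult_pt_neg neg_neg)
    then show ?thesis
      using fiber[OF nZ d P] ord_neg[OF P rG] oG[of "neg P"] P Z by (simp add: wd_def mult_pt_neg)
  qed
  then obtain \<alpha> where \<alpha>: "\<alpha> \<noteq> 0" "ev (\<lambda>p. G (neg p) = \<alpha> * (G p - d))"
    using proportional_if_same_ord[OF rfun_neg[OF rG] rGc] by blast
  \<comment> \<open>Negation is an involution, so the map c \<mapsto> \<alpha> (c - d) squares to
    the identity on the values of G; since G is not constant, this forces \<alpha>^2 = 1 and d
    (\<alpha> + 1) = 0.\<close>
  have inv2: "ev (\<lambda>p. (1 - \<alpha> ^ 2) * G p = - \<alpha> * d * (\<alpha> + 1))"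
    using \<alpha>(2) ev_neg[OF \<alpha>(2)]
  proof eventually_elim
    case (elim p)
    then have "G p = \<alpha> * (\<alpha> * (G p - d) - d)" by simp
    then show ?case by (simp add: algebra_simps power2_eq_square)
  qed
  have \<alpha>2: "\<alpha> ^ 2 = 1"
  proof (rule ccontr)
    assume "\<alpha> ^ 2 \<noteq> 1"
    from inv2 have "ev (\<lambda>p. G p = (- \<alpha> * d * (\<alpha> + 1)) / (1 - \<alpha> ^ 2))"
      by eventually_elim (use \<open>\<alpha> ^ 2 \<noteq> 1\<close> in \<open>simp add: field_simps\<close>)
    then show False using nc by blast
  qed
  have "ev (\<lambda>p. - \<alpha> * d * (\<alpha> + 1) = 0)" using inv2 by eventually_elim (simp add: \<alpha>2)
  then have \<alpha>d: "d * (\<alpha> + 1) = 0" using \<alpha>(1) by simp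
  have neg_value: "vge (ord (neg A)) 1 (\<lambda>p. G p - \<alpha> * (c - d))"
    if A: "A \<in> points E" and c: "vge (ord A) 1 (\<lambda>p. G p - c)" for A c
  proof (rule vge_neg[OF A])
    have "vge (ord A) 1 (\<lambda>p. \<alpha> * (G p - c))" by (rule vge_scale[OF A c])
    moreover have "ev (\<lambda>p. \<alpha> * (G p - c) = G (neg p) - \<alpha> * (c - d))"
      using \<alpha>(2) by eventually_elim (simp add: algebra_simps)
    ultimately show "vge (ord A) 1 (\<lambda>p. G (neg p) - \<alpha> * (c - d))" by (rule vge_cong[OF valuation_ord[OF A]])
  qed
  show False
  proof (cases "\<alpha> = 1")
    case True
    \<comment> \<open>Now G is even, so A and -A lie in one fibre and m A = -m A; a point m A with
      nonzero ordinate contradicts this.\<close>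
    then have "d = 0" using \<alpha>d two_neq_0 by simp
    obtain x y where xy: "on_curve E x y" "yc (Affine x y) \<noteq> 0" using ev_ex[OF ev_yc_neq] by blast
    obtain A where A: "A \<in> points E" "mm A = Affine x y" using mm_surj[of "Affine x y"] xy by auto
    obtain c where c: "vge (ord A) 1 (\<lambda>p. G p - c)" using val[OF A(1)] A(2) by auto
    have "vge (ord (neg A)) 1 (\<lambda>p. G p - c)" using neg_value[OF A(1) c] True \<open>d = 0\<close> by simp
    then have "mm A = mm (neg A)" using A c by (intro same_fiber[of A "neg A" c]) (auto simp: mult_pt_neg)
    then show False using A xy eq_minus_self_iff[of y] by (simp add: mult_pt_neg)
  next
    case False
    then have \<alpha>1: "\<alpha> = - 1" using \<alpha>2 by (simp add: power2_eq_1_iff)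
    \<comment> \<open>If m A has order two, A and -A lie in one fibre, so its value satisfies c = d
      - c. Two such classes would share the value d/2 and coincide.\<close>
    have half: "c + c = d" if A: "A \<in> points E" "mm A \<noteq> Infinity" "neg (mm A) = mm A"
      and c: "vge (ord A) 1 (\<lambda>p. G p - c)" for A c
    proof -
      have nA: "neg A \<in> points E" using A by simp
      have v1: "vge (ord (neg A)) 1 (\<lambda>p. G p - \<alpha> * (c - d))" by (rule neg_value[OF A(1) c])
      have "ord (neg A) (\<lambda>p. G p - c) = 1"
        using fiber[OF A(1,2) c nA] A by (simp add: wd_def mult_pt_neg)
      then have v2: "vge (ord (neg A)) 1 (\<lambda>p. G p - c)" using rGc by (intro vge_ordI) auto
      have "vge (ord (neg A)) 1 (\<lambda>p. (G p - \<alpha> * (c - d)) + (- 1) * (G p - c))"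
        by (intro vge_add[OF valuation_ord[OF nA]] vge_scale[OF nA] v1 v2)
      then have "vge (ord (neg A)) 1 (\<lambda>p. c + c - d)" by (simp add: \<alpha>1 algebra_simps)
      then have "c + c - d = 0" by (rule const_eq_0_if_vge[OF nA])
      then show ?thesis by simp
    qed
    obtain e1 e2 where e: "poly f e1 = 0" "poly f e2 = 0" "e1 \<noteq> e2" using two_f_roots by blast
    have oc: "on_curve E e1 0" "on_curve E e2 0" using e by (auto simp: on_curve_iff)
    obtain A where A: "A \<in> points E" "mm A = Affine e1 0" using mm_surj[of "Affine e1 0"] oc by auto
    obtain B where B: "B \<in> points E" "mm B = Affine e2 0" using mm_surj[of "Affine e2 0"] oc by auto
    obtain c where c: "vge (ord A) 1 (\<lambda>p. G p - c)" using val[OF A(1)] A(2) by auto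
    obtain c' where c': "vge (ord B) 1 (\<lambda>p. G p - c')" using val[OF B(1)] B(2) by auto
    have "c + c = c' + c'" using half[OF A(1) _ _ c] half[OF B(1) _ _ c'] A B by simp
    then have "(c - c') + (c - c') = 0" by (simp add: algebra_simps)
    then have "c = c'" using double_eq_0_iff[of "c - c'"] by simp
    then have "mm A = mm B" using A B c c' by (intro same_fiber[of A B c]) auto
    then show False using A B e by simp
  qed
qed

text \<open>As e(P2, P2) = 1, each e(S, P2) is a power of e(P1, P2), so its square would also be 1.
  The product G of g and its translate by -T', where m T' = P2, would then be invariant under E[m].
  It is a Weil function for 2 P2, which is nonzero because m \<ge> 3; no such function
  exists.\<close>

lemma wp_basis_square:
  assumes "m \<ge> 3" shows "wp P1 P2 ^ 2 \<noteq> 1"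
proof
  assume sq: "wp P1 P2 ^ 2 = 1"
  note T = P12(2)
  have Tp: "P2 \<in> points E" using T by (rule tors_points)
  obtain g where g: "wfun P2 g" using wfun_exists[OF T] .
  obtain T' where T': "T' \<in> points E" "mm T' = P2" using mm_surj[OF Tp] by blast
  have nT': "neg T' \<in> points E" using T' by simp
  have rg: "rfun g" using g by (simp add: wfun_def)
  define G where "G = (\<lambda>p. g p * g (p \<uplus> neg T'))"
  have "wfun (P2 \<uplus> P2) G"
    unfolding wfun_def
  proof (intro conjI ballI)
    show "rfun G" unfolding G_def by (intro rfun_mult rfun_trans rg nT')
    fix P assume P: "P \<in> points E"
    have mP: "mm P \<in> points E" using P by simp
    \<comment> \<open>The zeros of g lie on the coset m P = P2, where its translate has its poles;
      they cancel, leaving zeros where m P = 2 P2.\<close>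
    have "mm (P \<uplus> neg T') = mm P \<uplus> neg P2" using P T' by (simp add: mult_pt_distrib mult_pt_neg)
    moreover have "mm P \<uplus> neg P2 = P2 \<longleftrightarrow> mm P = P2 \<uplus> P2"
      using mP Tp by (metis add_neg_cancel)
    moreover have "mm P \<uplus> neg P2 = Infinity \<longleftrightarrow> mm P = P2"
      using mP Tp neg_unique[of "mm P" "neg P2"] by auto
    ultimately show "ord P G = wd (P2 \<uplus> P2) P"
      unfolding G_def using ord_mult[OF P rg rfun_trans[OF nT' rg]] ord_trans[OF P nT' rg] g P T'
      by (simp add: wfun_def wd_def)
  qed
  moreover have "ev (\<lambda>p. G (p \<uplus> S) = G p)" if S: "S \<in> tors" for S
  proof -
    obtain a b where ab: "S = mult_pt E a P1 \<uplus> mult_pt E b P2" using generating[OF S] by blast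
    have "wp S P2 = wp P1 P2 ^ a" unfolding ab
      using wp_add_left[OF tors_mult[OF P12(1)] tors_mult[OF P12(2)] T] wp_mult_left[OF P12(1) T]
        wp_mult_left[OF P12(2) T] wp_self[OF T] by simp
    then have "wp S P2 ^ 2 = (wp P1 P2 ^ 2) ^ a" by (simp add: mult.commute flip: power_mult)
    then have 1: "wp S P2 * wp S P2 = 1" using sq by (simp add: power2_eq_square)
    have Sp: "S \<in> points E" using S by (rule tors_points)
    show ?thesis
      using wpD(2)[OF S T g] ev_trans[OF nT' wpD(2)[OF S T g]] ev_points
    proof eventually_elim
      case (elim p)
      have "p \<uplus> S \<uplus> neg T' = p \<uplus> neg T' \<uplus> S" using elim(3) Sp nT' by (simp add: add_ac)
      then have "G (p \<uplus> S) = (wp S P2 * wp S P2) * G p" unfolding G_def by (simp add: elim mult_ac)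
      then show ?case by (simp add: 1)
    qed
  qed
  moreover have "P2 \<uplus> P2 \<noteq> Infinity"
  proof
    assume "P2 \<uplus> P2 = Infinity"
    then have "m dvd 2" using independent[of 0 2] by (simp add: mult_pt_Suc numeral_2_eq_2)
    then show False using assms by (auto dest: dvd_imp_le)
  qed
  ultimately show False using no_invariant_wfun[OF tors_add[OF T T]] by blast
qed

end

subsection \<open>Field automorphisms\<close>

definition field_aut :: "('a::field \<Rightarrow> 'a) \<Rightarrow> bool" where
  "field_aut \<sigma> \<longleftrightarrow> bij \<sigma> \<and> (\<forall>x y. \<sigma> (x + y) = \<sigma> x + \<sigma> y) \<and> (\<forall>x y. \<sigma> (x * y) = \<sigma> x * \<sigma> y)"

context
  fixes \<sigma> :: "'a::field \<Rightarrow> 'a" assumes aut: "field_aut \<sigma>"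
begin

lemma aut_add: "\<sigma> (x + y) = \<sigma> x + \<sigma> y" and aut_mult: "\<sigma> (x * y) = \<sigma> x * \<sigma> y"
  and aut_inj: "inj \<sigma>" and aut_surj: "surj \<sigma>"
  using aut by (auto simp: field_aut_def bij_def)

lemma aut_0: "\<sigma> 0 = 0"
  by (metis add_cancel_right_right aut_add)

lemma aut_eq_0_iff: "\<sigma> x = 0 \<longleftrightarrow> x = 0"
  using aut_inj aut_0 by (metis injD)

lemma aut_1: "\<sigma> 1 = 1"
  using aut_mult[of 1 1] aut_eq_0_iff[of 1] by simp

lemma aut_minus: "\<sigma> (- x) = - \<sigma> x"
  using aut_add[of x "- x"] aut_0 by (simp add: eq_neg_iff_add_eq_0 add.commute)

lemma aut_diff: "\<sigma> (x - y) = \<sigma> x - \<sigma> y"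
  using aut_add[of x "- y"] aut_minus by simp

lemma aut_inverse: "\<sigma> (inverse x) = inverse (\<sigma> x)"
proof (cases "x = 0")
  case False
  then have "\<sigma> x * \<sigma> (inverse x) = 1" using aut_mult[of x "inverse x"] aut_1 by simp
  then show ?thesis by (metis inverse_unique)
qed (simp add: aut_0)

lemma aut_divide: "\<sigma> (x / y) = \<sigma> x / \<sigma> y"
  by (simp add: field_class.field_divide_inverse aut_mult aut_inverse)

lemma aut_power: "\<sigma> (x ^ n) = \<sigma> x ^ n"
  by (induction n) (auto simp: aut_1 aut_mult)

lemma aut_power_int: "\<sigma> (x powi n) = \<sigma> x powi n"
  by (simp add: power_int_def aut_power aut_inverse)

lemma aut_of_nat: "\<sigma> (of_nat n) = of_nat n"
  by (induction n) (auto simp: aut_0 aut_1 aut_add)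

lemma aut_numeral: "\<sigma> (numeral n) = numeral n"
  using aut_of_nat[of "numeral n"] by simp

lemma aut_eq_iff: "\<sigma> x = \<sigma> y \<longleftrightarrow> x = y"
  using aut_inj by (simp add: inj_eq)

lemma aut_poly: "\<sigma> (poly p x) = poly (map_poly \<sigma> p) (\<sigma> x)"
  by (induction p) (auto simp: aut_0 aut_add aut_mult map_poly_pCons)

lemma aut_degree: "degree (map_poly \<sigma> p) = degree p"
  by (intro degree_map_poly) (auto simp: aut_eq_0_iff)

lemma aut_map_poly_eq_0_iff: "map_poly \<sigma> p = 0 \<longleftrightarrow> p = 0"
  by (intro map_poly_eq_0_iff) (auto simp: aut_0 aut_eq_0_iff)

lemmas aut_simps = aut_add aut_mult aut_0 aut_1 aut_minus aut_diff aut_divide aut_power aut_numeral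

lemma aut_inv [simp]: "\<sigma> (inv_into UNIV \<sigma> x) = x" "inv_into UNIV \<sigma> (\<sigma> x) = x"
  by (simp_all add: aut_surj surj_f_inv_f aut_inj)

end

locale curve_aut = weierstrass_curve +
  fixes \<sigma> :: "'a \<Rightarrow> 'a"
  assumes aut: "field_aut \<sigma>" and fix2: "\<sigma> (wa2 E) = wa2 E" and fix4: "\<sigma> (wa4 E) = wa4 E"
    and fix6: "\<sigma> (wa6 E) = wa6 E"
begin

abbreviation sp :: "'a point \<Rightarrow> 'a point" where "sp \<equiv> map_point \<sigma>"
abbreviation spi :: "'a point \<Rightarrow> 'a point" where "spi \<equiv> map_point (inv_into UNIV \<sigma>)"
text \<open>The conjugate function: \<sigma> is applied to the coefficients of g, so its value at
  \<sigma>(P) is \<sigma>(g(P)).\<close>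

abbreviation gs :: "('a point \<Rightarrow> 'a) \<Rightarrow> 'a point \<Rightarrow> 'a" where "gs g \<equiv> \<lambda>p. \<sigma> (g (spi p))"

lemmas as = aut_simps[OF aut] and ai = aut_inv[OF aut] and aeq = aut_eq_iff[OF aut] aut_eq_0_iff[OF aut]

lemma sp_spi [simp]: "sp (spi p) = p" "spi (sp p) = p"
  by (cases p; simp add: ai)+

lemma aut_f: "\<sigma> (poly f x) = poly f (\<sigma> x)"
  by (simp add: poly_f as fix2 fix4 fix6)

lemma on_curve_aut: "on_curve E (\<sigma> x) (\<sigma> y) \<longleftrightarrow> on_curve E x y"
  by (simp add: on_curve_iff aeq flip: aut_f as)

lemma sp_points [simp]: "sp P \<in> points E \<longleftrightarrow> P \<in> points E"
  by (cases P) (auto simp: on_curve_aut)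

lemma spi_points [simp]: "spi P \<in> points E \<longleftrightarrow> P \<in> points E"
  by (metis sp_points sp_spi(1))

lemma sp_add: "sp (P \<uplus> Q) = sp P \<uplus> sp Q"
proof (cases "P = Infinity \<or> Q = Infinity")
  case True
  then show ?thesis by auto
next
  case False
  then obtain x1 y1 x2 y2 where PQ: "P = Affine x1 y1" "Q = Affine x2 y2" by (metis point.exhaust)
  have "\<sigma> y1 + \<sigma> y2 = 0 \<longleftrightarrow> y1 + y2 = 0" using aeq(2)[of "y1 + y2"] by (simp add: as)
  then show ?thesis
    unfolding PQ by (auto simp: add_pt.simps(3) a1 a3 Let_def as aeq fix2 fix4)
qed

lemma sp_mult_pt: "sp (mult_pt E n P) = mult_pt E n (sp P)"
  by (induction n) (auto simp: mult_pt_Suc sp_add)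

lemma spi_add: "spi (P \<uplus> Q) = spi P \<uplus> spi Q"
  by (metis sp_add sp_spi)

lemma ev_spi: "ev Q \<Longrightarrow> ev (\<lambda>p. Q (spi p))"
  by (rule ev_inj) (auto intro!: inj_onI, metis sp_spi(1))

lemma reg_aut: "reg (map_poly \<sigma> A) (map_poly \<sigma> B) (sp p) = \<sigma> (reg A B p)"
  by (cases p) (simp_all add: as aut_poly[OF aut])

lemma reg_aut': "\<sigma> (reg A B (spi p)) = reg (map_poly \<sigma> A) (map_poly \<sigma> B) p"
  using reg_aut[of A B "spi p"] by simp

lemma isreg_aut: assumes "isreg h" shows "isreg (gs h)"
proof -
  from assms obtain A B where AB: "\<And>x y. on_curve E x y \<Longrightarrow> h (Affine x y) = reg A B (Affine x y)"
    unfolding isreg_def by blast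
  show ?thesis
  proof (rule isregI[of _ "map_poly \<sigma> A" "map_poly \<sigma> B"])
    fix x y assume "on_curve E x y"
    then have "on_curve E (inv_into UNIV \<sigma> x) (inv_into UNIV \<sigma> y)" using spi_points[of "Affine x y"] by simp
    from AB[OF this] have "h (spi (Affine x y)) = reg A B (spi (Affine x y))" by simp
    then show "\<sigma> (h (spi (Affine x y))) = reg (map_poly \<sigma> A) (map_poly \<sigma> B) (Affine x y)"
      by (simp only: reg_aut')
  qed
qed

lemma rat_aut: assumes "rat h" shows "rat (gs h)"
proof -
  obtain u v where uv: "isreg u" "isreg v" "ev (\<lambda>p. v p \<noteq> 0)" "ev (\<lambda>p. h p = u p / v p)"
    using assms unfolding rat_def by blast
  show ?thesis
  proof (rule ratI[OF isreg_aut[OF uv(1)] isreg_aut[OF uv(2)]])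
    show "ev (\<lambda>p. gs v p \<noteq> 0)" using ev_spi[OF uv(3)] by eventually_elim (simp add: aeq)
    show "ev (\<lambda>p. gs h p = gs u p / gs v p)" using ev_spi[OF uv(4)] by eventually_elim (simp add: as)
  qed
qed

lemma rfun_aut: assumes "rfun h" shows "rfun (gs h)"
  using assms rat_aut[of h] ev_spi[of "\<lambda>p. h p \<noteq> 0"] by (simp add: rfun_def aeq)

lemma degree_nrm_aut:
  assumes "A \<noteq> 0 \<or> B \<noteq> 0" shows "degree (nrm (map_poly \<sigma> A) (map_poly \<sigma> B)) = degree (nrm A B)"
  using degree_nrm(2)[OF assms] degree_nrm(2)[of "map_poly \<sigma> A" "map_poly \<sigma> B"] assms
  by (simp add: aut_degree[OF aut] aut_map_poly_eq_0_iff[OF aut])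

text \<open>\<sigma> carries the local parameter at P to the one at \<sigma>(P), and preserves the
  degrees of norms.\<close>

lemma ord_aut:
  assumes P: "P \<in> points E" and h: "rfun h" shows "ord (sp P) (gs h) = ord P h"
proof (rule ord_eqI[OF _ rfun_aut[OF h]])
  show "sp P \<in> points E" using P by simp
  show "has_ord (sp P) (gs h) (ord P h)"
  proof (cases P)
    case Infinity
    obtain A B C D where *: "A \<noteq> 0 \<or> B \<noteq> 0" "C \<noteq> 0 \<or> D \<noteq> 0" "ev (\<lambda>p. reg C D p * h p = reg A B p)"
      "ord P h = int (degree (nrm C D)) - int (degree (nrm A B))"
      using has_ord_ord[OF P h] unfolding Infinity has_ord.simps by blast
    have "has_ord Infinity (gs h) (ord P h)"
    proof (rule has_ord_InfinityI)
      show "map_poly \<sigma> A \<noteq> 0 \<or> map_poly \<sigma> B \<noteq> 0" "map_poly \<sigma> C \<noteq> 0 \<or> map_poly \<sigma> D \<noteq> 0"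
        using * by (auto simp: aut_map_poly_eq_0_iff[OF aut])
      show "ev (\<lambda>p. reg (map_poly \<sigma> C) (map_poly \<sigma> D) p * gs h p = reg (map_poly \<sigma> A) (map_poly \<sigma> B) p)"
        using ev_spi[OF *(3)] unfolding reg_aut'[symmetric] by eventually_elim (simp flip: as)
    qed (use * degree_nrm_aut in simp)
    then show ?thesis using Infinity by simp
  next
    case (Affine a b)
    obtain s t where *: "isreg s" "isreg t" "s (Affine a b) \<noteq> 0" "t (Affine a b) \<noteq> 0"
      "ev (\<lambda>p. s p * h p = t p * unif (Affine a b) p powi ord P h)"
      using has_ord_ord[OF P h] unfolding Affine has_ord.simps by blast
    have u: "\<sigma> (unif (Affine a b) (spi p)) = unif (Affine (\<sigma> a) (\<sigma> b)) p" for p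
      by (cases p) (auto simp: as aeq ai)
    have "has_ord (Affine (\<sigma> a) (\<sigma> b)) (gs h) (ord P h)"
    proof (rule has_ord_AffineI[OF isreg_aut[OF *(1)] isreg_aut[OF *(2)]])
      show "ev (\<lambda>p. gs s p * gs h p = gs t p * unif (Affine (\<sigma> a) (\<sigma> b)) p powi ord P h)"
        using ev_spi[OF *(5)]
      proof eventually_elim
        case (elim p)
        have "\<sigma> (s (spi p) * h (spi p)) = \<sigma> (t (spi p) * unif (Affine a b) (spi p) powi ord P h)"
          using elim by (rule arg_cong)
        then show ?case by (simp only: as u aut_power_int[OF aut])
      qed
    qed (use * in \<open>simp_all add: ai aeq\<close>)
    then show ?thesis using Affine by simp
  qed
qed

end

locale weil_aut = weil + curve_aut
begin

lemma sp_tors: "S \<in> tors \<Longrightarrow> sp S \<in> tors"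
  by (simp add: tors_iff flip: sp_mult_pt)

text \<open>The conjugate of g is a function for \<sigma>(T), and translation by \<sigma>(S)
  multiplies it by \<sigma>(e(S, T)).\<close>

lemma wp_aut: assumes S: "S \<in> tors" and T: "T \<in> tors" shows "wp (sp S) (sp T) = \<sigma> (wp S T)"
proof -
  obtain g where g: "wfun T g" using wfun_exists[OF T] .
  show ?thesis
  proof (rule weil_pairing_eqI[OF sp_tors[OF S] sp_tors[OF T]])
    show "wfun (sp T) (gs g)"
      unfolding wfun_def
    proof (intro conjI ballI)
      show "rfun (gs g)" using g by (intro rfun_aut) (simp add: wfun_def)
      fix P assume P: "P \<in> points E"
      have "ord P (gs g) = ord (spi P) g"
        using ord_aut[of "spi P" g] P g by (simp add: wfun_def)
      also have "\<dots> = wd T (spi P)" using g P by (simp add: wfun_def)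
      also have "\<dots> = wd (sp T) P"
      proof -
        have "mm (spi P) = Q \<longleftrightarrow> mm P = sp Q" for Q
          using sp_mult_pt[of m "spi P"] by (metis sp_spi)
        from this[of T] this[of Infinity] show ?thesis by (simp add: wd_def)
      qed
      finally show "ord P (gs g) = wd (sp T) P" .
    qed
    show "ev (\<lambda>p. gs g (p \<uplus> sp S) = \<sigma> (wp S T) * gs g p)"
      using ev_spi[OF wpD(2)[OF S T g]] by eventually_elim (simp add: spi_add flip: as)
  qed
qed

end

subsection \<open>Extending partial embeddings\<close>

definition is_subfield :: "'a::field set \<Rightarrow> bool" where
  "is_subfield F \<longleftrightarrow> 0 \<in> F \<and> 1 \<in> F \<and> (\<forall>x\<in>F. \<forall>y\<in>F. x + y \<in> F) \<and> (\<forall>x\<in>F. \<forall>y\<in>F. x * y \<in> F) \<and>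
    (\<forall>x\<in>F. - x \<in> F) \<and> (\<forall>x\<in>F. inverse x \<in> F)"

locale algebraic_over =
  fixes F :: "'a::alg_closed_field set"
  assumes sub: "is_subfield F" and alg: "\<And>x. \<exists>p. p \<noteq> 0 \<and> (\<forall>i. coeff p i \<in> F) \<and> poly p x = 0"
begin

text \<open>A partial embedding over \<open>F\<close> is given by its graph. Closure under inverses and injectivity follow
  because everything is algebraic over \<open>F\<close>.\<close>

definition emb :: "('a \<times> 'a) set \<Rightarrow> bool" where
  "emb G \<longleftrightarrow> Id_on F \<subseteq> G \<and> (\<forall>a b c d. (a, b) \<in> G \<longrightarrow> (c, d) \<in> G \<longrightarrow> (a + c, b + d) \<in> G \<and> (a * c, b * d) \<in> G) \<and>
    (\<forall>b. (0, b) \<in> G \<longrightarrow> b = 0)"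

lemma embD:
  assumes "emb G"
  shows "x \<in> F \<Longrightarrow> (x, x) \<in> G" "(a, b) \<in> G \<Longrightarrow> (c, d) \<in> G \<Longrightarrow> (a + c, b + d) \<in> G"
    "(a, b) \<in> G \<Longrightarrow> (c, d) \<in> G \<Longrightarrow> (a * c, b * d) \<in> G" "(0, b) \<in> G \<Longrightarrow> b = 0"
  using assms unfolding emb_def by (blast | auto simp: Id_on_def)+

lemma F_mem: "0 \<in> F" "1 \<in> F" "x \<in> F \<Longrightarrow> - x \<in> F" "x \<in> F \<Longrightarrow> inverse x \<in> F"
  using sub by (auto simp: is_subfield_def)

context
  fixes G assumes G: "emb G"
begin

lemma emb_01: "(0, 0) \<in> G" "(1, 1) \<in> G"
  using embD(1)[OF G] F_mem by auto

lemma emb_minus: "(a, b) \<in> G \<Longrightarrow> (- a, - b) \<in> G"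
  using embD(3)[OF G embD(1)[OF G F_mem(3)[OF F_mem(2)]], of a b] by simp

lemma emb_diff: "(a, b) \<in> G \<Longrightarrow> (c, d) \<in> G \<Longrightarrow> (a - c, b - d) \<in> G"
  using embD(2)[OF G _ emb_minus, of a b c d] by simp

lemma emb_unique: "(a, b) \<in> G \<Longrightarrow> (a, c) \<in> G \<Longrightarrow> b = c"
  using embD(4)[OF G, of "b - c"] emb_diff[of a b a c] by simp

lemma emb_poly: "(\<forall>i. (coeff p i, coeff q i) \<in> G) \<Longrightarrow> (a, b) \<in> G \<Longrightarrow> (poly p a, poly q b) \<in> G"
proof (induction p arbitrary: q)
  case 0
  then have "coeff q i = 0" for i using embD(4)[OF G] by simp
  then have "q = 0" by (intro poly_eqI) simp
  then show ?case using emb_01 by simp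
next
  case (pCons c p)
  obtain d q' where q: "q = pCons d q'" by (metis pCons_cases)
  have "(coeff p i, coeff q' i) \<in> G" for i using pCons(3)[THEN spec, of "Suc i"] q by simp
  then have "(poly p a, poly q' b) \<in> G" using pCons by blast
  moreover have "(c, d) \<in> G" using pCons(3)[THEN spec, of 0] q by simp
  ultimately show ?case unfolding q using embD(2,3)[OF G] pCons(4) by simp
qed

text \<open>Stripping powers of X from a polynomial that annihilates a leaves c + X r over F with c
  \<noteq> 0, so 1/a = -r(a)/c. The same equation holds for b because the embedding fixes the
  coefficients.\<close>

lemma emb_inverse: assumes ab: "(a, b) \<in> G" "a \<noteq> 0" shows "b \<noteq> 0" "(inverse a, inverse b) \<in> G"
proof -
  obtain p where p: "p \<noteq> 0" "\<forall>i. coeff p i \<in> F" "poly p a = 0" using alg[of a] by blast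
  obtain q where q: "p = [:-0, 1:] ^ order 0 p * q" "\<not> [:-0, 1:] dvd q"
    using order_decomp[OF p(1)] by blast
  have q0: "coeff q 0 \<noteq> 0" using q(2) by (metis minus_zero poly_0_coeff_0 poly_eq_0_iff_dvd)
  define k where "k = order 0 p"
  have "p = monom 1 k * q" using q(1) unfolding k_def[symmetric] by (simp add: monom_altdef)
  then have "coeff q i = coeff p (i + k)" for i by (simp add: coeff_monom_mult)
  then have qF: "coeff q i \<in> F" for i using p(2) by simp
  have qa: "poly q a = 0" using p(3) ab(2) by (subst (asm) q(1)) simp
  obtain c r where cr: "q = pCons c r" by (metis pCons_cases)
  have c: "c \<noteq> 0" "c \<in> F" using q0 qF[of 0] cr by auto
  have rF: "coeff r i \<in> F" for i using qF[of "Suc i"] cr by simp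
  have r: "(poly r a, poly r b) \<in> G" using emb_poly[of r r a b] rF embD(1)[OF G] ab(1) by blast
  have "(poly q a, poly q b) \<in> G" using emb_poly[of q q a b] qF embD(1)[OF G] ab(1) by blast
  then have "poly q b = 0" using qa embD(4)[OF G] by simp
  then have eb: "b * (- poly r b * inverse c) = 1" and ea: "a * (- poly r a * inverse c) = 1"
    using qa c(1) unfolding cr by (simp_all add: field_simps eq_neg_iff_add_eq_0 neg_eq_iff_add_eq_0 add.commute)
  then show "b \<noteq> 0" by auto
  have "(- poly r a * inverse c, - poly r b * inverse c) \<in> G"
    using embD(3)[OF G emb_minus[OF r] embD(1)[OF G F_mem(4)[OF c(2)]]] .
  moreover have "- poly r a * inverse c = inverse a" "- poly r b * inverse c = inverse b"
    using ea eb by (metis inverse_unique)+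
  ultimately show "(inverse a, inverse b) \<in> G" by simp
qed

text \<open>The coefficientwise extension of the embedding: q is the image of p.\<close>

definition gp :: "'a poly \<Rightarrow> 'a poly \<Rightarrow> bool" where
  "gp p q \<longleftrightarrow> (\<forall>i. (coeff p i, coeff q i) \<in> G)"

lemma gp_0: "gp 0 q \<Longrightarrow> q = 0"
  by (rule poly_eqI) (simp add: gp_def embD(4)[OF G])

lemma gp_degree: assumes "gp p q" shows "degree q = degree p"
proof -
  have *: "coeff p i = 0 \<longleftrightarrow> coeff q i = 0" for i
  proof -
    have pq: "(coeff p i, coeff q i) \<in> G" using assms by (simp add: gp_def)
    show ?thesis
    proof (cases "coeff p i = 0")
      case True
      then show ?thesis using embD(4)[OF G, of "coeff q i"] pq by simp
    next
      case False
      then show ?thesis using emb_inverse(1)[OF pq] by simp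
    qed
  qed
  show ?thesis
  proof (rule antisym)
    show "degree q \<le> degree p" by (rule degree_le) (simp add: coeff_eq_0 flip: *)
    show "degree p \<le> degree q" by (rule degree_le) (simp add: coeff_eq_0 *)
  qed
qed

lemma gp_add: "gp p q \<Longrightarrow> gp p' q' \<Longrightarrow> gp (p + p') (q + q')"
  using embD(2)[OF G] by (simp add: gp_def)

lemma gp_diff: "gp p q \<Longrightarrow> gp p' q' \<Longrightarrow> gp (p - p') (q - q')"
  using emb_diff by (simp add: gp_def)

lemma gp_pCons: "(c, d) \<in> G \<Longrightarrow> gp p q \<Longrightarrow> gp (pCons c p) (pCons d q)"
  by (simp add: gp_def coeff_pCons split: nat.splits)

lemma gp_smult: "(c, d) \<in> G \<Longrightarrow> gp p q \<Longrightarrow> gp (smult c p) (smult d q)"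
  using embD(3)[OF G] by (simp add: gp_def)

lemma gp_mult: "gp p q \<Longrightarrow> gp p' q' \<Longrightarrow> gp (p * p') (q * q')"
proof (induction p arbitrary: q)
  case 0
  then have "q = 0" using gp_0 by blast
  then show ?case using emb_01 by (simp add: gp_def)
next
  case (pCons c p)
  obtain d r where q: "q = pCons d r" by (metis pCons_cases)
  have "gp p r" using pCons(3) q unfolding gp_def by (metis coeff_pCons_Suc)
  moreover have "(c, d) \<in> G" using pCons(3) q unfolding gp_def by (metis coeff_pCons_0)
  ultimately show ?case unfolding q mult_pCons_left
    by (intro gp_add gp_smult gp_pCons emb_01 pCons)
qed

lemma gp_monom_mult: "(c, d) \<in> G \<Longrightarrow> gp p q \<Longrightarrow> gp (monom c n * p) (monom d n * q)"
  by (rule gp_mult) (auto simp: gp_def emb_01)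

text \<open>\<mu> is the minimal polynomial of a over the domain of G, and \<nu> its image. Division
  with remainder runs on p and q in parallel, cancelling corresponding leading terms, so that \<nu>
  dvd q comes along with \<mu> dvd p.\<close>

lemma min_poly:
  obtains \<mu> \<nu> where "gp \<mu> \<nu>" "lead_coeff \<mu> = 1" "lead_coeff \<nu> = 1" "poly \<mu> a = 0" "degree \<nu> = degree \<mu>" "degree \<mu> > 0"
    "\<forall>p q. gp p q \<longrightarrow> poly p a = 0 \<longrightarrow> \<mu> dvd p \<and> \<nu> dvd q"
proof -
  define Q where "Q = (\<lambda>n. \<exists>p q. p \<noteq> 0 \<and> gp p q \<and> poly p a = 0 \<and> degree p = n)"
  obtain p0 where "p0 \<noteq> 0" "\<forall>i. coeff p0 i \<in> F" "poly p0 a = 0" using alg[of a] by blast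
  then have "Q (degree p0)" unfolding Q_def gp_def using embD(1)[OF G] by blast
  then have "Q (LEAST n. Q n)" by (rule LeastI)
  then obtain \<mu>0 \<nu>0 where 0: "\<mu>0 \<noteq> 0" "gp \<mu>0 \<nu>0" "poly \<mu>0 a = 0" "degree \<mu>0 = (LEAST n. Q n)"
    unfolding Q_def by blast
  have least: "degree \<mu>0 \<le> degree p" if "p \<noteq> 0" "gp p q" "poly p a = 0" for p q
    unfolding 0(4) by (rule Least_le) (use that in \<open>auto simp: Q_def\<close>)
  define c d where "c = lead_coeff \<mu>0" and "d = coeff \<nu>0 (degree \<mu>0)"
  have cd: "(c, d) \<in> G" "c \<noteq> 0" using 0(1,2) by (simp_all add: c_def d_def gp_def)
  define \<mu> \<nu> where "\<mu> = smult (inverse c) \<mu>0" and "\<nu> = smult (inverse d) \<nu>0"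
  have gp: "gp \<mu> \<nu>" unfolding \<mu>_def \<nu>_def by (rule gp_smult[OF emb_inverse(2)[OF cd] 0(2)])
  have l1: "lead_coeff \<mu> = 1" using cd by (simp add: \<mu>_def c_def)
  have deg: "degree \<nu> = degree \<mu>" by (rule gp_degree[OF gp])
  have "(lead_coeff \<mu>, lead_coeff \<nu>) \<in> G" using gp deg by (simp add: gp_def)
  then have l2: "lead_coeff \<nu> = 1" using emb_unique[OF _ emb_01(2), of "lead_coeff \<nu>"] unfolding l1 by simp
  have rt: "poly \<mu> a = 0" using 0 by (simp add: \<mu>_def)
  have dpos: "degree \<mu> > 0"
  proof (rule ccontr)
    assume "\<not> degree \<mu> > 0"
    then obtain k where "\<mu> = [:k:]" by (metis degree_eq_zeroE gr0I)
    then show False using rt l1 by simp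
  qed
  have deg\<mu>: "degree \<mu> = degree \<mu>0" using cd by (simp add: \<mu>_def)
  have "\<mu> dvd p \<and> \<nu> dvd q" if "gp p q" "poly p a = 0" for p q
    using that
  proof (induction "degree p" arbitrary: p q rule: less_induct)
    case less
    show ?case
    proof (cases "p = 0")
      case True
      then show ?thesis using gp_0 less by auto
    next
      case False
      then have le: "degree \<mu> \<le> degree p" using least less deg\<mu> by metis
      define e k where "e = lead_coeff p" and "k = coeff q (degree p)"
      define n where "n = degree p - degree \<mu>"
      have ek: "(e, k) \<in> G" using less(2) by (simp add: gp_def e_def k_def)
      define p' q' where "p' = p - monom e n * \<mu>" and "q' = q - monom k n * \<nu>"
      have gp': "gp p' q'" unfolding p'_def q'_def by (intro gp_diff gp_monom_mult less ek gp)
      have rt': "poly p' a = 0" using less rt by (simp add: p'_def)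
      have "\<mu> dvd p' \<and> \<nu> dvd q'"
      proof (cases "p' = 0")
        case True
        then show ?thesis using gp' gp_0 by auto
      next
        case p0: False
        have "degree (monom e n * \<mu>) = degree p"
        proof -
          have "e \<noteq> 0" "\<mu> \<noteq> 0" using False l1 by (auto simp: e_def)
          then show ?thesis using le by (simp add: degree_mult_eq degree_monom_eq n_def)
        qed
        then have "degree p' \<le> degree p" unfolding p'_def by (intro degree_diff_le) auto
        moreover have "coeff p' (degree p) = 0"
          using le l1 by (simp add: p'_def coeff_monom_mult n_def e_def)
        ultimately have "degree p' < degree p"
          using p0 by (metis leading_coeff_0_iff le_neq_implies_less)
        then show ?thesis using less(1) gp' rt' by blast
      qed
      moreover have "p = p' + monom e n * \<mu>" "q = q' + monom k n * \<nu>" by (simp_all add: p'_def q'_def)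
      ultimately show ?thesis by (metis dvd_add dvd_triv_right)
    qed
  qed
  then show ?thesis using that[OF gp l1 l2 rt deg dpos] by blast
qed

text \<open>The extension sends p(a) to q(b) for corresponding p and q. It is well defined because
  p(a) = 0 makes q a multiple of \<nu>, hence q(b) = 0.\<close>

lemma emb_extend:
  assumes "poly \<nu> b = 0" "\<And>p q. gp p q \<Longrightarrow> poly p a = 0 \<Longrightarrow> \<nu> dvd q"
  obtains G' where "emb G'" "G \<subseteq> G'" "(a, b) \<in> G'"
proof -
  define G' where "G' = {(poly p a, poly q b) | p q. gp p q}"
  have sub: "G \<subseteq> G'"
  proof
    fix z assume "z \<in> G"
    then obtain c d where z: "z = (c, d)" "(c, d) \<in> G" by (cases z) auto
    then have "gp [:c:] [:d:]" using gp_pCons[of c d 0 0] emb_01 by (simp add: gp_def)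
    then show "z \<in> G'" unfolding G'_def z(1) by (intro CollectI exI[of _ "[:c:]"] exI[of _ "[:d:]"]) simp
  qed
  have "gp [:0, 1:] [:0, 1:]" using emb_01 by (simp add: gp_def coeff_pCons split: nat.splits)
  then have "(a, b) \<in> G'" unfolding G'_def by (intro CollectI exI[of _ "[:0, 1:]"]) simp
  moreover have "emb G'"
    unfolding emb_def
  proof (intro conjI allI impI)
    show "Id_on F \<subseteq> G'" using sub G unfolding emb_def by blast
  next
    fix x y z w assume "(x, y) \<in> G'" "(z, w) \<in> G'"
    then obtain p q p' q' where *: "gp p q" "gp p' q'" "x = poly p a" "y = poly q b" "z = poly p' a" "w = poly q' b"
      unfolding G'_def by blast
    have "(poly (p + p') a, poly (q + q') b) \<in> G'" unfolding G'_def using gp_add[OF *(1,2)] by blast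
    then show "(x + z, y + w) \<in> G'" using * by simp
    have "(poly (p * p') a, poly (q * q') b) \<in> G'" unfolding G'_def using gp_mult[OF *(1,2)] by blast
    then show "(x * z, y * w) \<in> G'" using * by simp
  next
    fix y assume "(0, y) \<in> G'"
    then obtain p q where *: "gp p q" "poly p a = 0" "y = poly q b" unfolding G'_def by auto
    then have "\<nu> dvd q" using assms(2) by blast
    then show "y = 0" using * assms(1) by (auto elim!: dvdE)
  qed
  ultimately show ?thesis using that sub by blast
qed

end

section \<open>Automorphisms over F and the elements they fix\<close>

text \<open>Zorn's lemma on graphs. A maximal embedding is defined everywhere, as any a can be sent
  to a root of the image of its minimal polynomial.\<close>

lemma emb_total_extension:
  assumes G: "emb G"
  obtains M where "emb M" "G \<subseteq> M" "\<And>a. \<exists>b. (a, b) \<in> M"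
proof -
  have "\<exists>M\<in>{H. emb H \<and> G \<subseteq> H}. \<forall>N\<in>{H. emb H \<and> G \<subseteq> H}. M \<subseteq> N \<longrightarrow> N = M"
  proof (rule subset_Zorn_nonempty)
    show "{H. emb H \<and> G \<subseteq> H} \<noteq> {}" using G by blast
    fix C assume C: "C \<noteq> {}" "subset.chain {H. emb H \<and> G \<subseteq> H} C"
    then have CH: "\<And>H. H \<in> C \<Longrightarrow> emb H \<and> G \<subseteq> H" and tot: "\<And>H K. H \<in> C \<Longrightarrow> K \<in> C \<Longrightarrow> H \<subseteq> K \<or> K \<subseteq> H"
      unfolding subset.chain_def by blast+
    obtain H0 where H0: "H0 \<in> C" using C by blast
    have "emb (\<Union>C)"
      unfolding emb_def
    proof (intro conjI allI impI)
      show "Id_on F \<subseteq> \<Union>C" using CH[OF H0] H0 unfolding emb_def by blast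
    next
      fix x y z w assume "(x, y) \<in> \<Union>C" "(z, w) \<in> \<Union>C"
      then obtain H K where HK: "H \<in> C" "K \<in> C" "(x, y) \<in> H" "(z, w) \<in> K" by blast
      then obtain L where L: "L \<in> C" "(x, y) \<in> L" "(z, w) \<in> L" using tot[OF HK(1,2)] by blast
      then show "(x + z, y + w) \<in> \<Union>C" "(x * z, y * w) \<in> \<Union>C" using CH[OF L(1)] embD(2,3) by blast+
    next
      fix y assume "(0, y) \<in> \<Union>C"
      then show "y = 0" using CH embD(4) by blast
    qed
    then show "\<Union>C \<in> {H. emb H \<and> G \<subseteq> H}" using CH[OF H0] H0 by blast
  qed
  then obtain M where "M \<in> {H. emb H \<and> G \<subseteq> H}" and mx: "\<forall>N\<in>{H. emb H \<and> G \<subseteq> H}. M \<subseteq> N \<longrightarrow> N = M" by (rule bexE)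
  then have M: "emb M" "G \<subseteq> M" by simp_all
  have max: "N = M" if "emb N" "M \<subseteq> N" for N using mx that M(2) by (metis mem_Collect_eq order_trans)
  have "\<exists>b. (a, b) \<in> M" for a
  proof -
    obtain \<mu> \<nu> where "gp M \<mu> \<nu>" "lead_coeff \<mu> = 1" and mn: "lead_coeff \<nu> = 1"
      and "poly \<mu> a = 0" and mn2: "degree \<nu> = degree \<mu>" "degree \<mu> > 0"
      "\<forall>p q. gp M p q \<longrightarrow> poly p a = 0 \<longrightarrow> \<mu> dvd p \<and> \<nu> dvd q"
      using min_poly[OF M(1), of a] by blast
    obtain b where b: "poly \<nu> b = 0" using alg_closed_imp_poly_has_root[of \<nu>] mn2 by auto
    have "\<And>p q. gp M p q \<Longrightarrow> poly p a = 0 \<Longrightarrow> \<nu> dvd q" using mn2(3) by blast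
    then obtain N where "emb N" "M \<subseteq> N" "(a, b) \<in> N" by (rule emb_extend[OF M(1) b])
    then show ?thesis using max by blast
  qed
  then show ?thesis using that M by blast
qed

text \<open>Surjectivity holds because \<sigma> maps the finite root set of a polynomial over F
  injectively into itself, and every y lies in such a set.\<close>

lemma emb_automorphism:
  assumes M: "emb M" and tot: "\<And>a. \<exists>b. (a, b) \<in> M"
  obtains \<sigma> where "field_aut \<sigma>" "\<And>a b. (a, b) \<in> M \<Longrightarrow> \<sigma> a = b"
proof -
  define \<sigma> where "\<sigma> a = (THE b. (a, b) \<in> M)" for a
  have \<sigma>: "\<sigma> a = b \<longleftrightarrow> (a, b) \<in> M" for a b
    using tot[of a] emb_unique[OF M] unfolding \<sigma>_def by (metis the_equality)
  then have mem: "(a, \<sigma> a) \<in> M" for a by blast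
  have add: "\<sigma> (x + y) = \<sigma> x + \<sigma> y" and mult: "\<sigma> (x * y) = \<sigma> x * \<sigma> y" for x y
    unfolding \<sigma> using embD(2,3)[OF M mem mem] by blast+
  have inj: "inj \<sigma>"
  proof (rule injI)
    fix x y assume "\<sigma> x = \<sigma> y"
    then have "(x - y, 0) \<in> M" using emb_diff[OF M mem[of x] mem[of y]] by simp
    then show "x = y" using emb_inverse(1)[OF M, of "x - y" 0] by auto
  qed
  have "\<exists>x. \<sigma> x = y" for y
  proof -
    obtain p where p: "p \<noteq> 0" "\<forall>i. coeff p i \<in> F" "poly p y = 0" using alg[of y] by blast
    define R where "R = {x. poly p x = 0}"
    have "finite R" unfolding R_def using p(1) by (rule poly_roots_finite)
    moreover have "\<sigma> x \<in> R" if "x \<in> R" for x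
    proof -
      have "(poly p x, poly p (\<sigma> x)) \<in> M" using emb_poly[OF M, of p p] p(2) embD(1)[OF M] mem by blast
      then show ?thesis using that embD(4)[OF M] by (simp add: R_def)
    qed
    ultimately have "\<sigma> ` R = R" using inj by (intro endo_inj_surj) (auto intro: inj_on_subset)
    moreover have "y \<in> R" using p(3) by (simp add: R_def)
    ultimately show ?thesis by (metis imageE)
  qed
  then have "surj \<sigma>" by (metis surj_def)
  then have "field_aut \<sigma>" using inj add mult by (simp add: field_aut_def bij_def)
  then show ?thesis using that \<sigma> by blast
qed

lemma emb_Id_on: "emb (Id_on F)"
  using sub by (auto simp: emb_def is_subfield_def Id_on_def)

text \<open>If a were outside F, its minimal polynomial, with a as a simple root, would have another
  root b; the embedding a \<mapsto> b extends to an automorphism over F that moves a.\<close>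

theorem fixed_imp_mem:
  assumes p: "\<And>i. coeff p i \<in> F" "poly p a = 0" "poly (pderiv p) a \<noteq> 0"
    and fixed: "\<And>\<sigma>. field_aut \<sigma> \<Longrightarrow> (\<And>x. x \<in> F \<Longrightarrow> \<sigma> x = x) \<Longrightarrow> \<sigma> a = a"
  shows "a \<in> F"
proof (rule ccontr)
  assume aF: "a \<notin> F"
  note G = emb_Id_on
  obtain \<mu> \<nu> where mn: "gp (Id_on F) \<mu> \<nu>" "lead_coeff \<mu> = 1" and "lead_coeff \<nu> = 1"
    and mn3: "poly \<mu> a = 0" and "degree \<nu> = degree \<mu>" "degree \<mu> > 0"
    and mn5: "\<forall>p q. gp (Id_on F) p q \<longrightarrow> poly p a = 0 \<longrightarrow> \<mu> dvd p \<and> \<nu> dvd q"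
    using min_poly[OF G, of a] by blast
  have eq: "\<nu> = \<mu>" using mn(1) unfolding gp_def[OF G] by (intro poly_eqI) (auto simp: Id_on_def)
  have "\<mu> dvd p" using mn5 p unfolding gp_def[OF G] by auto
  then obtain s where s: "p = \<mu> * s" by (elim dvdE)
  obtain \<rho> where \<rho>: "\<mu> = [:-a, 1:] * \<rho>" using mn3 by (auto simp: poly_eq_0_iff_dvd elim: dvdE)
  have "poly (pderiv \<mu>) a = poly \<rho> a" unfolding \<rho> by (subst pderiv_mult) (simp add: pderiv_pCons)
  \<comment> \<open>Simplicity of the root passes from p to its divisor \<mu>, so the cofactor
    \<rho> does not vanish at a.\<close>
  moreover have "poly (pderiv p) a = poly (pderiv \<mu>) a * poly s a"
    unfolding s pderiv_mult using mn3 by (simp add: mult.commute)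
  ultimately have \<rho>a: "poly \<rho> a \<noteq> 0" using p(3) by auto
  have "degree \<rho> > 0"
  proof (rule ccontr)
    assume "\<not> degree \<rho> > 0"
    then obtain k where k: "\<rho> = [:k:]" by (metis degree_eq_zeroE gr0I)
    then have "\<mu> = [:- a * k, k:]" unfolding \<rho> by simp
    moreover have "k \<noteq> 0" using \<rho>a k by simp
    ultimately have "k = 1" using mn(2) by simp
    then have "coeff \<mu> 0 = - a" using \<open>\<mu> = [:- a * k, k:]\<close> by simp
    then have "- a \<in> F" using mn(1) unfolding gp_def[OF G] by (auto simp: Id_on_def dest: spec[of _ 0])
    then show False using aF F_mem(3)[of "- a"] by simp
  qed
  then obtain b where b: "poly \<rho> b = 0" using alg_closed_imp_poly_has_root by blast
  then have "b \<noteq> a" using \<rho>a by auto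
  have "poly \<nu> b = 0" unfolding eq \<rho> using b by simp
  moreover have "\<And>p q. gp (Id_on F) p q \<Longrightarrow> poly p a = 0 \<Longrightarrow> \<nu> dvd q" using mn5 by blast
  ultimately obtain G' where G': "emb G'" "Id_on F \<subseteq> G'" "(a, b) \<in> G'" by (rule emb_extend[OF G])
  obtain M where M: "emb M" "G' \<subseteq> M" "\<And>a. \<exists>b. (a, b) \<in> M" using emb_total_extension[OF G'(1)] by blast
  obtain \<sigma> where \<sigma>: "field_aut \<sigma>" "\<And>a b. (a, b) \<in> M \<Longrightarrow> \<sigma> a = b" using emb_automorphism[OF M(1,3)] by blast
  have "\<sigma> x = x" if "x \<in> F" for x
    using \<sigma>(2)[of x x] that M(2) G'(2) by (meson Id_onI subsetD)
  then have "\<sigma> a = a" by (rule fixed[OF \<sigma>(1)])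
  then show False using \<sigma>(2)[of a b] G' M(2) \<open>b \<noteq> a\<close> by auto
qed

end

subsection \<open>Fields generated by torsion points\<close>

text \<open>\<open>adjoin\<close> is phrased with record operations of a ring; this and the next two
  facts identify them with those of the type class.\<close>

lemma type_algebra_minus: "\<ominus>\<^bsub>ring_of_type_algebra\<^esub> (x :: 'a::field) = - x"
proof -
  interpret field "ring_of_type_algebra :: 'a ring" by rule
  show ?thesis by (rule minus_equality) (simp_all add: ring_of_type_algebra_def)
qed

lemma type_algebra_inverse:
  assumes "x \<noteq> 0" shows "inv\<^bsub>ring_of_type_algebra\<^esub> (x :: 'a::field) = inverse x"
proof -
  interpret field "ring_of_type_algebra :: 'a ring" by rule
  show ?thesis by (rule inv_char) (use assms in \<open>simp_all add: ring_of_type_algebra_def\<close>)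
qed

lemma type_algebra_simps:
  "\<one>\<^bsub>ring_of_type_algebra\<^esub> = (1 :: 'a::field)" "\<zero>\<^bsub>ring_of_type_algebra\<^esub> = (0 :: 'a::field)"
  "x \<oplus>\<^bsub>ring_of_type_algebra\<^esub> y = x + (y :: 'a::field)" "x \<otimes>\<^bsub>ring_of_type_algebra\<^esub> y = x * (y :: 'a::field)"
  by (simp_all add: ring_of_type_algebra_def)

lemma adjoin_incl: "range to_ac \<subseteq> adjoin S" "S \<subseteq> adjoin S"
  unfolding adjoin_def by (auto intro: generate_field.incl)

lemma is_subfield_adjoin: "is_subfield (adjoin S)"
proof -
  have one: "1 \<in> adjoin S"
    unfolding adjoin_def by (metis generate_field.one type_algebra_simps(1))
  have minus: "- x \<in> adjoin S" if "x \<in> adjoin S" for x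
    using that unfolding adjoin_def using generate_field.a_inv[of x ring_of_type_algebra]
    by (simp add: type_algebra_minus)
  have add: "x + y \<in> adjoin S" if "x \<in> adjoin S" "y \<in> adjoin S" for x y
    using that unfolding adjoin_def using generate_field.eng_add[of x ring_of_type_algebra _ y]
    by (simp add: type_algebra_simps)
  have mult: "x * y \<in> adjoin S" if "x \<in> adjoin S" "y \<in> adjoin S" for x y
    using that unfolding adjoin_def using generate_field.eng_mult[of x ring_of_type_algebra _ y]
    by (simp add: type_algebra_simps)
  have zero: "0 \<in> adjoin S" using add[OF one minus[OF one]] by simp
  have "inverse x \<in> adjoin S" if "x \<in> adjoin S" for x
  proof (cases "x = 0")
    case False
    then show ?thesis
      using that unfolding adjoin_def using generate_field.m_inv[of x ring_of_type_algebra]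
      by (simp add: type_algebra_simps type_algebra_inverse)
  qed (use zero in simp)
  then show ?thesis using zero one add mult minus by (simp add: is_subfield_def)
qed

lemma adjoin_minimal:
  assumes F: "is_subfield F" "range to_ac \<subseteq> F" "S \<subseteq> F" shows "adjoin S \<subseteq> F"
proof
  fix x assume "x \<in> adjoin S"
  then show "x \<in> F" unfolding adjoin_def
    by (induction rule: generate_field.induct)
      (use F in \<open>auto simp: is_subfield_def type_algebra_simps type_algebra_minus type_algebra_inverse\<close>)
qed

lemma adjoin_eqI:
  assumes "S \<subseteq> adjoin T" "T \<subseteq> adjoin S" shows "adjoin S = adjoin T"
  using adjoin_minimal[OF is_subfield_adjoin adjoin_incl(1) assms(1)]
    adjoin_minimal[OF is_subfield_adjoin adjoin_incl(1) assms(2)] by blast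

text \<open>Every element is algebraic over the base field, whose image lies in
  \<open>adjoin S\<close>.\<close>

lemma algebraic_over_adjoin: "algebraic_over (adjoin S)"
proof
  show "is_subfield (adjoin S)" by (rule is_subfield_adjoin)
  fix x :: "'a alg_closure"
  obtain p :: "'a poly" where p: "p \<noteq> 0" "poly (map_poly to_ac p) x = 0" by (rule alg_closure_algebraic)
  have "map_poly to_ac p \<noteq> 0" using p(1) by (simp add: map_poly_eq_0_iff)
  moreover have "coeff (map_poly to_ac p) i \<in> adjoin S" for i
    using adjoin_incl(1) by (auto simp: coeff_map_poly)
  ultimately show "\<exists>p. p \<noteq> 0 \<and> (\<forall>i. coeff p i \<in> adjoin S) \<and> poly p x = 0" using p(2) by blast
qed

context weil begin

lemma wp_neg_neg: "S \<in> tors \<Longrightarrow> T \<in> tors \<Longrightarrow> wp (neg S) (neg T) = wp S T"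
  by (simp add: wp_neg_left wp_neg_right tors_neg)

text \<open>Ensures nonzero ordinates, so that the two points above x1, and likewise those above x2,
  are distinct and the sign of the image of each Pi is well defined.\<close>

lemma basis_order_gt_2:
  assumes "m \<ge> 3" shows "P1 \<uplus> P1 \<noteq> Infinity" "P2 \<uplus> P2 \<noteq> Infinity"
proof -
  have "\<not> m dvd 2" using assms by (auto dest: dvd_imp_le)
  then show "P1 \<uplus> P1 \<noteq> Infinity" "P2 \<uplus> P2 \<noteq> Infinity"
    using independent[of 2 0] independent[of 0 2] by (auto simp: mult_pt_Suc numeral_2_eq_2)
qed

end

text \<open>Changing exactly one sign inverts \<zeta> and negates y1 y2. Both changes are visible
  because \<zeta> differs from its inverse and 2 y1 y2 is nonzero.\<close>

lemma (in weil) aut_fixes_iff: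
  assumes \<sigma>: "field_aut \<sigma>" "\<sigma> (wa2 E) = wa2 E" "\<sigma> (wa4 E) = wa4 E" "\<sigma> (wa6 E) = wa6 E"
    and P: "P1 = Affine x1 y1" "P2 = Affine x2 y2" and x: "\<sigma> x1 = x1" "\<sigma> x2 = x2" and m3: "m \<ge> 3"
  shows "\<sigma> (wp P1 P2) = wp P1 P2 \<longleftrightarrow> \<sigma> (y1 * y2) = y1 * y2"
proof -
  interpret weil_aut E m P1 P2 \<sigma> by unfold_locales (use \<sigma> in auto)
  have oc: "on_curve E x1 y1" "on_curve E x2 y2" using P12 P by (auto simp: tors_iff)
  have y0: "y1 \<noteq> 0" "y2 \<noteq> 0"
    using basis_order_gt_2[OF m3] P by (auto simp: add_pt.simps(3) a1 a3)
  have sgn: "\<sigma> y = y \<or> \<sigma> y = - y" if "on_curve E x y" "\<sigma> x = x" for x y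
  proof -
    have "(\<sigma> y) ^ 2 = y ^ 2"
      using that on_curve_aut[of x y] by (simp add: on_curve_iff)
    then show ?thesis by (simp add: power2_eq_iff)
  qed
  define z where "z = wp P1 P2"
  have sz: "\<sigma> z = wp (Affine x1 (\<sigma> y1)) (Affine x2 (\<sigma> y2))"
    using wp_aut[OF P12] by (simp add: z_def P x)
  have neg: "neg P1 = Affine x1 (- y1)" "neg P2 = Affine x2 (- y2)" by (simp_all add: P)
  have yy: "y1 * y2 \<noteq> - (y1 * y2)" using y0 eq_minus_self_iff[of "y1 * y2"] by simp
  have "z \<noteq> 0" using wp_power_m[OF P12] m by (auto simp: z_def power_0_left)
  have zz: "inverse z \<noteq> z"
  proof
    assume "inverse z = z"
    then have "z ^ 2 = 1" using \<open>z \<noteq> 0\<close> by (metis power2_eq_square right_inverse)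
    then show False using wp_basis_square[OF m3] by (simp add: z_def)
  qed
  have my: "\<sigma> (y1 * y2) = \<sigma> y1 * \<sigma> y2" by (rule aut_mult[OF aut])
  from sgn[OF oc(1) x(1)] sgn[OF oc(2) x(2)] show ?thesis unfolding z_def[symmetric] my
  proof (elim disjE)
    assume s: "\<sigma> y1 = y1" "\<sigma> y2 = y2"
    then have "\<sigma> z = z" using sz by (simp add: z_def P)
    then show "(\<sigma> z = z) = (\<sigma> y1 * \<sigma> y2 = y1 * y2)" using s by simp
  next
    assume s: "\<sigma> y1 = - y1" "\<sigma> y2 = - y2"
    then have "\<sigma> z = z" using sz wp_neg_neg[OF P12] by (simp add: neg z_def)
    then show "(\<sigma> z = z) = (\<sigma> y1 * \<sigma> y2 = y1 * y2)" using s by simp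
  next
    assume s: "\<sigma> y1 = - y1" "\<sigma> y2 = y2"
    then have "\<sigma> z = inverse z" using sz wp_neg_left[OF P12] by (simp add: neg z_def flip: P(2))
    then show "(\<sigma> z = z) = (\<sigma> y1 * \<sigma> y2 = y1 * y2)" using s zz yy by auto
  next
    assume s: "\<sigma> y1 = y1" "\<sigma> y2 = - y2"
    then have "\<sigma> z = inverse z" using sz wp_neg_right[OF P12] by (simp add: neg z_def flip: P(1))
    then show "(\<sigma> z = z) = (\<sigma> y1 * \<sigma> y2 = y1 * y2)" using s zz yy by auto
  qed
qed

theorem theorem2p5:
  fixes E :: "'k::field weierstrass"
    and m :: nat
    and x1 y1 x2 y2 \<zeta> :: "'k alg_closure"
  assumes "elliptic_curve E"
    and "wa1 E = 0" and "wa3 E = 0"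
    and "m \<ge> 2"
    and "CHAR('k) > 0 \<longrightarrow> coprime m CHAR('k)"
    and "torsion_basis (map_weierstrass to_ac E) m (Affine x1 y1) (Affine x2 y2)"
    and "\<zeta> = weil_pairing (map_weierstrass to_ac E) m (Affine x1 y1) (Affine x2 y2)"
  shows "adjoin {x1, x2, \<zeta>} = adjoin {x1, x2, y1 * y2}"
proof -
  define E' where "E' = map_weierstrass to_ac E"
  have wa: "wa1 E' = 0" "wa3 E' = 0" "wa2 E' = to_ac (wa2 E)" "wa4 E' = to_ac (wa4 E)" "wa6 E' = to_ac (wa6 E)"
    using assms(2,3) by (simp_all add: E'_def weierstrass.map_sel)
  have "discriminant E' = to_ac (discriminant E)"
    unfolding discriminant_def Let_def wa assms(2,3) by simp
  then have "discriminant E' \<noteq> 0" using assms(1) by (simp add: elliptic_curve_def)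
  then interpret weil E' m "Affine x1 y1" "Affine x2 y2"
    using wa assms(4,6) by unfold_locales (simp_all add: E'_def)
  have \<zeta>: "\<zeta> = wp (Affine x1 y1) (Affine x2 y2)" using assms(7) by (simp add: E'_def)
  have \<zeta>m: "\<zeta> ^ m = 1" unfolding \<zeta> by (rule wp_power_m[OF P12])
  have oc: "on_curve E' x1 y1" "on_curve E' x2 y2" using P12 by (auto simp: tors_iff)
  have wmem: "to_ac c \<in> adjoin S" for c and S :: "'k alg_closure set" using adjoin_incl(1) by blast
  have mem: "x1 \<in> adjoin (insert x1 S)" "x2 \<in> adjoin (insert x1 (insert x2 S))"
    "z \<in> adjoin {x1, x2, z}" for S z
    by (rule subsetD[OF adjoin_incl(2)], simp)+
  note cl = is_subfield_adjoin[unfolded is_subfield_def]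
  show ?thesis
  proof (cases "m = 2")
    case True
    have y0: "y = 0" if "Affine x y \<in> tors" for x y
    proof -
      have "mm (Affine x y) = Infinity" using that by (simp add: tors_iff)
      then have "add_pt E' (Affine x y) (Affine x y) = Infinity"
        unfolding True numeral_2_eq_2 by (simp add: mult_pt_Suc)
      then show ?thesis using double_eq_0_iff by (auto simp: add_pt.simps(3) a1 a3 Let_def split: if_splits)
    qed
    have "y1 = 0" using y0 P12(1) by blast
    then have "y1 * y2 \<in> adjoin S" for S using cl[of S] by simp
    moreover have "\<zeta> = 1 \<or> \<zeta> = - 1" using \<zeta>m True by (simp add: power2_eq_1_iff)
    then have "\<zeta> \<in> adjoin S" for S using cl[of S] by auto
    ultimately show ?thesis using mem by (intro adjoin_eqI) auto
  next
    case False
    then have m3: "m \<ge> 3" using m by simp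
    note fixes_iff = aut_fixes_iff[OF _ _ _ _ refl refl _ _ m3, folded \<zeta>]
    \<comment> \<open>The parameter z lets the equivalence serve both fields, with z = y1 y2 and
      with z = \<zeta>; an automorphism over either fixes x1, x2 and the coefficients of the
      curve.\<close>
    have iff: "\<sigma> \<zeta> = \<zeta> \<longleftrightarrow> \<sigma> (y1 * y2) = y1 * y2"
      if "field_aut \<sigma>" "\<And>x. x \<in> adjoin {x1, x2, z} \<Longrightarrow> \<sigma> x = x" for \<sigma> z
      using that mem wmem by (intro fixes_iff) (auto simp: wa)
    \<comment> \<open>The condition on the characteristic enters here: the derivative of X^m - 1 is
      nonzero at \<zeta>, which is therefore a simple root.\<close>
    have "of_nat m \<noteq> (0 :: 'k alg_closure)"
    proof
      assume "of_nat m = (0 :: 'k alg_closure)"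
      then have dvd: "CHAR('k) dvd m" by (simp add: of_nat_eq_0_iff_char_dvd)
      then have "CHAR('k) > 0" using m by (auto intro: gr0I)
      then have "coprime m CHAR('k)" using assms(5) by blast
      then have "CHAR('k) = 1" using dvd by (simp add: coprime_absorb_right)
      then show False using CHAR_not_1 by auto
    qed
    moreover have "\<zeta> \<noteq> 0" using \<zeta>m m by (auto simp: power_0_left)
    ultimately have d: "poly (pderiv (monom 1 m - 1)) \<zeta> \<noteq> 0"
      by (simp add: pderiv_diff pderiv_monom poly_monom)
    have "\<zeta> \<in> adjoin {x1, x2, y1 * y2}"
    proof (rule algebraic_over.fixed_imp_mem[OF algebraic_over_adjoin _ _ d])
      show "coeff (monom 1 m - 1) i \<in> adjoin {x1, x2, y1 * y2}" for i
        using wmem[of 0] wmem[of 1] wmem[of "-1"] by (auto simp: coeff_diff coeff_1)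
      show "poly (monom 1 m - 1) \<zeta> = 0" using \<zeta>m by (simp add: poly_monom)
      fix \<sigma> assume \<sigma>: "field_aut \<sigma>" "\<And>x. x \<in> adjoin {x1, x2, y1 * y2} \<Longrightarrow> \<sigma> x = x"
      show "\<sigma> \<zeta> = \<zeta>" using iff[OF \<sigma>] \<sigma>(2)[OF mem(3)] by blast
    qed
    moreover
    have y0: "y1 \<noteq> 0" "y2 \<noteq> 0"
      using basis_order_gt_2[OF m3] by (auto simp: add_pt.simps(3) a1 a3)
    have "y1 * y2 \<in> adjoin {x1, x2, \<zeta>}"
    proof (rule algebraic_over.fixed_imp_mem[OF algebraic_over_adjoin])
      let ?F = "adjoin {x1, x2, \<zeta>}"
      have pow: "x ^ n \<in> ?F" if "x \<in> ?F" for x n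
        by (induction n) (use that cl[of "{x1, x2, \<zeta>}"] in auto)
      have f: "poly f x \<in> ?F" if "x \<in> ?F" for x
        unfolding poly_f wa using pow[OF that] that wmem cl[of "{x1, x2, \<zeta>}"] by simp
      \<comment> \<open>By the curve equations X^2 - (y1 y2)^2 has coefficients in K(x1, x2); its
        root y1 y2 is simple since 2 y1 y2 is nonzero.\<close>
      have "(y1 * y2) ^ 2 = poly f x1 * poly f x2"
        using oc by (simp add: on_curve_iff power_mult_distrib)
      moreover have "poly f x1 * poly f x2 \<in> ?F" using f mem cl[of "{x1, x2, \<zeta>}"] by blast
      ultimately have "- ((y1 * y2) ^ 2) \<in> ?F" using cl[of "{x1, x2, \<zeta>}"] by simp
      then show "coeff [:- ((y1 * y2) ^ 2), 0, 1:] i \<in> ?F" for i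
        using wmem[of 0] wmem[of 1] by (auto simp: coeff_pCons split: nat.splits)
      show "poly [:- ((y1 * y2) ^ 2), 0, 1:] (y1 * y2) = 0" by (simp add: power2_eq_square)
      show "poly (pderiv [:- ((y1 * y2) ^ 2), 0, 1:]) (y1 * y2) \<noteq> 0"
        using y0 double_eq_0_iff[of "y1 * y2"] by (simp add: pderiv_pCons)
      fix \<sigma> assume \<sigma>: "field_aut \<sigma>" "\<And>x. x \<in> ?F \<Longrightarrow> \<sigma> x = x"
      show "\<sigma> (y1 * y2) = y1 * y2" using iff[OF \<sigma>] \<sigma>(2)[OF mem(3)] by blast
    qed
    ultimately show ?thesis using mem by (intro adjoin_eqI) auto
  qed
qed

end
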